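(* Let $p\in\{2,3,5,7,11,13\}$ and let $MC_n$ denote the class in $BP^*\llbracket\xi\rrbracket/(\langle p\rangle\xi)$ defined in the context, written in its normal form (the unique remainder $s=\sum_i s_i\xi^i$ whose polynomial coefficients $s_i\in\mathbb{Z}_{(p)}[v_1,v_2,\ldots]$ have all integer coefficients in $\{0,\ldots,p-1\}$). Then: (1) for $p=2$: $MC_2=(v_1^6+v_2^2)\xi^6+(\text{terms in }\xi^{\ge 7})$ and $MC_4=v_1^4v_2^2\xi^{10}+(\text{terms in }\xi^{\ge11})$; (2) for $p=3$: $MC_4=2v_1^9\xi^{22}+(\text{terms in }\xi^{\ge23})$; (3) for $p=5$: $MC_8=3v_1^{16}\xi^{88}+(\text{higher order terms})$; (4) for $p=7$: $MC_{12}=4v_1^{22}\xi^{192}+(\text{higher order terms})$; (5) for $p=11$: $MC_{20}=9v_1^{34}\xi^{520}+(\text{higher order terms})$; (6) for $p=13$: $MC_{24}=11v_1^{40}\xi^{744}+(\text{higher order terms})$.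
   Context: $BP^*=\mathbb{Z}_{(p)}[v_1,v_2,\ldots]$ with Hazewinkel generators $v_i$ (of cohomological degree $-2(p^i-1)$); $\xi$ has degree $2$. The $BP$ formal group law is $F(x,y)=\exp(\log x+\log y)$ where $\log(x)=\sum_{k\ge0}\ell_kx^{p^k}$, $\ell_0=1$, and $p\,\ell_k=\sum_{i=0}^{k-1}\ell_i v_{k-i}^{p^i}$; $F$ has coefficients in $BP^*$. Write $[i]\xi$ for the $i$-fold formal sum of $\xi$ and $\langle p\rangle\xi=[p]\xi/\xi\in BP^*\llbracket\xi\rrbracket$. Define $a_i=a_i(\xi)\in BP^*\llbracket\xi\rrbracket$ by $\prod_{i=0}^{p-1}([i]\xi+_F x)=\sum_{i\ge0}a_ix^{i+1}$ in $BP^*\llbracket\xi,x\rrbracket$. Let $c_j=p^k\ell_k$ if $j=p^k-1$ for some $k\ge0$ and $c_j=0$ otherwise (these are the images $r_*[\mathbb{C}P^j]$ under Quillen's map $r\colon MU_{(p)}\to BP$). For $n\ge0$ set \[MC_n(\xi)=\sum_{k=0}^n c_{n-k}\cdot\Big(a_0^{2n+1}\big(\textstyle\sum_{i\ge0}a_iz^i\big)^{-(n+1)}\Big)[z^k],\] where $S(z)[z^k]$ denotes the coefficient of $z^k$ (for $k\le n$ this coefficient is a polynomial in the $a_i$), regarded as an element of $BP^*\llbracket\xi\rrbracket/(\langle p\rangle\xi)$. (This equals $r_*q_*\chi^{2n}P_{C_p,MU}[\mathbb{C}P^n]$, where $P_{C_p,MU}$ is tom Dieck's Steenrod power operation, $\chi=\prod_{i=1}^{p-1}[i]\xi$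 and $q_*$ reduces modulo $\langle p\rangle\xi$.) Every element of $BP^*\llbracket\xi\rrbracket$ is congruent modulo $\langle p\rangle\xi$ to a unique series whose coefficients are polynomials in the $v_i$ with integer coefficients in $\{0,\dots,p-1\}$; "$MC_n=c\,\xi^m+$ higher order terms" means this normal form has lowest-order term $c\,\xi^m$. *)

theory Defs
  imports Main "HOL-Library.Poly_Mapping" "HOL-Computational_Algebra.Formal_Power_Series"
begin

unbundle fps_syntax

text \<open>Coefficient ring: polynomials over the rationals in the variables v_1, v_2, ...
  (a monomial is a finitely supported exponent vector nat =>0 nat).
  BP^* = Z_(p)[v_1,v_2,...] is the subring of polynomials all of whose rational
  coefficients have denominator prime to p (predicate bp_poly below).\<close>

type_synonym qpoly = "(nat \<Rightarrow>\<^sub>0 nat) \<Rightarrow>\<^sub>0 rat"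

definition qconst :: "rat \<Rightarrow> qpoly" where
  "qconst c = Poly_Mapping.single 0 c"

definition v :: "nat \<Rightarrow> qpoly" where
  "v i = Poly_Mapping.single (Poly_Mapping.single i 1) 1"

definition bp_poly :: "nat \<Rightarrow> qpoly \<Rightarrow> bool" where
  "bp_poly p f \<longleftrightarrow> (\<forall>m. coprime (snd (quotient_of (Poly_Mapping.lookup f m))) (int p))"

definition bp_series :: "nat \<Rightarrow> qpoly fps \<Rightarrow> bool" where
  "bp_series p s \<longleftrightarrow> (\<forall>i. bp_poly p (s $ i))"

fun ell :: "nat \<Rightarrow> nat \<Rightarrow> qpoly" where
  "ell p 0 = 1"
| "ell p (Suc k) = qconst (1 / of_nat p) * (\<Sum>i<Suc k. ell p i * v (Suc k - i) ^ (p ^ i))"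

definition lg :: "nat \<Rightarrow> qpoly fps" where
  "lg p = Abs_fps (\<lambda>m. \<Sum>k\<in>{k. k \<le> m \<and> p ^ k = m}. ell p k)"

definition ex :: "nat \<Rightarrow> qpoly fps" where
  "ex p = (THE e. e $ 0 = 0 \<and> fps_compose (lg p) e = fps_X)"

text \<open>Two-variable power series in (xi, x): outer variable x, inner variable xi.
  Substitution of a series A with vanishing constant term (in both variables)
  into a one-variable series e.\<close>
definition comp2 :: "'a::comm_ring_1 fps \<Rightarrow> 'a fps fps \<Rightarrow> 'a fps fps" where
  "comp2 e A = Abs_fps (\<lambda>m. Abs_fps (\<lambda>n. \<Sum>k\<le>m + n. e $ k * ((A ^ k) $ m $ n)))"

definition fgl_add :: "nat \<Rightarrow> qpoly fps \<Rightarrow> qpoly fps \<Rightarrow> qpoly fps" where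
  "fgl_add p f g = fps_compose (ex p) (fps_compose (lg p) f + fps_compose (lg p) g)"

definition fgl_add2 :: "nat \<Rightarrow> qpoly fps fps \<Rightarrow> qpoly fps fps \<Rightarrow> qpoly fps fps" where
  "fgl_add2 p A B = comp2 (ex p) (comp2 (lg p) A + comp2 (lg p) B)"

fun fmul :: "nat \<Rightarrow> nat \<Rightarrow> qpoly fps" where
  "fmul p 0 = 0"
| "fmul p (Suc i) = fgl_add p (fmul p i) fps_X"

definition pbr :: "nat \<Rightarrow> qpoly fps" where
  "pbr p = fps_shift 1 (fmul p p)"

definition aa :: "nat \<Rightarrow> nat \<Rightarrow> qpoly fps" where
  "aa p i = (\<Prod>j<p. fgl_add2 p (fps_const (fmul p j)) fps_X) $ (Suc i)"

definition cc :: "nat \<Rightarrow> nat \<Rightarrow> qpoly" where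
  "cc p j = (\<Sum>k\<in>{k. k \<le> j \<and> p ^ k = j + 1}. qconst (of_nat p ^ k) * ell p k)"

text \<open>The coefficient of z^k (k \<le> n) in a_0^(2n+1) (sum_i a_i z^i)^(-(n+1)), written as
  the polynomial in the a_i obtained from the binomial series:
  sum_{j\<le>k} (-1)^j binom(n+j,j) a_0^(n-j) [z^k](sum_{i\<ge>1} a_i z^i)^j.\<close>
definition mc_coeff :: "nat \<Rightarrow> nat \<Rightarrow> nat \<Rightarrow> qpoly fps" where
  "mc_coeff p n k =
     (let A = Abs_fps (\<lambda>i. aa p i) :: qpoly fps fps
      in \<Sum>j\<le>k. (-1) ^ j * of_nat ((n + j) choose j) * aa p 0 ^ (n - j)
                    * (((A - fps_const (aa p 0)) ^ j) $ k))"

definition MC :: "nat \<Rightarrow> nat \<Rightarrow> qpoly fps" where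
  "MC p n = (\<Sum>k\<le>n. fps_const (cc p (n - k)) * mc_coeff p n k)"

definition digit_poly :: "nat \<Rightarrow> qpoly \<Rightarrow> bool" where
  "digit_poly p f \<longleftrightarrow> (\<forall>m. \<exists>d::nat. d < p \<and> Poly_Mapping.lookup f m = of_nat d)"

definition normal_form :: "nat \<Rightarrow> qpoly fps \<Rightarrow> qpoly fps \<Rightarrow> bool" where
  "normal_form p s t \<longleftrightarrow> (\<forall>i. digit_poly p (s $ i)) \<and>
      (\<exists>u. bp_series p u \<and> t - s = pbr p * u)"

definition lowest_term :: "nat \<Rightarrow> qpoly fps \<Rightarrow> nat \<Rightarrow> qpoly \<Rightarrow> bool" where
  "lowest_term p t m c \<longleftrightarrow>
     (\<exists>s. normal_form p s t \<and> (\<forall>i<m. s $ i = 0) \<and> s $ m = c)"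

end

theory Submission
  imports Defs "HOL-Number_Theory.Number_Theory"
begin

text \<open>
  Modulo \<open>\<langle>p\<rangle>\<xi>\<close> the point \<open>\<xi>\<close> is \<open>p\<close>-torsion, so \<open>log \<xi> = 0\<close> after inverting \<open>p\<close>, and multiplication by \<open>p\<close> raises the
  order in \<open>\<xi>\<close> by \<open>q = p - 1\<close>. Measuring series by this order turns the vanishing of the logarithm into
  \<open>1 + \<ell>\<^sub>1 \<xi> ^ (p - 1) + \<ell>\<^sub>2 \<xi> ^ (p\<^sup>2 - 1) + \<dots> = 0\<close>, in which the terms have rapidly growing order, and an integral
  element of high order has a normal form that starts in high degree.

  For odd \<open>p\<close> the series \<open>[i]\<xi> / \<xi>\<close> are approximately \<open>q\<close>-th roots of unity, so power sums over \<open>i\<close> kill all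
  coefficients of the logarithmic derivative of \<open>\<Prod>\<^sub>i ([i]\<xi> +\<^sub>F x)\<close> up to \<open>x ^ (2 q)\<close> except two, which are computed as
  residues after a change of variable. For \<open>n = 2 q\<close> the class is then an explicit cubic plus quartic
  expression in \<open>l = \<ell>\<^sub>2 \<xi> ^ (p\<^sup>2 - 1)\<close> whose coefficients are binomial sums of Wolstenholme type; their \<open>p\<close>-adic valuations
  determine the leading term. For \<open>p = 2\<close> the partial differential equation of the formal group law
  expresses the class as a rational function of \<open>\<ell>\<^sub>2 \<xi>\<^sup>3\<close>, \<open>\<ell>\<^sub>3 \<xi>\<^sup>7\<close> and \<open>\<ell>\<^sub>4 \<xi>\<^sup>1\<^sup>5\<close>.
\<close>

section \<open>Integrality and Frobenius lifts\<close>

text \<open>The recursion for \<open>ell\<close> puts the denominator p^k into the k-th term of the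
  logarithm, while normal forms live in the integral quotient. The order \<open>xo\<close> bridges
  the two: it is defined after multiplication by a power of p, and \<open>xo_imp_ideal\<close>
  returns to integral series because v_1 is a non-zero-divisor modulo p. For odd p the choice n = 2
  q leaves only k = q and k = 2 q with nonzero c_(n-k). In the resulting expression the terms of
  degree 0, 1 and 2 in l cancel, so the cubic term leads. Its coefficient is divisible by p^3 or
  p^4, which raises its order from 3 q^2 towards 4 q^2, the order of l^4. Hence the quartic term
  must be kept and estimated, while l^5 may be dropped; for p = 3 and p = 5 the estimate even needs
  divisibility of the quartic coefficient. For p = 2 the two main summands cancel once more in their
  lowest order, so the class is first written as an explicit polynomial and estimated only
  afterwards.\<close>

locale subring_pred =
  fixes I :: "'a::comm_ring_1 \<Rightarrow> bool"
  assumes one: "I 1"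
    and diff: "I a \<Longrightarrow> I b \<Longrightarrow> I (a - b)"
    and mult: "I a \<Longrightarrow> I b \<Longrightarrow> I (a * b)"
begin

lemma zero: "I 0"
  using diff[OF one one] by simp

lemma neg: "I a \<Longrightarrow> I (- a)"
  using diff[OF zero] by simp

lemma add: "I a \<Longrightarrow> I b \<Longrightarrow> I (a + b)"
  using diff[of a "- b"] neg by simp

lemma sum: "(\<And>i. i \<in> S \<Longrightarrow> I (f i)) \<Longrightarrow> I (sum f S)"
  by (induction S rule: infinite_finite_induct) (auto intro: zero add)

lemma prod: "(\<And>i. i \<in> S \<Longrightarrow> I (f i)) \<Longrightarrow> I (prod f S)"
  by (induction S rule: infinite_finite_induct) (auto intro: one mult)

lemma power: "I a \<Longrightarrow> I (a ^ n)"
  by (induction n) (auto intro: one mult)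

lemma of_nat: "I (of_nat n)"
  by (induction n) (auto intro: zero one add)

lemma of_int: "I (of_int n)"
  by (cases n) (auto intro!: of_nat neg simp del: of_nat_Suc)

lemma numeral: "I (numeral n)"
  using of_nat[of "numeral n"] by simp

lemmas closed = zero one neg add diff mult sum prod power of_nat of_int numeral

text \<open>Each application adds one series variable, so the closure rules for one- and
  two-variable integral series, and later for orders, come from a single locale.\<close>

definition fps_in :: "'a fps \<Rightarrow> bool" where
  "fps_in f \<longleftrightarrow> (\<forall>n. I (f $ n))"

lemma fps_subring: "subring_pred fps_in"
  by unfold_locales (auto simp: fps_in_def fps_mult_nth intro!: closed)

end

section \<open>Rationals and polynomials integral at p\<close>

definition pint :: "nat \<Rightarrow> rat \<Rightarrow> bool" where
  "pint p r \<longleftrightarrow> coprime (snd (quotient_of r)) (int p)"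

text \<open>The reduced denominator divides every other denominator, so closure properties can be
  checked on unreduced fractions.\<close>

lemma pint_iff: "pint p r \<longleftrightarrow> (\<exists>a b. b \<noteq> 0 \<and> coprime b (int p) \<and> r = of_int a / of_int b)"
proof
  assume "pint p r"
  moreover obtain a b where ab: "quotient_of r = (a, b)" by fastforce
  ultimately show "\<exists>a b. b \<noteq> 0 \<and> coprime b (int p) \<and> r = of_int a / of_int b"
    using quotient_of_div[OF ab] quotient_of_denom_pos[OF ab] ab
    by (intro exI[of _ a] exI[of _ b]) (auto simp: pint_def)
next
  assume "\<exists>a b. b \<noteq> 0 \<and> coprime b (int p) \<and> r = of_int a / of_int b"
  then obtain a b where ab: "b \<noteq> 0" "coprime b (int p)" "r = of_int a / of_int b" by blast
  obtain c d where cd: "quotient_of r = (c, d)" by fastforce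
  have "of_int a / of_int b = (of_int c / of_int d :: rat)" "d > 0"
    using quotient_of_div[OF cd] quotient_of_denom_pos[OF cd] ab by auto
  then have "of_int (a * d) = (of_int (c * b) :: rat)"
    using ab(1) by (simp add: field_simps)
  then have "a * d = c * b" by (simp only: of_int_eq_iff)
  then have "d dvd c * b" by (metis dvd_triv_right)
  then have "d dvd b"
    using quotient_of_coprime[OF cd] by (simp add: coprime_dvd_mult_right_iff coprime_commute)
  then show "pint p r"
    using ab(2) cd by (auto simp: pint_def intro: coprime_divisors[OF _ dvd_refl])
qed

lemma pint_subring: "subring_pred (pint p)"
proof
  show "pint p 1" by (auto simp: pint_def)
  fix r s assume "pint p r" "pint p s"
  then obtain a b c d where *: "b \<noteq> 0" "coprime b (int p)" "r = of_int a / of_int b"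
    "d \<noteq> 0" "coprime d (int p)" "s = of_int c / of_int d"
    by (auto simp: pint_iff)
  have "r - s = of_int (a * d - c * b) / of_int (b * d)" "r * s = of_int (a * c) / of_int (b * d)"
    unfolding *(3,6) using *(1,4) by (simp_all add: field_simps)
  moreover have "b * d \<noteq> 0" "coprime (b * d) (int p)" using * by auto
  ultimately show "pint p (r - s)" "pint p (r * s)" unfolding pint_iff by blast+
qed

interpretation pint: subring_pred "pint p" for p
  by (rule pint_subring)

lemma pint_inverse_of_int: "coprime n (int p) \<Longrightarrow> n \<noteq> 0 \<Longrightarrow> pint p (1 / of_int n)"
  unfolding pint_iff by (metis of_int_1)

text \<open>The residue field of the localisation at p is the prime field: the digit of a / b is a
  times an inverse of b modulo p. This is the source of the digits in normal forms.\<close>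

lemma pint_digit:
  assumes "pint p r" "p > 0"
  obtains d s where "d < p" "pint p s" "r = of_nat d + of_nat p * s"
proof -
  obtain a b where ab: "b \<noteq> 0" "coprime b (int p)" "r = of_int a / of_int b"
    using assms by (auto simp: pint_iff)
  obtain c where c: "[b * c = 1] (mod int p)"
    using cong_solve_coprime_int[OF ab(2)] by blast
  define d where "d = nat ((a * c) mod int p)"
  have d: "int d = (a * c) mod int p" using assms by (simp add: d_def)
  have "[int d * b = a * c * b] (mod int p)"
    unfolding d by (simp add: cong_def mod_simps)
  also have "a * c * b = a * (b * c)" by simp
  also have "[\<dots> = a * 1] (mod int p)" using c by (rule cong_scalar_left)
  finally have "int p dvd a - int d * b"
    by (metis cong_iff_dvd_diff cong_sym mult.right_neutral)
  then obtain k where k: "a - int d * b = int p * k" by auto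
  have "of_int a - of_nat d * of_int b = (of_nat p * of_int k :: rat)"
    using arg_cong[OF k, of "of_int :: int \<Rightarrow> rat"] by simp
  then have "r = of_nat d + of_nat p * (of_int k / of_int b)"
    using ab by (simp add: field_simps)
  moreover have "d < p" using d assms by (metis of_nat_less_iff of_nat_0_less_iff pos_mod_bound)
  moreover have "pint p (of_int k / of_int b)" using ab unfolding pint_iff by blast
  ultimately show ?thesis using that by blast
qed

text \<open>Modulo p a p-integral rational equals its digit, and Fermat's little theorem applies to
  the digit. Hence a Frobenius lift may fix all rational constants.\<close>

lemma pint_fermat:
  assumes "pint p r" "prime p"
  shows "pint p ((r ^ p - r) / of_nat p)"
proof -
  obtain d s where ds: "d < p" "pint p s" "r = of_nat d + of_nat p * s"
    using pint_digit[OF assms(1)] assms(2) prime_gt_0_nat by blast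
  have "[d ^ p = d] (mod p)"
  proof (cases "p dvd d")
    case True
    then show ?thesis using assms(2) by (simp add: cong_def prime_gt_0_nat dvd_power_same mod_eq_0_iff_dvd dvd_trans[OF True dvd_power])
  next
    case False
    have "[d ^ (p - 1) * d = 1 * d] (mod p)"
      using fermat_theorem[OF assms(2) False] by (rule cong_scalar_right)
    then show ?thesis using assms(2) prime_gt_0_nat[OF assms(2)]
      by (simp add: power_eq_if mult.commute)
  qed
  then have "int p dvd int d ^ p - int d"
    by (metis cong_iff_dvd_diff cong_int_iff of_nat_power)
  then obtain k where k: "int d ^ p - int d = int p * k" by auto
  have k': "of_nat d ^ p - of_nat d = (of_nat p * of_int k :: rat)"
    using arg_cong[OF k, of "of_int :: int \<Rightarrow> rat"] by simp
  have "r ^ p - of_nat d ^ p = (r - of_nat d) * (\<Sum>i<p. of_nat d ^ (p - Suc i) * r ^ i)"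
    by (rule power_diff_sumr2)
  then have "(r ^ p - r) / of_nat p = s * (\<Sum>i<p. of_nat d ^ (p - Suc i) * r ^ i) + of_int k - s"
    using k' assms(2) prime_gt_0_nat[OF assms(2)] ds(3) by (simp add: field_simps)
  then show ?thesis using ds(2) assms(1) by (auto intro!: pint.closed)
qed

lemma poly_mapping_sum_monomials:
  assumes "finite S" "Poly_Mapping.keys f \<subseteq> S"
  shows "(\<Sum>m\<in>S. Poly_Mapping.single m (Poly_Mapping.lookup f m)) = f"
proof (rule poly_mapping_eqI)
  fix k
  have "Poly_Mapping.lookup (\<Sum>m\<in>S. Poly_Mapping.single m (Poly_Mapping.lookup f m)) k
     = (\<Sum>m\<in>S. if m = k then Poly_Mapping.lookup f k else 0)"
    unfolding lookup_sum by (rule sum.cong) (auto simp: lookup_single when_def)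
  also have "\<dots> = Poly_Mapping.lookup f k"
    using assms by (auto simp: sum.delta in_keys_iff)
  finally show "Poly_Mapping.lookup (\<Sum>m\<in>S. Poly_Mapping.single m (Poly_Mapping.lookup f m)) k
    = Poly_Mapping.lookup f k" .
qed

lemma bp_poly_iff: "bp_poly p f \<longleftrightarrow> (\<forall>m. pint p (Poly_Mapping.lookup f m))"
  by (simp add: bp_poly_def pint_def)

lemma bp_poly_single: "pint p c \<Longrightarrow> bp_poly p (Poly_Mapping.single m c)"
  by (auto simp: bp_poly_iff lookup_single when_def pint.zero)

lemma bp_poly_mult:
  assumes "bp_poly p f" "bp_poly p g"
  shows "bp_poly p (f * g)"
proof -
  have add: "bp_poly p a \<Longrightarrow> bp_poly p b \<Longrightarrow> bp_poly p (a + b)" for a b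
    by (auto simp: bp_poly_iff lookup_add intro: pint.add)
  have sum: "(\<And>i. i \<in> S \<Longrightarrow> bp_poly p (h i)) \<Longrightarrow> bp_poly p (sum h S)" for S and h :: "'b \<Rightarrow> qpoly"
    by (induction S rule: infinite_finite_induct) (simp_all add: add, simp_all add: bp_poly_iff pint.zero)
  have "f * g = (\<Sum>m\<in>Poly_Mapping.keys f. \<Sum>n\<in>Poly_Mapping.keys g.
     Poly_Mapping.single (m + n) (Poly_Mapping.lookup f m * Poly_Mapping.lookup g n))"
    by (subst (1 2) poly_mapping_sum_monomials[OF finite_keys subset_refl, symmetric])
       (simp add: sum_product mult_single)
  also have "bp_poly p \<dots>"
    using assms by (intro sum bp_poly_single pint.mult) (simp_all add: bp_poly_iff)
  finally show ?thesis .
qed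

interpretation bp_poly: subring_pred "bp_poly p" for p
  by unfold_locales
     (auto simp: bp_poly_iff lookup_minus lookup_one when_def intro: pint.closed bp_poly_mult[unfolded bp_poly_iff, rule_format])

lemma bp_series_eq: "bp_series p = bp_poly.fps_in p"
  by (auto simp: bp_series_def bp_poly.fps_in_def fun_eq_iff)

interpretation bp_series: subring_pred "bp_series p" for p
  unfolding bp_series_eq by (rule bp_poly.fps_subring)

definition bp_series2 :: "nat \<Rightarrow> qpoly fps fps \<Rightarrow> bool" where
  "bp_series2 p s \<longleftrightarrow> (\<forall>i. bp_series p (s $ i))"

lemma bp_series2_eq: "bp_series2 p = bp_series.fps_in p"
  by (auto simp: bp_series2_def bp_series.fps_in_def fun_eq_iff)

interpretation bp_series2: subring_pred "bp_series2 p" for p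
  unfolding bp_series2_eq by (rule bp_series.fps_subring)

lemma bp_poly_qconst: "pint p c \<Longrightarrow> bp_poly p (qconst c)"
  unfolding qconst_def by (rule bp_poly_single)

lemma bp_poly_v: "bp_poly p (v i)"
  unfolding v_def by (rule bp_poly_single) (rule pint.one)

lemma qconst_mult: "qconst (a * b) = qconst a * qconst b"
  by (simp add: qconst_def mult_single)

lemma qconst_of_nat [simp]: "qconst (of_nat n) = of_nat n"
  by (simp add: qconst_def)

lemma qconst_of_int [simp]: "qconst (of_int n) = of_int n"
  by (simp add: qconst_def)

lemma qconst_1 [simp]: "qconst 1 = 1"
  by (simp add: qconst_def)

lemma of_nat_mult_qconst_inverse: "n \<noteq> 0 \<Longrightarrow> of_nat n * qconst (1 / of_nat n) = 1"
  using qconst_mult[of "of_nat n" "1 / of_nat n"] by simp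

lemma lookup_qconst_mult: "Poly_Mapping.lookup (qconst c * f) m = c * Poly_Mapping.lookup f m"
proof -
  have "qconst c * f = Poly_Mapping.map ((*) c) f"
    by (simp add: qconst_def mult_map_scale_conv_mult)
  then show ?thesis by (simp add: Poly_Mapping.map.rep_eq when_def)
qed

text \<open>Abstract in the coefficient ring, so that \<open>fps_lift\<close> can carry the lift
  from polynomials to one-variable and then to two-variable series.\<close>

locale frobenius_lift = subring_pred I for I :: "'a::comm_ring_1 \<Rightarrow> bool" +
  fixes p :: nat and \<phi> :: "'a \<Rightarrow> 'a"
  assumes prime: "prime p"
    and hom_add: "\<phi> (a + b) = \<phi> a + \<phi> b"
    and hom_mult: "\<phi> (a * b) = \<phi> a * \<phi> b"
    and hom_one: "\<phi> 1 = 1"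
    and hom_in: "I a \<Longrightarrow> I (\<phi> a)"
    and lift: "I a \<Longrightarrow> \<exists>b. I b \<and> a ^ p - \<phi> a = of_nat p * b"
begin

lemma hom_zero: "\<phi> 0 = 0"
  using hom_add[of 0 0] by simp

lemma hom_sum: "\<phi> (sum f S) = (\<Sum>i\<in>S. \<phi> (f i))"
  by (induction S rule: infinite_finite_induct) (auto simp: hom_zero hom_add)

lemma hom_power: "\<phi> (a ^ n) = \<phi> a ^ n"
  by (induction n) (auto simp: hom_one hom_mult)

lemma hom_diff: "\<phi> (a - b) = \<phi> a - \<phi> b"
  using hom_add[of "a - b" b] by (simp add: algebra_simps)

end

lemma (in subring_pred) freshman:
  assumes "prime p" "I a" "I b"
  shows "\<exists>c. I c \<and> (a + b) ^ p = a ^ p + b ^ p + of_nat p * c"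
proof -
  have p: "p > 0" using assms(1) prime_gt_0_nat by blast
  define c where "c = (\<Sum>k=1..<p. of_nat ((p choose k) div p) * a ^ k * b ^ (p - k))"
  have "(a + b) ^ p = (\<Sum>k\<le>p. of_nat (p choose k) * a ^ k * b ^ (p - k))"
    by (rule binomial_ring)
  also have "{..p} = insert 0 (insert p {1..<p})" using p by auto
  also have "(\<Sum>k\<in>insert 0 (insert p {1..<p}). of_nat (p choose k) * a ^ k * b ^ (p - k))
     = b ^ p + (a ^ p + (\<Sum>k=1..<p. of_nat (p choose k) * a ^ k * b ^ (p - k)))"
    using p by (subst sum.insert; simp)
  also have "(\<Sum>k=1..<p. of_nat (p choose k) * a ^ k * b ^ (p - k)) = of_nat p * c"
    unfolding c_def sum_distrib_left
  proof (rule sum.cong, goal_cases)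
    case (2 k)
    then have "p dvd p choose k" using assms(1) by (intro dvd_choose_prime) auto
    then have "p choose k = p * ((p choose k) div p)" by simp
    then have "of_nat (p choose k) = (of_nat p * of_nat ((p choose k) div p) :: 'a)"
      by (metis of_nat_mult)
    then show ?case by (simp add: algebra_simps)
  qed auto
  finally have "(a + b) ^ p = a ^ p + b ^ p + of_nat p * c" by (simp add: algebra_simps)
  moreover have "I c" unfolding c_def using assms by (auto intro!: closed)
  ultimately show ?thesis by blast
qed

lemma (in subring_pred) freshman_sum:
  assumes "prime p" "finite S" "\<And>i. i \<in> S \<Longrightarrow> I (f i)"
  shows "\<exists>c. I c \<and> (sum f S) ^ p = (\<Sum>i\<in>S. f i ^ p) + of_nat p * c"
  using assms(2,3)
proof (induction S rule: finite_induct)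
  case empty
  then show ?case using assms(1) by (intro exI[of _ 0]) (auto intro: zero simp: power_0_left prime_gt_0_nat)
next
  case (insert x S)
  then obtain c where c: "I c" "(sum f S) ^ p = (\<Sum>i\<in>S. f i ^ p) + of_nat p * c" by auto
  obtain d where d: "I d" "(f x + sum f S) ^ p = f x ^ p + sum f S ^ p + of_nat p * d"
    using freshman[OF assms(1), of "f x" "sum f S"] insert by (auto intro: sum)
  show ?case
    using insert c d by (intro exI[of _ "c + d"]) (auto intro: add simp: algebra_simps)
qed

definition mon_scale :: "nat \<Rightarrow> (nat \<Rightarrow>\<^sub>0 nat) \<Rightarrow> (nat \<Rightarrow>\<^sub>0 nat)" where
  "mon_scale p m = (\<Sum>i<p. m)"

text \<open>The ring endomorphism that fixes rational constants and sends every v_i to its p-th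
  power; it is the twist in Hazewinkel's functional equation.\<close>

definition frob :: "nat \<Rightarrow> qpoly \<Rightarrow> qpoly" where
  "frob p f = (\<Sum>m\<in>Poly_Mapping.keys f. Poly_Mapping.single (mon_scale p m) (Poly_Mapping.lookup f m))"

lemma frob_superset:
  assumes "finite S" "Poly_Mapping.keys f \<subseteq> S"
  shows "frob p f = (\<Sum>m\<in>S. Poly_Mapping.single (mon_scale p m) (Poly_Mapping.lookup f m))"
  unfolding frob_def using assms
  by (intro sum.mono_neutral_left) (auto simp: in_keys_iff)

lemma frob_add: "frob p (f + g) = frob p f + frob p g"
proof -
  let ?S = "Poly_Mapping.keys f \<union> Poly_Mapping.keys g"
  have "Poly_Mapping.keys (f + g) \<subseteq> ?S" by (rule keys_add)
  then show ?thesis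
    by (subst (1 2 3) frob_superset[of ?S]) (auto simp: lookup_add single_add sum.distrib)
qed

lemma frob_zero: "frob p 0 = 0"
  by (simp add: frob_def)

lemma frob_sum: "frob p (sum f S) = (\<Sum>i\<in>S. frob p (f i))"
  by (induction S rule: infinite_finite_induct) (auto simp: frob_zero frob_add)

lemma frob_single: "frob p (Poly_Mapping.single m c) = Poly_Mapping.single (mon_scale p m) c"
  by (subst frob_superset[of "{m}"]) (auto split: if_splits)

lemma frob_mult: "frob p (f * g) = frob p f * frob p g"
proof -
  have "f * g = (\<Sum>m\<in>Poly_Mapping.keys f. \<Sum>n\<in>Poly_Mapping.keys g.
     Poly_Mapping.single (m + n) (Poly_Mapping.lookup f m * Poly_Mapping.lookup g n))"
    by (subst (1 2) poly_mapping_sum_monomials[OF finite_keys subset_refl, symmetric])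
       (simp add: sum_product mult_single)
  then have "frob p (f * g) = (\<Sum>m\<in>Poly_Mapping.keys f. \<Sum>n\<in>Poly_Mapping.keys g.
     Poly_Mapping.single (mon_scale p (m + n)) (Poly_Mapping.lookup f m * Poly_Mapping.lookup g n))"
    by (simp add: frob_sum frob_single)
  also have "\<dots> = frob p f * frob p g"
    by (simp add: frob_def sum_product mult_single mon_scale_def distrib_left)
  finally show ?thesis .
qed

lemma single_power: "Poly_Mapping.single m c ^ n = Poly_Mapping.single (mon_scale n m) (c ^ n :: rat)"
  by (induction n) (simp_all add: mon_scale_def mult_single algebra_simps)

lemma frob_v: "frob p (v i) = v i ^ p"
  by (simp add: v_def frob_single single_power)

lemma frob_qconst: "frob p (qconst c) = qconst c"
  by (simp add: qconst_def frob_single mon_scale_def)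

text \<open>The p-th power is additive modulo p, which reduces the claim to single terms; there the
  exponent vectors agree and the coefficients agree by Fermat.\<close>

lemma frob_lift:
  assumes "prime p" "bp_poly p f"
  shows "\<exists>g. bp_poly p g \<and> f ^ p - frob p f = of_nat p * g"
proof -
  let ?K = "Poly_Mapping.keys f"
  let ?s = "\<lambda>m. Poly_Mapping.single m (Poly_Mapping.lookup f m)"
  have f: "(\<Sum>m\<in>?K. ?s m) = f" by (rule poly_mapping_sum_monomials) auto
  obtain c where c: "bp_poly p c" "(\<Sum>m\<in>?K. ?s m) ^ p = (\<Sum>m\<in>?K. ?s m ^ p) + of_nat p * c"
    using bp_poly.freshman_sum[OF assms(1) finite_keys[of f], of p ?s] assms(2)
    by (meson bp_poly_iff bp_poly_single)
  define d where "d = (\<Sum>m\<in>?K. Poly_Mapping.single (mon_scale p m)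
     ((Poly_Mapping.lookup f m ^ p - Poly_Mapping.lookup f m) / of_nat p))"
  have pm: "of_nat p * Poly_Mapping.single m ((a - b) / of_nat p) =
      Poly_Mapping.single m a - Poly_Mapping.single m b" for m and a b :: rat
    using prime_gt_0_nat[OF assms(1)] mult_single[of 0 "of_nat p :: rat" m "(a - b) / of_nat p"]
    by (simp add: single_diff)
  have "(\<Sum>m\<in>?K. ?s m ^ p) - frob p f = of_nat p * d"
    by (simp only: single_power frob_def d_def sum_distrib_left pm sum_subtractf)
  then have "f ^ p - frob p f = of_nat p * (c + d)"
    using c f by (simp add: algebra_simps)
  moreover have "bp_poly p d" unfolding d_def using assms
    by (intro bp_poly.sum bp_poly_single pint_fermat) (simp_all add: bp_poly_iff)
  ultimately show ?thesis using c by (intro exI[of _ "c + d"]) (auto intro: bp_poly.add)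
qed

lemma bp_poly_frob: "bp_poly p f \<Longrightarrow> bp_poly p (frob p f)"
  unfolding frob_def by (intro bp_poly.sum bp_poly_single) (simp add: bp_poly_iff)

lemma frobenius_lift_frob: "prime p \<Longrightarrow> frobenius_lift (bp_poly p) p (frob p)"
  by unfold_locales (auto simp: frob_add frob_mult intro: bp_poly_frob frob_lift
      simp: frob_qconst[of p 1, simplified])

text \<open>The lift acts on the series variable as well, by \<open>x \<mapsto> x ^ p\<close>.\<close>
definition fps_frob :: "nat \<Rightarrow> ('a \<Rightarrow> 'a) \<Rightarrow> 'a::comm_ring_1 fps \<Rightarrow> 'a fps" where
  "fps_frob p \<phi> f = Abs_fps (\<lambda>n. if p dvd n then \<phi> (f $ (n div p)) else 0)"

lemma fps_X_power_eq_mod: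
  fixes a b :: "'a::comm_ring_1 fps"
  assumes "\<And>k. k \<le> n \<Longrightarrow> a $ k = b $ k" "m \<le> n"
  shows "(a ^ i) $ m = (b ^ i) $ m"
  using assms(2)
proof (induction i arbitrary: m)
  case (Suc i)
  then show ?case using assms(1) by (auto simp: fps_mult_nth intro!: sum.cong)
qed auto

text \<open>A coefficient of a^p depends only on a truncation of a. For the truncation, a finite sum
  of monomials, the p-th power is additive modulo p, and the coefficient ring supplies the
  rest.\<close>

lemma (in frobenius_lift) fps_lift: "frobenius_lift fps_in p (fps_frob p \<phi>)"
proof -
  have p: "p > 0" using prime prime_gt_0_nat by blast
  interpret F: subring_pred fps_in by (rule fps_subring)
  show ?thesis
  proof
    show "prime p" by (rule prime)
    show "fps_frob p \<phi> (a + b) = fps_frob p \<phi> a + fps_frob p \<phi> b" for a b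
      by (rule fps_ext) (auto simp: fps_frob_def hom_add)
    show "fps_frob p \<phi> (a * b) = fps_frob p \<phi> a * fps_frob p \<phi> b" for a b
    proof (rule fps_ext)
      fix n
      show "fps_frob p \<phi> (a * b) $ n = (fps_frob p \<phi> a * fps_frob p \<phi> b) $ n"
      proof (cases "p dvd n")
        case True
        then obtain m where n: "n = p * m" by auto
        have "(fps_frob p \<phi> a * fps_frob p \<phi> b) $ n =
            (\<Sum>i\<in>{0..n}. fps_frob p \<phi> a $ i * fps_frob p \<phi> b $ (n - i))"
          by (simp add: fps_mult_nth)
        also have "\<dots> = (\<Sum>i\<in>(\<lambda>i. p * i) ` {0..m}. fps_frob p \<phi> a $ i * fps_frob p \<phi> b $ (n - i))"
          by (rule sum.mono_neutral_right) (auto simp: n fps_frob_def p elim!: dvdE)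
        also have "\<dots> = (\<Sum>i\<in>{0..m}. fps_frob p \<phi> a $ (p * i) * fps_frob p \<phi> b $ (n - p * i))"
          using p by (subst sum.reindex) (auto simp: inj_on_def)
        also have "\<dots> = (\<Sum>i\<in>{0..m}. \<phi> (a $ i) * \<phi> (b $ (m - i)))"
          using p by (intro sum.cong) (auto simp: fps_frob_def n simp flip: diff_mult_distrib2)
        also have "\<dots> = fps_frob p \<phi> (a * b) $ n"
          using p by (simp add: n fps_frob_def fps_mult_nth hom_sum hom_mult)
        finally show ?thesis by simp
      next
        case False
        then have "fps_frob p \<phi> a $ i * fps_frob p \<phi> b $ (n - i) = 0" if "i \<le> n" for i
          using that by (auto simp: fps_frob_def dvd_diff_nat) (metis dvd_add le_add_diff_inverse)
        then show ?thesis using False by (simp add: fps_mult_nth fps_frob_def)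
      qed
    qed
    show "fps_frob p \<phi> 1 = 1"
      using p by (intro fps_ext) (auto simp: fps_frob_def hom_one hom_zero elim!: dvdE)
    show "fps_in (fps_frob p \<phi> a)" if "fps_in a" for a
      using that by (auto simp: fps_in_def fps_frob_def intro: hom_in zero)
    show "\<exists>b. fps_in b \<and> a ^ p - fps_frob p \<phi> a = of_nat p * b" if a: "fps_in a" for a
    proof -
      have "\<exists>c. I c \<and> (a ^ p - fps_frob p \<phi> a) $ n = of_nat p * c" for n
      proof -
        define t where "t = (\<Sum>k\<le>n. fps_const (a $ k) * fps_X ^ k)"
        have tn: "t $ k = a $ k" if "k \<le> n" for k
          using that by (simp add: t_def fps_sum_nth fps_X_power_nth if_distrib[of "\<lambda>x. _ * x"] cong: if_cong)
        have inF: "fps_in (fps_const (a $ k) * fps_X ^ k)" for k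
          using a by (auto simp: fps_in_def fps_X_power_nth intro: zero)
        obtain c where c: "fps_in c" "t ^ p = (\<Sum>k\<le>n. (fps_const (a $ k) * fps_X ^ k) ^ p) + of_nat p * c"
          using F.freshman_sum[OF prime, of "{..n}" "\<lambda>k. fps_const (a $ k) * fps_X ^ k"] inF
          unfolding t_def by auto
        have "(\<Sum>k\<le>n. (fps_const (a $ k) * fps_X ^ k) ^ p) $ n =
           (\<Sum>k\<le>n. if n = p * k then (a $ k) ^ p else 0)"
          by (simp add: fps_sum_nth power_mult_distrib fps_X_power_nth mult.commute flip: power_mult)
            (auto intro!: sum.cong)
        also have "\<dots> = (if p dvd n then (a $ (n div p)) ^ p else 0)"
        proof (cases "p dvd n")
          case True
          then obtain m where m: "n = p * m" by auto
          then have "(\<Sum>k\<le>n. if n = p * k then (a $ k) ^ p else 0) = (\<Sum>k\<le>n. if k = m then (a $ m) ^ p else 0)"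
            using p by (intro sum.cong) auto
          then show ?thesis using m p by (simp add: mult_le_mono1[of 1 p m, simplified])
        qed (auto intro!: sum.neutral)
        finally have s: "(\<Sum>k\<le>n. (fps_const (a $ k) * fps_X ^ k) ^ p) $ n = \<dots>" .
        have "(a ^ p) $ n = (t ^ p) $ n"
          by (rule fps_X_power_eq_mod[of n]) (auto simp: tn)
        also have "\<dots> = (if p dvd n then (a $ (n div p)) ^ p else 0) + of_nat p * c $ n"
          using c(2) s by (simp add: fps_mult_of_nat_nth)
        finally have *: "(a ^ p - fps_frob p \<phi> a) $ n =
            (if p dvd n then (a $ (n div p)) ^ p - \<phi> (a $ (n div p)) else 0) + of_nat p * c $ n"
          by (simp add: fps_frob_def)
        show ?thesis
        proof (cases "p dvd n")
          case True
          obtain b where "I b" "(a $ (n div p)) ^ p - \<phi> (a $ (n div p)) = of_nat p * b"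
            using lift a by (auto simp: fps_in_def)
          then show ?thesis using * True c(1)
            by (intro exI[of _ "b + c $ n"]) (auto simp: fps_in_def algebra_simps intro: add)
        qed (use * c(1) in \<open>auto simp: fps_in_def\<close>)
      qed
      then obtain b where b: "\<And>n. I (b n)" "\<And>n. (a ^ p - fps_frob p \<phi> a) $ n = of_nat p * b n"
        by metis
      then show ?thesis
        by (intro exI[of _ "Abs_fps b"]) (auto simp: fps_in_def fps_eq_iff fps_mult_of_nat_nth)
    qed
  qed
qed

section \<open>Substitution into one-variable series\<close>

text \<open>Total degree in both variables is the filtration in which substitution into a
  one-variable series converges.\<close>

definition ord2 :: "nat \<Rightarrow> 'a::comm_ring_1 fps fps \<Rightarrow> bool" where
  "ord2 n G \<longleftrightarrow> (\<forall>i j. i + j < n \<longrightarrow> G $ i $ j = 0)"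

abbreviation cst :: "'a::comm_ring_1 \<Rightarrow> 'a fps fps" where
  "cst c \<equiv> fps_const (fps_const c)"

lemma ord2_0 [simp]: "ord2 0 G"
  by (simp add: ord2_def)

lemma ord2_zero [simp]: "ord2 n 0"
  by (simp add: ord2_def)

lemma ord2_mono: "ord2 m G \<Longrightarrow> n \<le> m \<Longrightarrow> ord2 n G"
  by (auto simp: ord2_def)

lemma ord2_add: "ord2 n a \<Longrightarrow> ord2 n b \<Longrightarrow> ord2 n (a + b)"
  and ord2_diff: "ord2 n a \<Longrightarrow> ord2 n b \<Longrightarrow> ord2 n (a - b)"
  by (auto simp: ord2_def)

lemma ord2_sum: "(\<And>i. i \<in> S \<Longrightarrow> ord2 n (f i)) \<Longrightarrow> ord2 n (sum f S)"
  by (induction S rule: infinite_finite_induct) (auto intro: ord2_add)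

lemma ord2_mult:
  assumes "ord2 m a" "ord2 n b"
  shows "ord2 (m + n) (a * b)"
  unfolding ord2_def
proof (intro allI impI)
  fix i j assume ij: "i + j < m + n"
  have "a $ k $ l * b $ (i - k) $ (j - l) = 0" if "k \<le> i" "l \<le> j" for k l
  proof (cases "k + l < m")
    case True
    then show ?thesis using assms by (simp add: ord2_def)
  next
    case False
    then have "(i - k) + (j - l) < n" using that ij by linarith
    then show ?thesis using assms by (simp add: ord2_def)
  qed
  then show "(a * b) $ i $ j = 0"
    by (simp add: fps_mult_nth fps_sum_nth)
qed

lemma ord2_mult_left: "ord2 n b \<Longrightarrow> ord2 n (a * b)"
  using ord2_mult[of 0 a n b] by simp

lemma ord2_mult_right: "ord2 n a \<Longrightarrow> ord2 n (a * b)"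
  using ord2_mult[of n a 0 b] by simp

lemma ord2_power: "ord2 1 a \<Longrightarrow> ord2 k (a ^ k)"
  using ord2_mult[of 1 a] by (induction k) auto

lemma ord2_diff_power:
  assumes "ord2 1 a" "ord2 1 b" "ord2 n (a - b)" "m > 0"
  shows "ord2 (n + (m - 1)) (a ^ m - b ^ m)"
proof -
  have "ord2 (m - 1) (\<Sum>i<m. b ^ (m - Suc i) * a ^ i)"
  proof (rule ord2_sum)
    fix i assume "i \<in> {..<m}"
    then have "m - Suc i + i = m - 1" by auto
    then show "ord2 (m - 1) (b ^ (m - Suc i) * a ^ i)"
      using ord2_mult[OF ord2_power[OF assms(2), of "m - Suc i"] ord2_power[OF assms(1), of i]] by simp
  qed
  then show ?thesis
    unfolding power_diff_sumr2 using assms(3) by (intro ord2_mult)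
qed

lemma ord2_eqI: "(\<And>N. ord2 N (a - b)) \<Longrightarrow> a = b"
  by (rule fps_ext, rule fps_ext)
     (metis (no_types) ord2_def fps_sub_nth eq_iff_diff_eq_0 less_add_one add.commute)

lemma ord2_trans: "ord2 n (a - b) \<Longrightarrow> ord2 n (b - c) \<Longrightarrow> ord2 n (a - c)"
  using ord2_add[of n "a - b" "b - c"] by simp

lemma ord2_sym: "ord2 n (a - b) \<Longrightarrow> ord2 n (b - a)"
  by (auto simp: ord2_def)

text \<open>The k-th power of A starts in total degree k, so N terms determine everything below
  degree N. All laws of substitution are checked on these finite sums.\<close>

lemma comp2_approx:
  assumes "ord2 1 A"
  shows "ord2 N (comp2 e A - (\<Sum>k<N. cst (e $ k) * A ^ k))"
  unfolding ord2_def
proof (intro allI impI)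
  fix i j assume ij: "i + j < N"
  have "(\<Sum>k<N. cst (e $ k) * A ^ k) $ i $ j = (\<Sum>k<N. e $ k * (A ^ k) $ i $ j)"
    by (simp add: fps_sum_nth)
  also have "\<dots> = (\<Sum>k\<le>i + j. e $ k * (A ^ k) $ i $ j)"
    using ij ord2_power[OF assms] by (intro sum.mono_neutral_right) (auto simp: ord2_def)
  finally show "(comp2 e A - (\<Sum>k<N. cst (e $ k) * A ^ k)) $ i $ j = 0"
    by (simp add: comp2_def)
qed

lemma comp2_add: "comp2 (a + b) C = comp2 a C + comp2 b C"
  by (rule fps_ext, rule fps_ext) (simp add: comp2_def distrib_right sum.distrib)

lemma comp2_sum: "comp2 (sum f S) C = (\<Sum>i\<in>S. comp2 (f i) C)"
proof (induction S rule: infinite_finite_induct)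
  case (infinite A)
  then show ?case by (auto simp: fps_eq_iff comp2_def)
qed (auto simp: comp2_add, auto simp: fps_eq_iff comp2_def)

lemma comp2_const: "comp2 (fps_const c) C = cst c"
proof (rule fps_ext, rule fps_ext)
  fix i j
  have "(\<Sum>k\<le>i + j. fps_const c $ k * (C ^ k) $ i $ j) = (\<Sum>k\<le>i + j. if k = 0 then c * (1 :: 'a fps fps) $ i $ j else 0)"
    by (intro sum.cong) auto
  then show "comp2 (fps_const c) C $ i $ j = cst c $ i $ j"
    by (auto simp: comp2_def)
qed

lemma comp2_ord: "(\<And>m. m < N \<Longrightarrow> d $ m = 0) \<Longrightarrow> ord2 N (comp2 d C)"
  by (auto simp: ord2_def comp2_def intro!: sum.neutral)

lemma comp2_ord1: "d $ 0 = 0 \<Longrightarrow> ord2 1 (comp2 d C)"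
  by (rule comp2_ord) simp

text \<open>The product of two truncations exceeds the truncation of the product only by terms with
  i + j >= N, which have order at least N.\<close>

lemma comp2_mult:
  assumes C: "ord2 1 C"
  shows "comp2 (a * b) C = comp2 a C * comp2 b C"
proof (rule ord2_eqI)
  fix N
  let ?P = "\<lambda>a. \<Sum>k<N. cst (a $ k) * C ^ k"
  let ?g = "\<lambda>i j. cst (a $ i) * cst (b $ j) * C ^ (i + j)"
  have "?P (a * b) = (\<Sum>n<N. \<Sum>i\<le>n. ?g i (n - i))"
  proof (intro sum.cong refl)
    fix n
    have "cst (sum f S) = (\<Sum>i\<in>S. cst (f i))" for f :: "nat \<Rightarrow> 'a" and S
      by (induction S rule: infinite_finite_induct) (auto simp flip: fps_const_add)
    then show "cst ((a * b) $ n) * C ^ n = (\<Sum>i\<le>n. ?g i (n - i))"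
      by (simp add: fps_mult_nth atLeast0AtMost sum_distrib_right)
  qed
  also have "\<dots> = (\<Sum>(i, j)\<in>{(i, j). i + j < N}. ?g i j)"
    by (rule sum.triangle_reindex[symmetric])
  finally have 1: "?P (a * b) = (\<Sum>(i, j)\<in>{(i, j). i + j < N}. ?g i j)" .
  have "?P a * ?P b = (\<Sum>(i, j)\<in>{..<N} \<times> {..<N}. ?g i j)"
    by (simp add: sum_product sum.cartesian_product power_add mult_ac del: fps_const_mult)
  also have "{..<N} \<times> {..<N} = {(i, j). i + j < N} \<union> {(i, j). i < N \<and> j < N \<and> N \<le> i + j}" by auto
  also have "(\<Sum>(i, j)\<in>\<dots>. ?g i j) = ?P (a * b) + (\<Sum>(i, j)\<in>{(i, j). i < N \<and> j < N \<and> N \<le> i + j}. ?g i j)"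
    unfolding 1
    by (rule sum.union_disjoint)
       (auto intro: finite_subset[of _ "{..<N} \<times> {..<N}"])
  finally have 2: "?P a * ?P b - ?P (a * b) = (\<Sum>(i, j)\<in>{(i, j). i < N \<and> j < N \<and> N \<le> i + j}. ?g i j)"
    by simp
  have "ord2 N (?P a * ?P b - ?P (a * b))"
    unfolding 2 by (intro ord2_sum) (auto intro!: ord2_mult_left intro: ord2_mono[OF ord2_power[OF C]])
  moreover have "ord2 N (comp2 a C * comp2 b C - ?P a * ?P b)"
  proof -
    have "comp2 a C * comp2 b C - ?P a * ?P b
      = (comp2 a C - ?P a) * comp2 b C + ?P a * (comp2 b C - ?P b)" by (simp add: algebra_simps)
    then show ?thesis
      by (simp only:) (rule ord2_add[OF ord2_mult_right[OF comp2_approx[OF C]] ord2_mult_left[OF comp2_approx[OF C]]])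
  qed
  ultimately show "ord2 N (comp2 (a * b) C - comp2 a C * comp2 b C)"
    using comp2_approx[OF C, of N "a * b"] by (meson ord2_trans ord2_sym)
qed

lemma comp2_power:
  assumes "ord2 1 C"
  shows "comp2 (a ^ n) C = comp2 a C ^ n"
  using comp2_const[of 1 C] by (induction n) (auto simp: comp2_mult[OF assms])

lemma comp2_compose:
  assumes C: "ord2 1 C" and b: "b $ 0 = 0"
  shows "comp2 (a oo b) C = comp2 a (comp2 b C)"
proof (rule ord2_eqI)
  fix N
  let ?s = "\<Sum>k<N. fps_const (a $ k) * b ^ k"
  have z: "(a oo b) $ m - ?s $ m = 0" if "m < N" for m
  proof -
    have "(\<Sum>k<N. a $ k * b ^ k $ m) = (\<Sum>k=0..m. a $ k * b ^ k $ m)"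
      using that b by (intro sum.mono_neutral_right) (auto simp: startsby_zero_power_prefix)
    then show ?thesis by (simp add: fps_compose_nth fps_sum_nth)
  qed
  have "comp2 (a oo b) C = comp2 ((a oo b) - ?s) C + comp2 ?s C"
    using comp2_add[of "(a oo b) - ?s" ?s C] by (simp only: diff_add_cancel)
  moreover have "ord2 N (comp2 ((a oo b) - ?s) C)"
    using z by (intro comp2_ord) simp
  moreover have "comp2 ?s C = (\<Sum>k<N. cst (a $ k) * comp2 b C ^ k)"
    by (simp add: comp2_sum comp2_mult[OF C] comp2_const comp2_power[OF C])
  ultimately have "ord2 N (comp2 (a oo b) C - (\<Sum>k<N. cst (a $ k) * comp2 b C ^ k))" by simp
  then show "ord2 N (comp2 (a oo b) C - comp2 a (comp2 b C))"
    using comp2_approx[OF comp2_ord1[OF b], of N a] by (meson ord2_trans ord2_sym)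
qed

lemma comp2_nth_0: "comp2 e A $ 0 = e oo (A $ 0)"
  by (rule fps_ext) (simp add: comp2_def fps_compose_nth fps_power_zeroth atLeast0AtMost)

lemma comp2_fps_const: "comp2 e (fps_const r) = fps_const (e oo r)"
proof (rule fps_ext, rule fps_ext)
  fix i j
  show "comp2 e (fps_const r) $ i $ j = fps_const (e oo r) $ i $ j"
    by (auto simp: comp2_def fps_compose_nth atLeast0AtMost)
qed

lemma comp2_fps_X_self: "comp2 fps_X C = C" if "ord2 1 C"
proof (rule ord2_eqI)
  fix N
  have "ord2 (Suc (Suc N)) (comp2 fps_X C - (\<Sum>k<Suc (Suc N). cst (fps_X $ k) * C ^ k))"
    by (rule comp2_approx[OF that])
  also have "(\<Sum>k<Suc (Suc N). cst (fps_X $ k) * C ^ k) = (\<Sum>k<Suc (Suc N). if k = 1 then C else 0)"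
    by (intro sum.cong) auto
  also have "\<dots> = C" by (subst sum.delta) auto
  finally show "ord2 N (comp2 fps_X C - C)" by (rule ord2_mono) simp
qed

text \<open>As b starts in degree 2, every product in degree m that contains the coefficient e_m
  also contains e_0 = 0.\<close>

lemma fps_compose_nth_cong:
  fixes b :: "'a::comm_ring_1 fps"
  assumes "b $ 0 = 0" "b $ 1 = 0" "e $ 0 = 0" "e' $ 0 = 0" "\<And>k. k < m \<Longrightarrow> e $ k = e' $ k"
  shows "(b oo e) $ m = (b oo e') $ m"
proof -
  have "b $ i * (e ^ i) $ m = b $ i * (e' ^ i) $ m" for i
  proof (cases "i < 2 \<or> m = 0")
    case True
    then have "i = 0 \<or> i = 1 \<or> m = 0" by auto
    then show ?thesis using assms by (auto simp: fps_power_zeroth)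
  next
    case False
    then obtain l where i: "i = Suc (Suc l)" by (metis add_2_eq_Suc le_Suc_ex not_less)
    have "(e * e ^ Suc l) $ m = (e' * e' ^ Suc l) $ m"
      unfolding fps_mult_nth
    proof (rule sum.cong)
      fix k assume k: "k \<in> {0..m}"
      consider "k = 0" | "k = m" | "k < m" "m - k < m" using k False by force
      then show "e $ k * e ^ Suc l $ (m - k) = e' $ k * e' ^ Suc l $ (m - k)"
      proof cases
        case 3
        then have "e ^ Suc l $ (m - k) = e' ^ Suc l $ (m - k)"
          using assms(5) by (intro fps_X_power_eq_mod[of "m - k"]) auto
        then show ?thesis using 3 assms(5) by simp
      qed (use assms in auto)
    qed auto
    then show ?thesis by (simp add: i)
  qed
  then show ?thesis by (simp add: fps_compose_nth)
qed

text \<open>The equation a(e) = X is the fixed point equation e = X - b(e) with b = a - X. Each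
  iteration settles one more coefficient, and no division is made, so any commutative ring is
  allowed.\<close>

lemma fps_compinv_ex1:
  fixes a :: "'a::comm_ring_1 fps"
  assumes a: "a $ 0 = 0" "a $ 1 = 1"
  shows "\<exists>!e. e $ 0 = 0 \<and> a oo e = fps_X"
proof -
  define b where "b = a - fps_X"
  have b: "b $ 0 = 0" "b $ 1 = 0" using a by (auto simp: b_def)
  have X: "fps_X oo e = e" if "e $ 0 = 0" for e :: "'a fps"
    using that by (simp add: fps_eq_iff fps_compose_nth fps_X_nth if_distrib[of "\<lambda>x. x * _"] cong: if_cong)
  have ae: "a oo e = e + (b oo e)" if "e $ 0 = 0" for e
    using X[OF that] fps_compose_add_distrib[of fps_X b e] by (simp add: b_def)
  define E where "E = rec_nat (0 :: 'a fps) (\<lambda>_ e. fps_X - (b oo e))"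
  have E0: "E 0 = 0" and ES: "E (Suc n) = fps_X - (b oo E n)" for n by (simp_all add: E_def)
  have Ez: "E n $ 0 = 0" for n using b by (cases n) (auto simp: E0 ES)
  have st: "E (Suc n) $ m = E n $ m" if "m \<le> n" for n m
    using that
  proof (induction n arbitrary: m)
    case 0
    then show ?case by (simp add: Ez)
  next
    case (Suc n)
    have "(b oo E (Suc n)) $ m = (b oo E n) $ m"
      using Suc by (intro fps_compose_nth_cong b Ez) auto
    then show ?case by (simp add: ES)
  qed
  have st': "E (m + d) $ m = E m $ m" for m d
    by (induction d) (auto simp: st)
  define e where "e = Abs_fps (\<lambda>n. E n $ n)"
  have e0: "e $ 0 = 0" by (simp add: e_def Ez)
  have "e + (b oo e) = fps_X"
  proof (rule fps_ext)
    fix m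
    have "(b oo e) $ m = (b oo E m) $ m"
    proof (rule fps_compose_nth_cong[OF b e0 Ez])
      fix k assume "k < m"
      then show "e $ k = E m $ k" using st'[of k "m - k"] by (simp add: e_def)
    qed
    moreover have "e $ m = (fps_X - (b oo E m)) $ m"
      using st'[of m 1] unfolding ES[symmetric] by (simp add: e_def)
    ultimately show "(e + (b oo e)) $ m = fps_X $ m" by simp
  qed
  then have "a oo e = fps_X" using ae[OF e0] by simp
  moreover have "e1 = e2" if "e1 $ 0 = 0" "a oo e1 = fps_X" "e2 $ 0 = 0" "a oo e2 = fps_X" for e1 e2
  proof (rule fps_ext)
    fix n
    show "e1 $ n = e2 $ n"
    proof (induction n rule: less_induct)
      case (less n)
      then have "(b oo e1) $ n = (b oo e2) $ n" by (intro fps_compose_nth_cong b that)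
      moreover have "e1 + (b oo e1) = e2 + (b oo e2)" using that ae[of e1] ae[of e2] by simp
      ultimately show ?case by (metis add_right_imp_eq fps_add_nth)
    qed
  qed
  ultimately show ?thesis using e0 by blast
qed

section \<open>Logarithm, exponential and formal multiples\<close>

locale bp_prime =
  fixes p :: nat
  assumes prime: "prime p"
begin

lemma p2: "p \<ge> 2" using prime by (rule prime_ge_2_nat)

lemma exponents_less: "k < p ^ k"
  using p2 by (simp add: less_exp power_gt_expt)

lemma lg_nth_power: "lg p $ (p ^ k) = ell p k"
proof -
  have "{k'. k' \<le> p ^ k \<and> p ^ k' = p ^ k} = {k}"
    using p2 exponents_less[of k] by (auto simp: power_inject_exp)
  then show ?thesis by (simp add: lg_def)
qed

lemma lg_nth_other: "m \<notin> range (\<lambda>k. p ^ k) \<Longrightarrow> lg p $ m = 0"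
  by (auto simp: lg_def intro!: sum.neutral)

lemma lg_0 [simp]: "lg p $ 0 = 0"
  using p2 by (intro lg_nth_other) auto

lemma lg_1 [simp]: "lg p $ 1 = 1"
  using lg_nth_power[of 0] by simp

lemma ex_props: "ex p $ 0 = 0" "lg p oo ex p = fps_X"
  using theI'[OF fps_compinv_ex1[OF lg_0 lg_1]] unfolding ex_def by auto

lemma fps_lg_sum: "(\<Sum>m<p ^ K. cst (lg p $ m) * C ^ m) = (\<Sum>k<K. cst (ell p k) * C ^ (p ^ k))"
proof -
  have "(\<Sum>m<p ^ K. cst (lg p $ m) * C ^ m) = (\<Sum>m\<in>(\<lambda>k. p ^ k) ` {..<K}. cst (lg p $ m) * C ^ m)"
  proof (intro sum.mono_neutral_right ballI)
    fix m assume m: "m \<in> {..<p ^ K} - (\<lambda>k. p ^ k) ` {..<K}"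
    then have "m \<notin> range (\<lambda>k. p ^ k)"
      using p2 by (auto simp: power_less_imp_less_exp)
    then show "cst (lg p $ m) * C ^ m = 0" by (simp add: lg_nth_other)
  qed (use p2 in \<open>auto simp: power_strict_increasing\<close>)
  also have "\<dots> = (\<Sum>k<K. cst (ell p k) * C ^ (p ^ k))"
    using p2 by (subst sum.reindex) (auto simp: inj_on_def lg_nth_power)
  finally show ?thesis .
qed

lemma comp2_lg_approx:
  assumes "ord2 1 C"
  shows "ord2 (p ^ K) (comp2 (lg p) C - (\<Sum>k<K. cst (ell p k) * C ^ (p ^ k)))"
  using comp2_approx[OF assms, of "p ^ K" "lg p"] by (simp add: fps_lg_sum)

lemma fmul_0: "fmul p i $ 0 = 0"
  by (cases i) (auto simp: fgl_add_def ex_props)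

lemma lg_fmul: "lg p oo fmul p i = of_nat i * lg p"
proof (induction i)
  case 0
  then show ?case by (simp add: fps_compose_0_right)
next
  case (Suc i)
  have "lg p oo fmul p (Suc i) = (lg p oo ex p) oo ((lg p oo fmul p i) + lg p)"
    by (simp add: fgl_add_def fps_compose_assoc ex_props)
  then show ?case
    using Suc by (simp add: ex_props fps_eq_iff fps_compose_nth fps_X_nth if_distrib[of "\<lambda>x. x * _"] algebra_simps cong: if_cong)
qed

text \<open>Only log after exp is known to be the identity at this point, so the defining recursion
  of \<open>fmul\<close> replaces a cancellation of exp against log.\<close>

lemma ex_lg_fmul: "ex p oo (lg p oo fmul p i) = fmul p i"
proof (cases i)
  case (Suc j)
  have "lg p oo fmul p (Suc j) = (lg p oo fmul p j) + lg p"
    unfolding lg_fmul by (simp add: algebra_simps)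
  then show ?thesis unfolding Suc by (simp add: fgl_add_def)
qed (simp add: fps_compose_0_right ex_props)

definition Z :: "nat \<Rightarrow> qpoly fps fps" where
  "Z i = fgl_add2 p (fps_const (fmul p i)) fps_X"

lemma comp2_lg_Z:
  "comp2 (lg p) (Z i) = of_nat i * comp2 (lg p) (fps_const fps_X) + comp2 (lg p) fps_X"
proof -
  have C: "ord2 1 (comp2 (lg p) A + comp2 (lg p) B)" for A B
    by (intro ord2_add comp2_ord1) auto
  have "comp2 (lg p) (Z i) = comp2 (lg p oo ex p) (comp2 (lg p) (fps_const (fmul p i)) + comp2 (lg p) fps_X)"
    unfolding Z_def fgl_add2_def using C by (subst comp2_compose) (auto simp: ex_props)
  also have "\<dots> = comp2 (lg p) (fps_const (fmul p i)) + comp2 (lg p) fps_X"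
    using comp2_fps_X_self[OF C] by (simp add: ex_props)
  finally show ?thesis
    by (simp add: comp2_fps_const lg_fmul fps_of_nat[symmetric] del: fps_of_nat)
qed

lemma ord_Z: "ord2 1 (Z i)"
  unfolding Z_def fgl_add2_def by (intro comp2_ord1) (simp add: ex_props)

lemma Z_nth_0: "Z i $ 0 = fmul p i"
proof -
  have "comp2 (lg p) fps_X $ 0 = 0" by (simp add: comp2_nth_0 fps_compose_0_right)
  then show ?thesis
    by (simp add: Z_def fgl_add2_def comp2_nth_0 ex_lg_fmul)
qed

end

section \<open>Integrality of the formal group law\<close>

lemma power_power_power: "((x :: 'a::monoid_mult) ^ (p ^ i)) ^ (p ^ j) = x ^ (p ^ (i + j))"
  by (simp add: power_add power_mult)

context frobenius_lift
begin

lemma power_cong_p: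
  assumes "I a" "I b" "\<exists>c. I c \<and> a - b = of_nat p * c"
  shows "\<exists>c. I c \<and> a ^ n - b ^ n = of_nat p * c"
proof -
  obtain c where c: "I c" "a - b = of_nat p * c" using assms by blast
  have "a ^ n - b ^ n = of_nat p * (c * (\<Sum>i<n. b ^ (n - Suc i) * a ^ i))"
    unfolding power_diff_sumr2 c by (simp add: mult.assoc)
  then show ?thesis using c assms by (intro exI[of _ "c * (\<Sum>i<n. b ^ (n - Suc i) * a ^ i)"]) (auto intro!: closed)
qed

text \<open>If x and y agree modulo p, the cofactor of x - y in x^p - y^p is p y^(p-1) modulo p; so
  each p-th power gains one further factor p.\<close>

lemma power_cong_p_power:
  assumes "I a" "I b" "\<exists>c. I c \<and> a - b = of_nat p * c"
  shows "\<exists>c. I c \<and> a ^ (p ^ k) - b ^ (p ^ k) = of_nat p ^ Suc k * c"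
proof (induction k)
  case 0
  then show ?case using assms by simp
next
  case (Suc k)
  then obtain c where c: "I c" "a ^ (p ^ k) - b ^ (p ^ k) = of_nat p ^ Suc k * c" by blast
  define x y where "x = a ^ (p ^ k)" and "y = b ^ (p ^ k)"
  have xy: "I x" "I y" "x - y = of_nat p ^ Suc k * c" using assms c by (auto simp: x_def y_def intro: power)
  then have "\<exists>c. I c \<and> x - y = of_nat p * c"
    using c by (intro exI[of _ "of_nat p ^ k * c"]) (auto intro!: closed simp: mult.assoc)
  from power_cong_p[OF xy(1,2) this]
  obtain e where e: "\<And>i. I (e i)" "\<And>i. x ^ i - y ^ i = of_nat p * e i" by metis
  have "(\<Sum>i<p. y ^ (p - Suc i) * x ^ i) = (\<Sum>i<p. y ^ (p - Suc i) * (y ^ i + of_nat p * e i))"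
    by (intro sum.cong refl) (simp add: e(2)[symmetric])
  also have "\<dots> = (\<Sum>i<p. y ^ (p - 1) + of_nat p * (y ^ (p - Suc i) * e i))"
    by (intro sum.cong refl) (simp add: distrib_left mult_ac flip: power_add)
  also have "\<dots> = of_nat p * (y ^ (p - 1) + (\<Sum>i<p. y ^ (p - Suc i) * e i))"
    by (simp add: sum.distrib sum_distrib_left distrib_left)
  finally have "x ^ p - y ^ p = of_nat p ^ Suc (Suc k) * (c * (y ^ (p - 1) + (\<Sum>i<p. y ^ (p - Suc i) * e i)))"
    unfolding power_diff_sumr2 xy(3) by (simp add: mult_ac)
  moreover have "x ^ p = a ^ (p ^ Suc k)" "y ^ p = b ^ (p ^ Suc k)"
    by (simp_all add: x_def y_def mult.commute flip: power_mult)
  moreover have "I (c * (y ^ (p - 1) + (\<Sum>i<p. y ^ (p - Suc i) * e i)))"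
    using c e xy by (auto intro!: closed)
  ultimately show ?case by auto
qed

lemma hom_funpow_in: "I a \<Longrightarrow> I ((\<phi> ^^ j) a)"
  by (induction j) (auto intro: hom_in)

lemma hom_funpow:
  "(\<phi> ^^ j) (a + b) = (\<phi> ^^ j) a + (\<phi> ^^ j) b"
  "(\<phi> ^^ j) (a * b) = (\<phi> ^^ j) a * (\<phi> ^^ j) b"
  "(\<phi> ^^ j) (a - b) = (\<phi> ^^ j) a - (\<phi> ^^ j) b"
  "(\<phi> ^^ j) (sum f S) = (\<Sum>i\<in>S. (\<phi> ^^ j) (f i))"
  "(\<phi> ^^ j) (a ^ n) = (\<phi> ^^ j) a ^ n"
  "(\<phi> ^^ j) 1 = 1"
  by (induction j) (auto simp: hom_add hom_mult hom_diff hom_sum hom_power hom_one)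

lemma hom_funpow_of_nat: "(\<phi> ^^ j) (of_nat n) = of_nat n"
proof -
  have "(\<phi> ^^ j) 0 = 0" by (induction j) (auto simp: hom_zero)
  then show ?thesis by (induction n) (auto simp: hom_funpow)
qed

lemma lift_funpow: "I a \<Longrightarrow> \<exists>b. I b \<and> a ^ (p ^ j) - (\<phi> ^^ j) a = of_nat p * b"
proof (induction j)
  case 0
  then show ?case by (intro exI[of _ 0]) (auto intro: zero)
next
  case (Suc j)
  then obtain b where b: "I b" "(a ^ (p ^ j)) ^ p - ((\<phi> ^^ j) a) ^ p = of_nat p * b"
    using power_cong_p[of "a ^ (p ^ j)" "(\<phi> ^^ j) a" p] hom_funpow_in by (auto intro: power)
  obtain c where c: "I c" "((\<phi> ^^ j) a) ^ p - \<phi> ((\<phi> ^^ j) a) = of_nat p * c"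
    using lift hom_funpow_in Suc by blast
  have "a ^ (p ^ Suc j) = (a ^ (p ^ j)) ^ p" by (simp add: mult.commute flip: power_mult)
  then have "a ^ (p ^ Suc j) - (\<phi> ^^ Suc j) a = of_nat p * (b + c)"
    using b c by (simp add: algebra_simps)
  then show ?case using b c by (intro exI[of _ "b + c"]) (auto intro: add)
qed

end

context bp_prime
begin

sublocale F0: frobenius_lift "bp_poly p" p "frob p"
  by (rule frobenius_lift_frob[OF prime])

sublocale F1: frobenius_lift "bp_series p" p "fps_frob p (frob p)"
  using F0.fps_lift by (simp add: bp_series_eq)

definition \<Psi> :: "qpoly fps fps \<Rightarrow> qpoly fps fps" where
  "\<Psi> = fps_frob p (fps_frob p (frob p))"

sublocale F2: frobenius_lift "bp_series2 p" p \<Psi>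
  using F1.fps_lift by (simp add: bp_series2_eq \<Psi>_def)

abbreviation pinv :: qpoly where
  "pinv \<equiv> qconst (1 / of_nat p)"

lemma p_pinv: "of_nat p * pinv = 1"
  using prime_gt_0_nat[OF prime] by (intro of_nat_mult_qconst_inverse) simp

lemma ell_rec: "k > 0 \<Longrightarrow> of_nat p * ell p k = (\<Sum>i<k. ell p i * v (k - i) ^ (p ^ i))"
proof (cases k)
  case (Suc l)
  have "of_nat p * ell p k = (of_nat p * pinv) * (\<Sum>i<k. ell p i * v (k - i) ^ (p ^ i))"
    by (simp add: Suc mult.assoc)
  then show ?thesis by (simp add: p_pinv)
qed simp

lemma frob_funpow_v: "(frob p ^^ j) (v i) = v i ^ (p ^ j)"
  by (induction j) (auto simp: frob_v F0.hom_power mult.commute simp flip: power_mult)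

text \<open>Hazewinkel's recursion twists the generators, whereas the functional equation needs the
  twist on the coefficients of the logarithm. After one more multiplication by p both forms expand
  into the same double sum, summed in different orders.\<close>

lemma ell_frob_rec: "k > 0 \<Longrightarrow> of_nat p * ell p k = (\<Sum>j=1..k. v j * (frob p ^^ j) (ell p (k - j)))"
proof (induction k rule: less_induct)
  case (less k)
  let ?t = "\<lambda>i j. v j * (frob p ^^ j) (ell p (i - j)) * v (k - i) ^ (p ^ i)"
  have i0: "{..<k} = insert 0 {1..<k}" using less.prems by auto
  have "of_nat p * (of_nat p * ell p k) = of_nat p * (v k + (\<Sum>i=1..<k. ell p i * v (k - i) ^ (p ^ i)))"
    unfolding ell_rec[OF less.prems] i0 by (subst sum.insert) auto
  also have "\<dots> = of_nat p * v k + (\<Sum>i=1..<k. \<Sum>j=1..i. ?t i j)"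
    unfolding distrib_left sum_distrib_left
    by (intro arg_cong2[where f = "(+)"] refl sum.cong)
       (use less in \<open>auto simp: mult.assoc[symmetric] sum_distrib_right\<close>)
  also have "(\<Sum>i=1..<k. \<Sum>j=1..i. ?t i j) = (\<Sum>j=1..<k. \<Sum>i=j..<k. ?t i j)"
    by (subst (1 2) sum.Sigma, simp, simp, simp, simp,
        rule sum.reindex_bij_witness[of _ "\<lambda>(a, b). (b, a)" "\<lambda>(a, b). (b, a)"]) auto
  also have "\<dots> = (\<Sum>j=1..<k. of_nat p * (v j * (frob p ^^ j) (ell p (k - j))))"
  proof (intro sum.cong refl)
    fix j assume j: "j \<in> {1..<k}"
    have "of_nat p * (v j * (frob p ^^ j) (ell p (k - j))) = v j * (frob p ^^ j) (of_nat p * ell p (k - j))"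
      by (simp add: F0.hom_funpow F0.hom_funpow_of_nat)
    also have "\<dots> = (\<Sum>i<k - j. v j * (frob p ^^ j) (ell p i) * v (k - (j + i)) ^ (p ^ (i + j)))"
      using j by (subst ell_rec) (auto simp: F0.hom_funpow frob_funpow_v sum_distrib_left mult.assoc
          power_power_power add.commute[of j] diff_diff_left)
    also have "\<dots> = (\<Sum>i=j..<k. ?t i j)"
      by (rule sum.reindex_bij_witness[of _ "\<lambda>i. i - j" "\<lambda>i. i + j"]) (auto simp: add.commute)
    finally show "(\<Sum>i=j..<k. ?t i j) = of_nat p * (v j * (frob p ^^ j) (ell p (k - j)))" ..
  qed
  also have "of_nat p * v k + \<dots> = of_nat p * (\<Sum>j=1..k. v j * (frob p ^^ j) (ell p (k - j)))"
  proof -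
    have "{1..k} = insert k {1..<k}" using less.prems by auto
    then show ?thesis by (simp add: F0.hom_funpow sum_distrib_left distrib_left)
  qed
  finally show ?case using prime_gt_0_nat[OF prime] by simp
qed

lemma bp_ell: "bp_poly p (of_nat p ^ k * ell p k)"
proof (induction k rule: less_induct)
  case (less k)
  show ?case
  proof (cases k)
    case (Suc l)
    have "of_nat p ^ k * ell p k = of_nat p ^ l * (\<Sum>i<k. ell p i * v (k - i) ^ (p ^ i))"
      using ell_rec[of k] by (simp add: Suc mult_ac)
    also have "\<dots> = (\<Sum>i<k. of_nat p ^ (l - i) * (of_nat p ^ i * ell p i) * v (k - i) ^ (p ^ i))"
      unfolding sum_distrib_left
    proof (intro sum.cong refl)
      fix i assume "i \<in> {..<k}"
      then have "(of_nat p ^ l :: qpoly) = of_nat p ^ (l - i) * of_nat p ^ i"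
        by (simp add: Suc flip: power_add)
      then show "of_nat p ^ l * (ell p i * v (k - i) ^ (p ^ i)) =
        of_nat p ^ (l - i) * (of_nat p ^ i * ell p i) * v (k - i) ^ (p ^ i)" by (simp add: mult_ac)
    qed
    also have "bp_poly p \<dots>"
      by (intro bp_poly.sum bp_poly.mult[OF bp_poly.mult[OF bp_poly.power[OF bp_poly.of_nat] less] bp_poly.power[OF bp_poly_v]]) auto
    finally show ?thesis .
  qed (auto intro: bp_poly.one)
qed

lemma bp_ell_frob: "bp_poly p (of_nat p ^ k * (frob p ^^ j) (ell p k))"
  using F0.hom_funpow_in[OF bp_ell[of k], of j] by (simp add: F0.hom_funpow F0.hom_funpow_of_nat)

lemma bp_cst: "bp_poly p c \<Longrightarrow> bp_series2 p (cst c)"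
  by (auto simp: bp_series2_def bp_series_def intro: bp_poly.zero)

lemma \<Psi>_cst: "(\<Psi> ^^ j) (cst c) = cst ((frob p ^^ j) c)"
proof -
  have "fps_frob p f (fps_const a) = fps_const (f a)" if "f 0 = 0" for f and a :: "'a::comm_ring_1"
    using prime_gt_0_nat[OF prime] that by (intro fps_ext) (auto simp: fps_frob_def elim!: dvdE)
  note c = this
  have "\<Psi> (cst a) = cst (frob p a)" for a
    unfolding \<Psi>_def by (simp add: c[of "fps_frob p (frob p)", OF F1.hom_zero] c[of "frob p", OF frob_zero])
  then show ?thesis by (induction j) auto
qed

lemma \<Psi>_ord: "ord2 n A \<Longrightarrow> ord2 (p ^ j * n) ((\<Psi> ^^ j) A)"
proof (induction j)
  case (Suc j)
  have "ord2 (p * m) (\<Psi> B)" if "ord2 m B" for m B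
    unfolding ord2_def
  proof (intro allI impI)
    fix a b assume ab: "a + b < p * m"
    show "\<Psi> B $ a $ b = 0"
    proof (cases "p dvd a \<and> p dvd b")
      case True
      then obtain a' b' where "a = p * a'" "b = p * b'" by (auto elim!: dvdE)
      moreover from this have "p * (a' + b') < p * m" using ab by (simp only: distrib_left)
      then have "a' + b' < m" by simp
      ultimately show ?thesis using that prime_gt_0_nat[OF prime]
        by (simp add: \<Psi>_def fps_frob_def ord2_def frob_zero)
    qed (auto simp: \<Psi>_def fps_frob_def)
  qed
  from this[OF Suc.IH[OF Suc.prems]] show ?case by (simp add: mult.assoc)
qed auto

text \<open>Grouping the logarithm by the generator v_j of the mirrored recursion gives log A - A as
  the sum over j of v_j / p times the j-fold twisted logarithm at A^(p^j). The pairs with i + j >= N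
  that complete the rectangle have order at least N.\<close>

lemma log_sum_split:
  assumes A: "ord2 1 A"
  shows "ord2 N ((\<Sum>k=1..<N. cst (ell p k) * A ^ (p ^ k)) -
    (\<Sum>j=1..<N. cst (pinv * v j) * (\<Sum>i<N. cst ((frob p ^^ j) (ell p i)) * A ^ (p ^ (i + j)))))"
proof -
  let ?t = "\<lambda>j i. cst (pinv * v j * (frob p ^^ j) (ell p i)) * A ^ (p ^ (i + j))"
  have ell: "ell p k = (\<Sum>j=1..k. pinv * v j * (frob p ^^ j) (ell p (k - j)))" if "k > 0" for k
  proof -
    have "ell p k = pinv * (of_nat p * ell p k)" using p_pinv by (simp add: mult.assoc[symmetric] mult.commute)
    then show ?thesis by (simp only: ell_frob_rec[OF that] sum_distrib_left mult.assoc)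
  qed
  have cs: "cst (sum f S) = (\<Sum>i\<in>S. cst (f i))" for f :: "nat \<Rightarrow> qpoly" and S
    by (induction S rule: infinite_finite_induct) (auto simp flip: fps_const_add)
  have "(\<Sum>k=1..<N. cst (ell p k) * A ^ (p ^ k)) = (\<Sum>k=1..<N. \<Sum>j=1..k. ?t j (k - j))"
  proof (intro sum.cong refl)
    fix k assume "k \<in> {1..<N}"
    then have "k > 0" by simp
    show "cst (ell p k) * A ^ (p ^ k) = (\<Sum>j=1..k. ?t j (k - j))"
      by (subst ell[OF \<open>k > 0\<close>]) (simp add: cs sum_distrib_right)
  qed
  also have "\<dots> = (\<Sum>j=1..<N. \<Sum>i<N - j. ?t j i)"
    by (subst (1 2) sum.Sigma, simp, simp, simp, simp,
        rule sum.reindex_bij_witness[of _ "\<lambda>(j, i). (i + j, j)" "\<lambda>(k, j). (j, k - j)"]) auto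
  finally have 1: "(\<Sum>k=1..<N. cst (ell p k) * A ^ (p ^ k)) = (\<Sum>j=1..<N. \<Sum>i<N - j. ?t j i)" .
  have 2: "(\<Sum>j=1..<N. cst (pinv * v j) * (\<Sum>i<N. cst ((frob p ^^ j) (ell p i)) * A ^ (p ^ (i + j))))
      = (\<Sum>j=1..<N. (\<Sum>i<N - j. ?t j i) + (\<Sum>i=N - j..<N. ?t j i))"
  proof (intro sum.cong refl)
    fix j assume "j \<in> {1..<N}"
    then have "(\<Sum>i<N. ?t j i) = (\<Sum>i<N - j. ?t j i) + (\<Sum>i=N - j..<N. ?t j i)"
      using sum.atLeastLessThan_concat[of 0 "N - j" N "?t j"] by (simp add: atLeast0LessThan)
    then show "cst (pinv * v j) * (\<Sum>i<N. cst ((frob p ^^ j) (ell p i)) * A ^ (p ^ (i + j)))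
      = (\<Sum>i<N - j. ?t j i) + (\<Sum>i=N - j..<N. ?t j i)"
      by (simp add: sum_distrib_left mult.assoc[symmetric])
  qed
  have "ord2 N (\<Sum>j=1..<N. \<Sum>i=N - j..<N. ?t j i)"
  proof (intro ord2_sum ord2_mult_left)
    fix j i assume "j \<in> {1..<N}" "i \<in> {N - j..<N}"
    then have "N \<le> i + j" by auto
    then have "N \<le> p ^ (i + j)" using exponents_less[of "i + j"] by linarith
    then show "ord2 N (A ^ (p ^ (i + j)))" using ord2_power[OF A] ord2_mono by blast
  qed
  then have "ord2 N (0 - (\<Sum>j=1..<N. \<Sum>i=N - j..<N. ?t j i))" by (intro ord2_diff) auto
  then show ?thesis unfolding 1 2 sum.distrib by simp
qed

text \<open>Hazewinkel's functional equation lemma. In the induction on the total degree, G to the power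
  p^(i+j) is congruent modulo p^(i+1) to the p^i-th power of its j-fold Frobenius twist.\<close>
theorem functional_equation:
  assumes G: "ord2 1 G"
    and H: "\<And>N. ord2 N ((\<Sum>k<N. cst (ell p k) * G ^ (p ^ k)) - H)"
    and K: "\<And>N. \<exists>K. bp_series2 p K \<and>
       ord2 N (H - (\<Sum>j=1..<N. cst (pinv * v j) * (\<Psi> ^^ j) H) - K)"
  shows "bp_series2 p G"
proof -
  have step: "\<exists>G'. bp_series2 p G' \<and> ord2 n (G - G')" if "n \<le> N" for n N
    using that
  proof (induction n)
    case 0
    then show ?case by (intro exI[of _ 0]) (auto intro: bp_series2.zero)
  next
    case (Suc n)
    show ?case
    proof (cases "n = 0")
      case True
      then show ?thesis using G by (intro exI[of _ 0]) (auto intro: bp_series2.zero)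
    next
      case False
      then obtain G' where G': "bp_series2 p G'" "ord2 n (G - G')" using Suc by auto
      have G'1: "ord2 1 G'"
        using ord2_diff[OF G ord2_mono[OF G'(2), of 1]] False by simp
      obtain K where K': "bp_series2 p K"
         "ord2 N (H - (\<Sum>j=1..<N. cst (pinv * v j) * (\<Psi> ^^ j) H) - K)" using K by blast
      have N: "{..<N} = insert 0 {1..<N}" using Suc.prems by auto
      let ?f = "\<lambda>A. \<Sum>k=1..<N. cst (ell p k) * A ^ (p ^ k)"
      have "ord2 N (G + ?f G - H)"
        using H[of N] unfolding N by (subst (asm) sum.insert) auto
      then have a1: "ord2 (Suc n) (G + ?f G - H)" using Suc.prems ord2_mono by blast
      \<comment> \<open>Exponents p^k >= 2 gain at least one degree, so the known approximation may
        replace \<open>G\<close> in all nonlinear terms.\<close>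
      have pow: "ord2 (Suc n) (G ^ (p ^ k) - G' ^ (p ^ k))" if "k \<ge> 1" for k
      proof -
        have "p ^ 1 \<le> p ^ k" using that p2 by (intro power_increasing) auto
        then have "p ^ k \<ge> 2" using p2 by simp
        then have "p ^ k > 0" "Suc n \<le> n + (p ^ k - 1)" by linarith+
        then show ?thesis
          using ord2_mono[OF ord2_diff_power[OF G G'1 G'(2), of "p ^ k"], of "Suc n"] by blast
      qed
      have a2: "ord2 (Suc n) (?f G - ?f G')"
        unfolding sum_subtractf[symmetric] right_diff_distrib[symmetric]
        by (intro ord2_sum ord2_mult_left pow) auto
      let ?r = "\<lambda>j. \<Sum>i<N. cst ((frob p ^^ j) (ell p i)) * G' ^ (p ^ (i + j))"
      let ?s = "\<lambda>j. \<Sum>i<N. cst ((frob p ^^ j) (ell p i)) * ((\<Psi> ^^ j) G') ^ (p ^ i)"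
      have a3: "ord2 (Suc n) (?f G' - (\<Sum>j=1..<N. cst (pinv * v j) * ?r j))"
        using log_sum_split[OF G'1, of N] Suc.prems ord2_mono by blast
      have "\<exists>b. bp_series2 p b \<and> G' ^ (p ^ (i + j)) - ((\<Psi> ^^ j) G') ^ (p ^ i) = of_nat p ^ Suc i * b" for i j
      proof -
        have "\<exists>c. bp_series2 p c \<and> G' ^ p ^ j - (\<Psi> ^^ j) G' = of_nat p * c"
          by (rule F2.lift_funpow[OF G'(1)])
        from F2.power_cong_p_power[OF bp_series2.power[OF G'(1)] F2.hom_funpow_in[OF G'(1)] this, of i]
        show ?thesis by (simp add: power_power_power add.commute)
      qed
      then obtain b where b: "\<And>i j. bp_series2 p (b i j)"
        "\<And>i j. G' ^ (p ^ (i + j)) - ((\<Psi> ^^ j) G') ^ (p ^ i) = of_nat p ^ Suc i * b i j" by metis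
      \<comment> \<open>The factor p^(i+1) of the congruence pays for both denominators: p^i for the
        twisted \<open>ell p i\<close> and one p for the \<open>pinv\<close> in front of
        v_j.\<close>
      define R where "R = (\<Sum>j=1..<N. \<Sum>i<N. cst (v j * (of_nat p ^ i * (frob p ^^ j) (ell p i))) * b i j)"
      have R: "bp_series2 p R" unfolding R_def
        by (intro bp_series2.sum bp_series2.mult bp_cst bp_poly.mult bp_poly_v bp_ell_frob b)
      have a4: "(\<Sum>j=1..<N. cst (pinv * v j) * ?r j) - (\<Sum>j=1..<N. cst (pinv * v j) * ?s j) = R"
      proof -
        have "cst (pinv * v j) * ?r j - cst (pinv * v j) * ?s j =
           (\<Sum>i<N. cst (v j * (of_nat p ^ i * (frob p ^^ j) (ell p i))) * b i j)" for j
        proof -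
          have "cst (pinv * v j) * ?r j - cst (pinv * v j) * ?s j =
             (\<Sum>i<N. cst (pinv * v j) * (cst ((frob p ^^ j) (ell p i)) * (of_nat p ^ Suc i * b i j)))"
            by (simp only: right_diff_distrib[symmetric] sum_subtractf[symmetric] sum_distrib_left b)
          also have "\<dots> = (\<Sum>i<N. cst (pinv * of_nat p * (v j * (of_nat p ^ i * (frob p ^^ j) (ell p i)))) * b i j)"
          proof (intro sum.cong refl)
            fix i
            have "(of_nat p :: qpoly fps fps) = cst (of_nat p)" by (simp add: fps_of_nat)
            then have "(of_nat p ^ Suc i :: qpoly fps fps) = cst (of_nat p * of_nat p ^ i)" by simp
            then show "cst (pinv * v j) * (cst ((frob p ^^ j) (ell p i)) * (of_nat p ^ Suc i * b i j)) =
              cst (pinv * of_nat p * (v j * (of_nat p ^ i * (frob p ^^ j) (ell p i)))) * b i j"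
              by (simp only: fps_const_mult[symmetric] mult_ac)
          qed
          also have "pinv * of_nat p = 1" using p_pinv by (simp add: mult.commute)
          finally show ?thesis by simp
        qed
        then show ?thesis unfolding R_def sum_subtractf[symmetric] by simp
      qed
      have a5: "?s j = (\<Psi> ^^ j) (\<Sum>k<N. cst (ell p k) * G' ^ (p ^ k))" for j
        by (simp add: F2.hom_funpow \<Psi>_cst)
      have "ord2 n ((\<Sum>k<N. cst (ell p k) * G' ^ (p ^ k)) - H)"
      proof -
        have "ord2 n ((\<Sum>k<N. cst (ell p k) * G' ^ (p ^ k)) - (\<Sum>k<N. cst (ell p k) * G ^ (p ^ k)))"
          unfolding sum_subtractf[symmetric] right_diff_distrib[symmetric]
        proof (intro ord2_sum ord2_mult_left)
          fix k
          show "ord2 n (G' ^ p ^ k - G ^ p ^ k)"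
            using ord2_mono[OF ord2_diff_power[OF G'1 G ord2_sym[OF G'(2)], of "p ^ k"], of n]
              zero_less_power[OF prime_gt_0_nat[OF prime], of k] by (meson le_add1)
        qed
        then show ?thesis using H[of N] Suc.prems ord2_mono ord2_trans by (meson Suc_leD)
      qed
      \<comment> \<open>Applying \<open>\<Psi>\<close> j times multiplies orders by p^j >= 2, so
        agreement with \<open>H\<close> below degree n already yields agreement below degree n +
        1.\<close>
      then have a6: "ord2 (Suc n) (?s j - (\<Psi> ^^ j) H)" if "j \<ge> 1" for j
      proof -
        have "p ^ 1 \<le> p ^ j" using that p2 by (intro power_increasing) auto
        then have "2 * n \<le> p ^ j * n" using p2 by (intro mult_right_mono) auto
        then have "Suc n \<le> p ^ j * n" using False by linarith
        moreover have "ord2 (p ^ j * n) (?s j - (\<Psi> ^^ j) H)"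
          unfolding a5 F2.hom_funpow(3)[symmetric] by (rule \<Psi>_ord) fact
        ultimately show ?thesis using ord2_mono by blast
      qed
      have a7: "ord2 (Suc n) ((\<Sum>j=1..<N. cst (pinv * v j) * ?s j) - (\<Sum>j=1..<N. cst (pinv * v j) * (\<Psi> ^^ j) H))"
        unfolding sum_subtractf[symmetric] right_diff_distrib[symmetric]
        by (intro ord2_sum ord2_mult_left a6) auto
      have a8: "ord2 (Suc n) (H - (\<Sum>j=1..<N. cst (pinv * v j) * (\<Psi> ^^ j) H) - K)"
        using K'(2) Suc.prems ord2_mono by blast
      have eq: "G - (K - R) = (G + ?f G - H) - (?f G - ?f G') - (?f G' - (\<Sum>j=1..<N. cst (pinv * v j) * ?r j))
         - ((\<Sum>j=1..<N. cst (pinv * v j) * ?s j) - (\<Sum>j=1..<N. cst (pinv * v j) * (\<Psi> ^^ j) H))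
         + (H - (\<Sum>j=1..<N. cst (pinv * v j) * (\<Psi> ^^ j) H) - K)"
        unfolding a4[symmetric] by (simp add: algebra_simps)
      have "ord2 (Suc n) (G - (K - R))"
        unfolding eq by (rule ord2_add[OF ord2_diff[OF ord2_diff[OF ord2_diff[OF a1 a2] a3] a7] a8])
      then show ?thesis using K'(1) R by (intro exI[of _ "K - R"]) (auto intro: bp_series2.diff)
    qed
  qed
  show ?thesis
    unfolding bp_series2_def bp_series_def
  proof (intro allI)
    fix i j
    obtain G' where "bp_series2 p G'" "ord2 (Suc (i + j)) (G - G')" using step by blast
    then show "bp_poly p (G $ i $ j)"
      by (auto simp: ord2_def bp_series2_def bp_series_def)
  qed
qed

text \<open>For a variable y, on which the Frobenius lift is the p-th power, the grouping of
  \<open>log_sum_split\<close> is exactly the functional equation of the logarithm, with integral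
  part y.\<close>

lemma log_functional:
  assumes y: "ord2 1 y" "\<Psi> y = y ^ p"
    and H: "\<And>N. ord2 N (H - (\<Sum>k<N. cst (ell p k) * y ^ (p ^ k)))"
  shows "ord2 N (H - (\<Sum>j=1..<N. cst (pinv * v j) * (\<Psi> ^^ j) H) - y)"
proof (cases "N = 0")
  case False
  have yj: "(\<Psi> ^^ j) y = y ^ (p ^ j)" for j
    by (induction j) (auto simp: y F2.hom_power mult.commute simp flip: power_mult)
  let ?r = "\<lambda>j. \<Sum>i<N. cst ((frob p ^^ j) (ell p i)) * y ^ (p ^ (i + j))"
  have "ord2 N ((\<Psi> ^^ j) H - ?r j)" for j
  proof -
    have "ord2 (p ^ j * N) ((\<Psi> ^^ j) (H - (\<Sum>k<N. cst (ell p k) * y ^ (p ^ k))))"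
      using H by (rule \<Psi>_ord)
    then have "ord2 N ((\<Psi> ^^ j) (H - (\<Sum>k<N. cst (ell p k) * y ^ (p ^ k))))"
      using p2 by (rule_tac ord2_mono) auto
    moreover have "(\<Psi> ^^ j) (\<Sum>k<N. cst (ell p k) * y ^ (p ^ k)) = ?r j"
      by (simp add: F2.hom_funpow \<Psi>_cst yj power_power_power add.commute)
    ultimately show ?thesis by (simp add: F2.hom_funpow)
  qed
  then have 1: "ord2 N ((\<Sum>j=1..<N. cst (pinv * v j) * (\<Psi> ^^ j) H) - (\<Sum>j=1..<N. cst (pinv * v j) * ?r j))"
    unfolding sum_subtractf[symmetric] right_diff_distrib[symmetric]
    by (intro ord2_sum ord2_mult_left)
  have N: "{..<N} = insert 0 {1..<N}" using False by auto
  have "ord2 N (H - (y + (\<Sum>k=1..<N. cst (ell p k) * y ^ (p ^ k))))"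
    using H[of N] unfolding N by (subst (asm) sum.insert) auto
  from ord2_diff[OF ord2_add[OF this log_sum_split[OF y(1), of N]] 1]
  show ?thesis by (simp add: algebra_simps)
qed auto

lemma log_approx: "ord2 1 C \<Longrightarrow> ord2 N (comp2 (lg p) C - (\<Sum>k<N. cst (ell p k) * C ^ (p ^ k)))"
  using comp2_lg_approx[of C N] exponents_less[of N] ord2_mono by (meson less_imp_le)

text \<open>The functional equation is additive, so i log xi + log x satisfies it with the integral
  part i xi + x.\<close>

theorem bp_Z: "bp_series2 p (Z i)"
proof (rule functional_equation[OF ord_Z])
  show "ord2 N ((\<Sum>k<N. cst (ell p k) * Z i ^ p ^ k) - comp2 (lg p) (Z i))" for N
    using log_approx[OF ord_Z] ord2_sym by blast
  fix N
  let ?X = "fps_const fps_X :: qpoly fps fps" and ?Y = "fps_X :: qpoly fps fps"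
  let ?D = "\<lambda>H. H - (\<Sum>j=1..<N. cst (pinv * v j) * (\<Psi> ^^ j) H)"
  have X: "ord2 1 ?X" "ord2 1 ?Y" by (auto simp: ord2_def)
  have fX: "fps_frob p f fps_X = fps_X ^ p" if "f 0 = 0" "f 1 = 1" for f :: "'a::comm_ring_1 \<Rightarrow> 'a"
  proof (rule fps_ext)
    fix n
    show "fps_frob p f fps_X $ n = fps_X ^ p $ n"
      using that p2 by (cases "p dvd n") (auto simp: fps_frob_def fps_X_power_nth fps_X_nth elim: dvdE)
  qed
  have f1: "frob p 1 = 1" using F0.hom_one .
  have fc: "fps_frob p f (fps_const a) = fps_const (f a)" if "f 0 = 0" for f and a :: "'a::comm_ring_1"
    using prime_gt_0_nat[OF prime] that by (intro fps_ext) (auto simp: fps_frob_def elim!: dvdE)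
  have \<Psi>: "\<Psi> ?X = ?X ^ p" "\<Psi> ?Y = ?Y ^ p"
    by (simp_all add: \<Psi>_def fX fc F1.hom_zero F1.hom_one frob_zero f1)
  have "ord2 N (?D (comp2 (lg p) ?X) - ?X)" "ord2 N (?D (comp2 (lg p) ?Y) - ?Y)"
    using log_functional[OF X(1) \<Psi>(1) log_approx[OF X(1)]]
      log_functional[OF X(2) \<Psi>(2) log_approx[OF X(2)]] by blast+
  then have "ord2 N (of_nat i * (?D (comp2 (lg p) ?X) - ?X) + (?D (comp2 (lg p) ?Y) - ?Y))"
    by (intro ord2_add ord2_mult_left)
  also have "of_nat i * (?D (comp2 (lg p) ?X) - ?X) + (?D (comp2 (lg p) ?Y) - ?Y) =
     ?D (comp2 (lg p) (Z i)) - (of_nat i * ?X + ?Y)"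
  proof -
    have "?D (A + B) = ?D A + ?D B" for A B
      unfolding F2.hom_funpow distrib_left sum.distrib by simp
    moreover have "?D (of_nat i * A) = of_nat i * ?D A" for A
      unfolding F2.hom_funpow F2.hom_funpow_of_nat right_diff_distrib sum_distrib_left
      by (simp add: mult.left_commute)
    ultimately show ?thesis
      unfolding comp2_lg_Z by (simp only: right_diff_distrib[of "of_nat i" _ ?X]) simp
  qed
  finally have "ord2 N (?D (comp2 (lg p) (Z i)) - (of_nat i * ?X + ?Y))" .
  moreover have "bp_series2 p ?X" "bp_series2 p ?Y"
    by (auto simp: bp_series2_def bp_series_def fps_X_nth intro: bp_poly.closed)
  then have "bp_series2 p (of_nat i * ?X + ?Y)"
    by (intro bp_series2.add bp_series2.mult bp_series2.of_nat)
  ultimately show "\<exists>K. bp_series2 p K \<and> ord2 N (?D (comp2 (lg p) (Z i)) - K)" by blast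
qed

end

section \<open>The quotient by the p-series\<close>

text \<open>Multiplication by a generator only shifts exponent vectors; hence v_1 is a
  non-zero-divisor modulo p.\<close>

lemma lookup_v_mult:
  "Poly_Mapping.lookup (v i * f) (Poly_Mapping.single i 1 + m) = Poly_Mapping.lookup f m"
proof -
  have "v i * f = (\<Sum>n\<in>Poly_Mapping.keys f. Poly_Mapping.single (Poly_Mapping.single i 1 + n) (Poly_Mapping.lookup f n))"
    by (subst poly_mapping_sum_monomials[OF finite_keys subset_refl, of f, symmetric])
       (simp add: v_def sum_distrib_left mult_single)
  then have "Poly_Mapping.lookup (v i * f) (Poly_Mapping.single i 1 + m)
     = (\<Sum>n\<in>Poly_Mapping.keys f. if n = m then Poly_Mapping.lookup f m else 0)"
    by (auto simp: lookup_sum lookup_single when_def intro!: sum.cong)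
  then show ?thesis by (simp add: sum.delta in_keys_iff)
qed

lemma digit_poly_zero: "p > 0 \<Longrightarrow> digit_poly p 0"
  by (auto simp: digit_poly_def intro!: exI[of _ 0])

lemma bp_poly_digit:
  assumes "bp_poly p f" "p > 0"
  shows "\<exists>e. bp_poly p e \<and> digit_poly p (f - of_nat p * e)"
proof -
  have "\<forall>m. \<exists>d s. d < p \<and> pint p s \<and> Poly_Mapping.lookup f m = of_nat d + of_nat p * s"
    using pint_digit assms unfolding bp_poly_iff by metis
  then obtain d s where ds: "\<And>m. d m < p" "\<And>m. pint p (s m)"
    "\<And>m. Poly_Mapping.lookup f m = of_nat (d m) + of_nat p * s m" by metis
  define e where "e = (\<Sum>m\<in>Poly_Mapping.keys f. Poly_Mapping.single m (s m))"
  have e: "Poly_Mapping.lookup e m = (if m \<in> Poly_Mapping.keys f then s m else 0)" for m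
  proof -
    have "Poly_Mapping.lookup e m = (\<Sum>n\<in>Poly_Mapping.keys f. if n = m then s m else 0)"
      unfolding e_def by (auto simp: lookup_sum lookup_single when_def intro!: sum.cong)
    then show ?thesis by simp
  qed
  have pe: "Poly_Mapping.lookup (of_nat p * e) m = of_nat p * Poly_Mapping.lookup e m" for m
    using lookup_qconst_mult[of "of_nat p" e m] by simp
  have "digit_poly p (f - of_nat p * e)"
    unfolding digit_poly_def
  proof
    fix m
    show "\<exists>d<p. Poly_Mapping.lookup (f - of_nat p * e) m = rat_of_nat d"
    proof (cases "m \<in> Poly_Mapping.keys f")
      case True
      then show ?thesis using ds by (auto simp: lookup_minus pe e intro!: exI[of _ "d m"])
    next
      case False
      then show ?thesis using assms(2) by (auto simp: lookup_minus pe e in_keys_iff intro!: exI[of _ 0])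
    qed
  qed
  moreover have "bp_poly p e" using ds by (auto simp: bp_poly_iff e pint.zero)
  ultimately show ?thesis by blast
qed

lemma fps_shift_eq: "(\<And>k. k < n \<Longrightarrow> f $ k = 0) \<Longrightarrow> f = fps_X ^ n * fps_shift n (f :: 'a::comm_ring_1 fps)"
  by (rule fps_ext) (simp add: fps_X_power_mult_nth)

lemma bp_series_shift: "bp_series p f \<Longrightarrow> bp_series p (fps_shift n f)"
  by (simp add: bp_series_def)

lemma bp_series_const: "bp_poly p c \<Longrightarrow> bp_series p (fps_const c)"
  by (auto simp: bp_series_def intro: bp_poly.zero)

lemma bp_series_X: "bp_series p fps_X"
  by (auto simp: bp_series_def fps_X_nth intro: bp_poly.closed)

section \<open>The p-series, division by p and the order in xi\<close>

context bp_prime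
begin

lemma p_pos: "p > 0" using prime by (rule prime_gt_0_nat)

abbreviation q :: nat where "q \<equiv> p - 1"

lemma q_pos: "q > 0" using p2 by simp

lemma bp_fmul: "bp_series p (fmul p i)"
  using bp_Z[of i] unfolding Z_nth_0[symmetric] bp_series2_def by blast

definition rho :: "nat \<Rightarrow> qpoly fps" where
  "rho i = fps_shift 1 (fmul p i)"

lemma pbr_rho: "pbr p = rho p"
  by (simp add: pbr_def rho_def)

lemma fmul_rho: "fmul p i = fps_X * rho i"
  using fps_shift_eq[of 1 "fmul p i"] by (simp add: rho_def fmul_0)

lemma bp_rho: "bp_series p (rho i)"
  unfolding rho_def by (intro bp_series_shift bp_fmul)

lemma bp_pbr: "bp_series p (pbr p)"
  unfolding pbr_rho by (rule bp_rho)

lemma not_power: "i < p \<Longrightarrow> i \<noteq> 1 \<Longrightarrow> i \<notin> range (\<lambda>k. p ^ k)"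
proof
  assume i: "i < p" "i \<noteq> 1" "i \<in> range (\<lambda>k. p ^ k)"
  then obtain k where k: "i = p ^ k" by auto
  then have "k \<noteq> 0" using i by (intro notI) simp
  then have "p ^ 1 \<le> p ^ k" using p2 by (intro power_increasing) auto
  then show False using i k by simp
qed

lemma lg_compose_low:
  assumes "f $ 0 = 0" "n < p"
  shows "(lg p oo f) $ n = f $ n"
proof (cases "n = 0")
  case False
  have "(lg p oo f) $ n = (\<Sum>i=0..n. if i = 1 then f $ n else 0)"
    unfolding fps_compose_nth
  proof (intro sum.cong refl)
    fix i assume "i \<in> {0..n}"
    moreover have "lg p $ i = 0" if "i < p" "i \<noteq> 1"
      using that by (intro lg_nth_other not_power)
    ultimately show "lg p $ i * f ^ i $ n = (if i = 1 then f $ n else 0)"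
      using assms lg_1 by auto
  qed
  then show ?thesis using False by simp
qed (use assms in simp)

lemma rho_0: "rho i $ 0 = of_nat i"
proof -
  have "(lg p oo fmul p i) $ 1 = fmul p i $ 1"
    using p2 by (intro lg_compose_low fmul_0) auto
  then show ?thesis
    unfolding lg_fmul rho_def using lg_1 by (simp add: fps_mult_of_nat_nth)
qed

text \<open>The logarithm has no term between degrees 1 and p, so the p-series divided by xi is p
  plus a multiple of xi^q. In the quotient p equals - xi^q \<open>V\<close>, which is why p counts
  as q orders.\<close>

definition V :: "qpoly fps" where
  "V = fps_shift q (pbr p - of_nat p)"

lemma pbr_low: "0 < n \<Longrightarrow> n < q \<Longrightarrow> pbr p $ n = 0"
proof -
  assume n: "0 < n" "n < q"
  then have "(lg p oo fmul p p) $ (Suc n) = fmul p p $ Suc n"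
    by (intro lg_compose_low fmul_0) auto
  moreover have "Suc n \<notin> range (\<lambda>k. p ^ k)"
    using n by (intro not_power) auto
  ultimately show ?thesis
    unfolding lg_fmul pbr_def by (simp add: fps_mult_of_nat_nth lg_nth_other)
qed

lemma ell_1: "of_nat p * ell p 1 = v 1"
  using ell_rec[of 1] by simp

lemma pbr_q: "pbr p $ q = v 1 * (1 - of_nat p ^ q)"
proof -
  let ?f = "fmul p p"
  have f1: "?f $ 1 = of_nat p"
    using rho_0[of p] by (simp add: rho_def)
  have "(lg p oo ?f) $ p = (\<Sum>i=0..p. lg p $ i * ?f ^ i $ p)"
    by (simp add: fps_compose_nth)
  also have "\<dots> = (\<Sum>i\<in>{1, p}. lg p $ i * ?f ^ i $ p)"
  proof (intro sum.mono_neutral_right)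
    show "\<forall>i\<in>{0..p} - {1, p}. lg p $ i * ?f ^ i $ p = 0"
    proof
      fix i assume i: "i \<in> {0..p} - {1, p}"
      then have "i \<notin> range (\<lambda>k. p ^ k)" by (intro not_power) auto
      then show "lg p $ i * ?f ^ i $ p = 0" by (simp add: lg_nth_other)
    qed
  qed (use p2 in auto)
  also have "\<dots> = ?f $ p + ell p 1 * of_nat p ^ p"
    using p2 lg_1 lg_nth_power[of 1] startsby_zero_power_nth_same[OF fmul_0, of p p] f1 by simp
  finally have "?f $ p = of_nat p * ell p 1 - ell p 1 * of_nat p ^ p"
    unfolding lg_fmul using lg_nth_power[of 1] by (simp add: fps_mult_of_nat_nth)
  also have "(of_nat p ^ p :: qpoly) = of_nat p * of_nat p ^ q"
    using p_pos by (simp flip: power_Suc)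
  also have "of_nat p * ell p 1 - ell p 1 * (of_nat p * of_nat p ^ q) = v 1 * (1 - of_nat p ^ q)"
    unfolding ell_1[symmetric] by (simp add: algebra_simps)
  finally show ?thesis using p_pos by (simp add: pbr_def)
qed

lemma pbr_V: "pbr p = of_nat p + fps_X ^ q * V"
proof -
  have "pbr p - of_nat p = fps_X ^ q * V"
    unfolding V_def
  proof (rule fps_shift_eq)
    fix k assume "k < q"
    then show "(pbr p - of_nat p) $ k = 0"
      using pbr_low[of k] rho_0[of p] by (cases "k = 0") (auto simp: pbr_rho fps_of_nat[symmetric] simp del: fps_of_nat)
  qed
  then show ?thesis by (simp add: algebra_simps)
qed

lemma bp_V: "bp_series p V"
  unfolding V_def by (intro bp_series_shift bp_series.diff bp_pbr bp_series.of_nat)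

lemma V_0: "V $ 0 = v 1 * (1 - of_nat p ^ q)"
  using pbr_q q_pos by (simp add: V_def fps_of_nat[symmetric] del: fps_of_nat)

lemma bp_poly_div_p:
  assumes "bp_poly p c" "v 1 * f = of_nat p * c"
  shows "bp_poly p (pinv * f)"
  unfolding bp_poly_iff
proof
  fix m
  have "Poly_Mapping.lookup f m = Poly_Mapping.lookup (qconst (of_nat p) * c) (Poly_Mapping.single 1 1 + m)"
    using lookup_v_mult[of 1 f m] assms(2) by simp
  then have "Poly_Mapping.lookup (pinv * f) m = Poly_Mapping.lookup c (Poly_Mapping.single 1 1 + m)"
    using p_pos by (simp only: lookup_qconst_mult) simp
  then show "pint p (Poly_Mapping.lookup (pinv * f) m)"
    using assms(1) by (simp add: bp_poly_iff)
qed

lemma p_pinv_mult: "of_nat p * (pinv * f) = f"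
  by (simp add: p_pinv flip: mult.assoc)

text \<open>Dividing by p costs q orders of xi modulo the ideal generated by pbr: modulo p, pbr is
  xi^q times a series with leading coefficient v_1, which is not a zero divisor.\<close>
lemma descend_p:
  assumes f: "bp_series p f" and u: "bp_series p u" and g: "bp_series p g"
    and eq: "of_nat p * f = pbr p * u + fps_X ^ M * g"
  shows "\<exists>u' g'. bp_series p u' \<and> bp_series p g' \<and> f = pbr p * u' + fps_X ^ (M - q) * g'"
proof (cases "q \<le> M")
  case False
  then show ?thesis using f by (intro exI[of _ 0] exI[of _ f]) (auto intro: bp_series.zero)
next
  case True
  have pq: "(of_nat p ^ q :: qpoly) = of_nat p * of_nat p ^ (q - 1)"
    using q_pos by (cases q) auto
  \<comment> \<open>In degree n + q every term other than v_1 u_n is a multiple of p, by the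
    induction hypothesis and because xi^M starts too late. As v_1 can be cancelled modulo p, u_n is
    divisible by p.\<close>
  have un: "bp_poly p (pinv * u $ n)" if "n < M - q" for n
    using that
  proof (induction n rule: less_induct)
    case (less n)
    have "(of_nat p * f) $ (n + q) = (of_nat p * u + fps_X ^ q * (V * u) + fps_X ^ M * g) $ (n + q)"
      unfolding eq pbr_V by (simp add: algebra_simps)
    then have "of_nat p * f $ (n + q) = of_nat p * u $ (n + q) + (V * u) $ n"
      using less.prems by (simp add: fps_X_power_mult_nth fps_mult_of_nat_nth)
    also have "(V * u) $ n = (\<Sum>i=0..n. u $ i * V $ (n - i))"
      by (simp add: fps_mult_nth mult.commute[of V u])
    also have "\<dots> = u $ n * V $ 0 + (\<Sum>i<n. u $ i * V $ (n - i))"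
      by (cases n) (auto simp: atLeast0AtMost lessThan_Suc_atMost add.commute)
    also have "(\<Sum>i<n. u $ i * V $ (n - i)) = of_nat p * (\<Sum>i<n. (pinv * u $ i) * V $ (n - i))"
      by (simp add: sum_distrib_left mult.assoc[symmetric] p_pinv)
    finally have "v 1 * u $ n = of_nat p * (f $ (n + q) - u $ (n + q)
       - (\<Sum>i<n. (pinv * u $ i) * V $ (n - i)) + of_nat p ^ (q - 1) * v 1 * u $ n)"
      by (simp only: V_0 pq) (simp add: algebra_simps)
    then show ?case
    proof (rule bp_poly_div_p[rotated])
      show "bp_poly p (f $ (n + q) - u $ (n + q) - (\<Sum>i<n. (pinv * u $ i) * V $ (n - i))
          + of_nat p ^ (q - 1) * v 1 * u $ n)"
        using less f u bp_V by (intro bp_poly.add bp_poly.diff bp_poly.sum bp_poly.mult[of p "pinv * _"] bp_poly.mult[of p "_ * v 1"] bp_poly.mult[of p "of_nat p ^ _"]  bp_poly.power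
          bp_poly.of_nat bp_poly_v) (auto simp: bp_series_def)
    qed
  qed
  define u2 where "u2 = Abs_fps (\<lambda>n. if n < M - q then pinv * u $ n else 0)"
  define u1 where "u1 = fps_shift (M - q) u"
  have u2: "bp_series p u2" using un by (auto simp: bp_series_def u2_def intro: bp_poly.zero)
  have u_eq: "u = of_nat p * u2 + fps_X ^ (M - q) * u1"
    by (rule fps_ext) (auto simp: u1_def u2_def fps_X_power_mult_nth fps_mult_of_nat_nth p_pinv_mult)
  have XM: "fps_X ^ M = fps_X ^ (M - q) * (fps_X ^ q :: qpoly fps)"
    using True by (simp flip: power_add)
  have h: "of_nat p * (f - pbr p * u2) = fps_X ^ (M - q) * (pbr p * u1 + fps_X ^ q * g)"
    using eq unfolding u_eq XM by (simp add: algebra_simps)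
  have low: "(f - pbr p * u2) $ k = 0" if "k < M - q" for k
  proof -
    have "(of_nat p * (f - pbr p * u2)) $ k = 0"
      unfolding h using that by (simp add: fps_X_power_mult_nth)
    then show ?thesis using p_pos by (simp add: fps_mult_of_nat_nth)
  qed
  have "f - pbr p * u2 = fps_X ^ (M - q) * fps_shift (M - q) (f - pbr p * u2)"
    by (rule fps_shift_eq) (rule low)
  then have "f = pbr p * u2 + fps_X ^ (M - q) * fps_shift (M - q) (f - pbr p * u2)"
    by (simp add: algebra_simps)
  moreover have "bp_series p (fps_shift (M - q) (f - pbr p * u2))"
    using f u2 bp_pbr by (intro bp_series_shift bp_series.diff bp_series.mult)
  ultimately show ?thesis using u2 by blast
qed

lemma descend_p_power:
  assumes "bp_series p f" "bp_series p u" "bp_series p g"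
    and "of_nat p ^ k * f = pbr p * u + fps_X ^ M * g"
  shows "\<exists>u' g'. bp_series p u' \<and> bp_series p g' \<and> f = pbr p * u' + fps_X ^ (M - k * q) * g'"
  using assms
proof (induction k arbitrary: u g M)
  case 0
  then show ?case by auto
next
  case (Suc k)
  have "of_nat p * (of_nat p ^ k * f) = pbr p * u + fps_X ^ M * g"
    using Suc.prems by (simp add: mult.assoc)
  from descend_p[OF _ Suc.prems(2,3) this] obtain u' g' where
    "bp_series p u'" "bp_series p g'" "of_nat p ^ k * f = pbr p * u' + fps_X ^ (M - q) * g'"
    using Suc.prems(1) by (auto intro: bp_series.mult bp_series.power bp_series.of_nat)
  from Suc.IH[OF Suc.prems(1) this] show ?case by (simp add: add.commute)
qed

text \<open>Since \<open>pbr p\<close> has constant term p, subtracting w_n times it reduces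
  coefficient n to digits and sends the carry to higher degrees only.\<close>

lemma normal_form_exists:
  assumes g: "bp_series p g"
  shows "\<exists>s w. (\<forall>i. digit_poly p (s $ i)) \<and> bp_series p w \<and> g = s + pbr p * w"
proof -
  let ?A = "\<lambda>f n. g $ n - (\<Sum>i<n. pbr p $ (n - i) * f i)"
  have "\<exists>w. \<forall>n. bp_poly p (w n) \<and> digit_poly p (?A w n - of_nat p * w n)"
  proof (rule dependent_wellorder_choice)
    fix n and f :: "nat \<Rightarrow> qpoly"
    assume "\<And>y. y < n \<Longrightarrow> bp_poly p (f y) \<and> digit_poly p (?A f y - of_nat p * f y)"
    then have "bp_poly p (?A f n)" using g bp_pbr
      by (intro bp_poly.diff bp_poly.sum bp_poly.mult) (auto simp: bp_series_def)
    then show "\<exists>r. bp_poly p r \<and> digit_poly p (?A f n - of_nat p * r)"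
      using bp_poly_digit[OF _ p_pos] by blast
  qed auto
  then obtain w where w: "\<And>n. bp_poly p (w n)" "\<And>n. digit_poly p (?A w n - of_nat p * w n)" by blast
  define W where "W = Abs_fps w"
  have "(g - pbr p * W) $ n = ?A w n - of_nat p * w n" for n
  proof -
    have "(pbr p * W) $ n = (W * pbr p) $ n" by (simp add: mult.commute)
    also have "\<dots> = (\<Sum>i=0..n. w i * pbr p $ (n - i))" by (simp add: fps_mult_nth W_def)
    also have "\<dots> = w n * pbr p $ 0 + (\<Sum>i<n. w i * pbr p $ (n - i))"
      by (cases n) (auto simp: atLeast0AtMost lessThan_Suc_atMost add.commute)
    finally show ?thesis using rho_0[of p] by (simp add: pbr_rho mult.commute)
  qed
  then have "digit_poly p ((g - pbr p * W) $ n)" for n using w(2)[of n] by (simp only:)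
  moreover have "bp_series p W" using w by (simp add: W_def bp_series_def)
  ultimately show ?thesis by (intro exI[of _ "g - pbr p * W"] exI[of _ W]) auto
qed

text \<open>The condition \<open>xo N f\<close> says that \<open>f\<close> vanishes to order at least \<open>N\<close> in \<open>\<xi>\<close> in the quotient by
  \<open>\<langle>p\<rangle>\<xi>\<close>, where \<open>p\<close> is inverted and counts as \<open>\<xi>\<close> to the power \<open>q = p - 1\<close>; \<open>N\<close> may be negative.\<close>
definition xo :: "int \<Rightarrow> qpoly fps \<Rightarrow> bool" where
  "xo N f \<longleftrightarrow> (\<exists>k M u g. bp_series p u \<and> bp_series p g \<and> N + int (k * q) \<le> int M
     \<and> of_nat p ^ k * f = pbr p * u + fps_X ^ M * g)"

lemma xo_raise:
  assumes "bp_series p u" "bp_series p g" "of_nat p ^ k * f = pbr p * u + fps_X ^ M * g"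
  shows "\<exists>u' g'. bp_series p u' \<and> bp_series p g' \<and>
    of_nat p ^ (k + d) * f = pbr p * u' + fps_X ^ (M + d * q) * g'"
proof (induction d)
  case 0
  then show ?case using assms by auto
next
  case (Suc d)
  then obtain u' g' where u: "bp_series p u'" "bp_series p g'"
    "of_nat p ^ (k + d) * f = pbr p * u' + fps_X ^ (M + d * q) * g'" by blast
  have XS: "(fps_X :: qpoly fps) ^ (M + Suc d * q) = fps_X ^ (M + d * q) * fps_X ^ q"
    by (simp only: mult_Suc power_add mult_ac)
  have "of_nat p ^ (k + Suc d) * f = of_nat p * (of_nat p ^ (k + d) * f)" by (simp add: mult.assoc)
  also have "\<dots> = pbr p * (of_nat p * u') + fps_X ^ (M + d * q) * (of_nat p * g')"
    unfolding u(3) by (simp add: algebra_simps)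
  also have "of_nat p * g' = pbr p * g' - fps_X ^ q * V * g'"
    unfolding pbr_V by (simp add: algebra_simps)
  finally have "of_nat p ^ (k + Suc d) * f = pbr p * (of_nat p * u' + fps_X ^ (M + d * q) * g')
      + fps_X ^ (M + Suc d * q) * (- (V * g'))"
    unfolding XS by (simp add: algebra_simps)
  moreover have "bp_series p (of_nat p * u' + fps_X ^ (M + d * q) * g')" "bp_series p (- (V * g'))"
    using u bp_V bp_series_X
    by (auto intro!: bp_series.add bp_series.mult bp_series.neg bp_series.power bp_series.of_nat)
  ultimately show ?case by blast
qed

lemma xo_mono: "xo N f \<Longrightarrow> N' \<le> N \<Longrightarrow> xo N' f"
  unfolding xo_def by (meson add_right_mono order_trans)

lemma xo_add:
  assumes "xo N f" "xo N f'"
  shows "xo N (f + f')"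
proof -
  obtain k M u g where a: "bp_series p u" "bp_series p g" "N + int (k * q) \<le> int M"
    "of_nat p ^ k * f = pbr p * u + fps_X ^ M * g" using assms(1) unfolding xo_def by blast
  obtain k' M' u' g' where b: "bp_series p u'" "bp_series p g'" "N + int (k' * q) \<le> int M'"
    "of_nat p ^ k' * f' = pbr p * u' + fps_X ^ M' * g'" using assms(2) unfolding xo_def by blast
  obtain u1 g1 where a1: "bp_series p u1" "bp_series p g1"
    "of_nat p ^ (k + k') * f = pbr p * u1 + fps_X ^ (M + k' * q) * g1"
    using xo_raise[OF a(1,2,4)] by blast
  obtain u2 g2 where b1: "bp_series p u2" "bp_series p g2"
    "of_nat p ^ (k' + k) * f' = pbr p * u2 + fps_X ^ (M' + k * q) * g2"
    using xo_raise[OF b(1,2,4)] by blast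
  define m where "m = min (M + k' * q) (M' + k * q)"
  have X: "fps_X ^ (M + k' * q) = fps_X ^ m * (fps_X ^ (M + k' * q - m) :: qpoly fps)"
    "fps_X ^ (M' + k * q) = fps_X ^ m * (fps_X ^ (M' + k * q - m) :: qpoly fps)"
    by (simp_all add: m_def flip: power_add)
  have "of_nat p ^ (k + k') * (f + f') = pbr p * (u1 + u2) +
     fps_X ^ m * (fps_X ^ (M + k' * q - m) * g1 + fps_X ^ (M' + k * q - m) * g2)"
    using a1(3) b1(3) unfolding X by (simp add: algebra_simps)
  moreover have "bp_series p (u1 + u2)"
    "bp_series p (fps_X ^ (M + k' * q - m) * g1 + fps_X ^ (M' + k * q - m) * g2)"
    using a1 b1 bp_series_X by (auto intro!: bp_series.add bp_series.mult bp_series.power)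
  moreover have "N + int ((k + k') * q) \<le> int m"
    using a(3) b(3) unfolding m_def by (simp add: add_mult_distrib min_def)
  ultimately show ?thesis unfolding xo_def by blast
qed

lemma xo_mult:
  assumes "xo N f" "xo N' f'"
  shows "xo (N + N') (f * f')"
proof -
  obtain k M u g where a: "bp_series p u" "bp_series p g" "N + int (k * q) \<le> int M"
    "of_nat p ^ k * f = pbr p * u + fps_X ^ M * g" using assms(1) unfolding xo_def by blast
  obtain k' M' u' g' where b: "bp_series p u'" "bp_series p g'" "N' + int (k' * q) \<le> int M'"
    "of_nat p ^ k' * f' = pbr p * u' + fps_X ^ M' * g'" using assms(2) unfolding xo_def by blast
  have "of_nat p ^ (k + k') * (f * f') = (of_nat p ^ k * f) * (of_nat p ^ k' * f')"
    by (simp add: power_add mult_ac)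
  also have "\<dots> = pbr p * (u * (pbr p * u' + fps_X ^ M' * g') + fps_X ^ M * g * u') + fps_X ^ (M + M') * (g * g')"
    unfolding a(4) b(4) by (simp add: algebra_simps power_add)
  finally have "of_nat p ^ (k + k') * (f * f') = \<dots>" .
  moreover have "bp_series p (u * (pbr p * u' + fps_X ^ M' * g') + fps_X ^ M * g * u')" "bp_series p (g * g')"
    using a b bp_pbr bp_series_X by (auto intro!: bp_series.add bp_series.mult bp_series.power)
  moreover have "N + N' + int ((k + k') * q) \<le> int (M + M')"
    using a(3) b(3) by (simp add: add_mult_distrib)
  ultimately show ?thesis unfolding xo_def by blast
qed

lemma xo_bp: "bp_series p f \<Longrightarrow> xo 0 f"
  unfolding xo_def by (intro exI[of _ 0] exI[of _ f]) (auto intro: bp_series.zero)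

lemma xo_X: "xo (int n) (fps_X ^ n)"
  unfolding xo_def by (intro exI[of _ 0] exI[of _ n] exI[of _ 1]) (auto intro: bp_series.closed)

lemma xo_pbr: "bp_series p u \<Longrightarrow> xo N (pbr p * u)"
  unfolding xo_def
  by (intro exI[of _ 0] exI[of _ "nat N"] exI[of _ u]) (auto intro: bp_series.closed)

lemma xo_zero: "xo N 0"
  using xo_pbr[OF bp_series.zero] by simp

lemma xo_neg: "xo N f \<Longrightarrow> xo N (- f)"
  using xo_mult[OF xo_bp[OF bp_series.neg[OF bp_series.one]], of N f] by simp

lemma xo_diff: "xo N f \<Longrightarrow> xo N g \<Longrightarrow> xo N (f - g)"
  using xo_add[of N f "- g"] xo_neg by simp

lemma xo_sum: "(\<And>i. i \<in> S \<Longrightarrow> xo N (f i)) \<Longrightarrow> xo N (sum f S)"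
  by (induction S rule: infinite_finite_induct) (auto intro: xo_zero xo_add)

lemma xo_mult_bp: "bp_series p f \<Longrightarrow> xo N g \<Longrightarrow> xo N (f * g)"
  using xo_mult[OF xo_bp, of f N g] by simp

lemma xo_mult0: "xo 0 f \<Longrightarrow> xo N g \<Longrightarrow> xo N (f * g)"
  using xo_mult[of 0 f N g] by simp

lemma xo_power: "xo N f \<Longrightarrow> xo (int n * N) (f ^ n)"
proof (induction n)
  case 0
  then show ?case by (auto intro: xo_bp bp_series.one)
next
  case (Suc n)
  then show ?case using xo_mult[of N f "int n * N" "f ^ n"] by (simp add: algebra_simps)
qed

lemma xo_p: "xo (int q) (of_nat p)"
proof -
  have "xo (int q) (fps_X ^ q * V)" using xo_mult[OF xo_X xo_bp[OF bp_V]] by simp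
  moreover have "(of_nat p :: qpoly fps) = pbr p * 1 - fps_X ^ q * V" unfolding pbr_V by simp
  ultimately show ?thesis using xo_pbr[OF bp_series.one] xo_diff by metis
qed

lemma xo_div_p:
  assumes "of_nat p ^ j * f = g" "xo N g"
  shows "xo (N - int (j * q)) f"
proof -
  obtain k M u h where a: "bp_series p u" "bp_series p h" "N + int (k * q) \<le> int M"
    "of_nat p ^ k * g = pbr p * u + fps_X ^ M * h" using assms(2) unfolding xo_def by blast
  have "of_nat p ^ (k + j) * f = pbr p * u + fps_X ^ M * h"
    using a(4) assms(1) by (simp add: power_add mult.assoc)
  moreover have "N - int (j * q) + int ((k + j) * q) \<le> int M"
    using a(3) by (simp add: add_mult_distrib)
  ultimately show ?thesis unfolding xo_def using a(1,2) by blast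
qed

text \<open>The return from rational to integral statements: each of the k cancelled factors p costs
  q orders, and these are the orders that \<open>xo\<close> has set aside.\<close>

lemma xo_imp_ideal:
  assumes "bp_series p f" "xo (int N) f"
  shows "\<exists>u g. bp_series p u \<and> bp_series p g \<and> f = pbr p * u + fps_X ^ N * g"
proof -
  obtain k M u g where a: "bp_series p u" "bp_series p g" "int N + int (k * q) \<le> int M"
    "of_nat p ^ k * f = pbr p * u + fps_X ^ M * g" using assms(2) unfolding xo_def by blast
  obtain u' g' where b: "bp_series p u'" "bp_series p g'" "f = pbr p * u' + fps_X ^ (M - k * q) * g'"
    using descend_p_power[OF assms(1) a(1,2,4)] by blast
  have "N \<le> M - k * q" using a(3) by linarith
  then have "fps_X ^ (M - k * q) = fps_X ^ N * (fps_X ^ (M - k * q - N) :: qpoly fps)"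
    by (simp flip: power_add)
  then have "f = pbr p * u' + fps_X ^ N * (fps_X ^ (M - k * q - N) * g')"
    using b(3) by (simp add: mult.assoc)
  moreover have "bp_series p (fps_X ^ (M - k * q - N) * g')"
    using b bp_series_X by (intro bp_series.mult bp_series.power)
  ultimately show ?thesis using b(1) by blast
qed

text \<open>Only the error is brought to normal form. It starts above degree m, and c consists of
  digits already, so no carry reaches degree m.\<close>

theorem lowest_termI:
  assumes t: "bp_series p t" and c: "digit_poly p c" "bp_poly p c"
    and O: "xo (int (Suc m)) (t - fps_const c * fps_X ^ m)"
  shows "lowest_term p t m c"
proof -
  have "bp_series p (t - fps_const c * fps_X ^ m)"
    using t c(2) bp_series_X by (intro bp_series.diff bp_series.mult bp_series.power bp_series_const)
  from xo_imp_ideal[OF this O] obtain u g where ug: "bp_series p u" "bp_series p g"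
    "t - fps_const c * fps_X ^ m = pbr p * u + fps_X ^ Suc m * g" by blast
  obtain s w where sw: "\<And>i. digit_poly p (s $ i)" "bp_series p w" "g = s + pbr p * w"
    using normal_form_exists[OF ug(2)] by blast
  define r where "r = fps_const c * fps_X ^ m + fps_X ^ Suc m * s"
  have r: "r $ i = (if i < m then 0 else if i = m then c else s $ (i - Suc m))" for i
    by (auto simp: r_def fps_X_power_mult_nth fps_X_power_nth simp del: power_Suc)
  have "t - r = pbr p * (u + fps_X ^ Suc m * w)"
    using ug(3) unfolding sw(3) r_def by (simp add: algebra_simps)
  moreover have "bp_series p (u + fps_X ^ Suc m * w)"
    using ug sw bp_series_X by (intro bp_series.add bp_series.mult bp_series.power)
  moreover have "digit_poly p (r $ i)" for i
    using sw(1) c(1) digit_poly_zero[OF p_pos] by (auto simp: r)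
  ultimately have "normal_form p r t" unfolding normal_form_def by blast
  then show ?thesis unfolding lowest_term_def by (intro exI[of _ r]) (auto simp: r)
qed

end

section \<open>Residues and the logarithm of a torsion point\<close>

lemma (in subring_pred) fps_compose_in: "fps_in a \<Longrightarrow> fps_in b \<Longrightarrow> fps_in (a oo b)"
proof -
  interpret F: subring_pred fps_in by (rule fps_subring)
  assume "fps_in a" "fps_in b"
  then have "I (a $ i * (b ^ i) $ n)" for i n
    using F.power[of b i] by (auto simp: fps_in_def intro: mult)
  then show ?thesis unfolding fps_in_def fps_compose_nth by (auto intro: sum)
qed

lemma (in subring_pred) fps_inverse_in:
  assumes f: "fps_in f" and d: "I d" "f $ 0 * d = 1"
  shows "\<exists>g. fps_in g \<and> f * g = 1"
proof -
  define g where "g = fps_right_inverse f d"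
  have fg: "f * g = 1" unfolding g_def by (rule fps_right_inverse) (rule d(2))
  have "I (g $ n)" for n
  proof (induction n rule: less_induct)
    case (less n)
    have "(f * g) $ n = f $ 0 * g $ n + (\<Sum>i=1..n. f $ i * g $ (n - i))"
      by (simp add: fps_mult_nth sum.atLeast_Suc_atMost)
    then have "f $ 0 * g $ n = (1 :: 'a fps) $ n - (\<Sum>i=1..n. f $ i * g $ (n - i))"
      using fg by (simp add: algebra_simps)
    then have "(f $ 0 * d) * g $ n = d * ((1 :: 'a fps) $ n - (\<Sum>i=1..n. f $ i * g $ (n - i)))"
      by (metis mult.assoc mult.commute)
    then have "g $ n = d * ((1 :: 'a fps) $ n - (\<Sum>i=1..n. f $ i * g $ (n - i)))"
      using d(2) by simp
    also have "I \<dots>"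
      using less f d(1) by (intro mult diff sum) (auto simp: fps_in_def intro: closed)
    finally show ?case .
  qed
  then show ?thesis using fg unfolding fps_in_def by blast
qed

text \<open>Invariance of the residue under a change of variable, for Laurent tails written as
  negative powers of an invertible series: every term except the simple pole is a derivative.\<close>

lemma residue_power:
  fixes \<mu> \<nu> :: "'a::{idom,semiring_char_0} fps"
  assumes "\<mu> * \<nu> = 1"
  shows "(fps_deriv (fps_X * \<mu>) * \<nu> ^ Suc m) $ m = (if m = 0 then 1 else 0)"
proof (cases m)
  case 0
  then show ?thesis using assms by (metis (no_types, lifting) fps_deriv_mult fps_deriv_fps_X
    fps_mult_nth_0 fps_X_nth fps_add_nth mult_1 mult_zero_left power_Suc0_right add_0_right fps_one_nth zero_neq_one add_0 mult.commute One_nat_def)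
next
  case (Suc n)
  have "fps_deriv (\<mu> * \<nu>) = 0" by (simp add: assms)
  then have "\<mu> * fps_deriv \<nu> = - (fps_deriv \<mu> * \<nu>)"
    by (simp add: eq_neg_iff_add_eq_0)
  then have "\<nu> * (\<mu> * fps_deriv \<nu>) = - (fps_deriv \<mu> * \<nu> ^ 2)"
    by (simp only:) (simp add: power2_eq_square algebra_simps)
  then have "(\<mu> * \<nu>) * fps_deriv \<nu> = - (fps_deriv \<mu> * \<nu> ^ 2)"
    by (simp only: mult_ac)
  then have d\<nu>: "fps_deriv \<nu> = - (fps_deriv \<mu> * \<nu> ^ 2)" by (simp add: assms)
  have dp: "fps_deriv (\<nu> ^ m) = - (of_nat m * (fps_deriv \<mu> * \<nu> ^ Suc m))"
    unfolding Suc fps_deriv_power' d\<nu> by (simp add: power2_eq_square fps_of_nat algebra_simps)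
  have "\<mu> * \<nu> ^ Suc m = \<nu> ^ m" using assms by (simp add: mult.assoc[symmetric])
  then have "fps_deriv (fps_X * \<mu>) * \<nu> ^ Suc m = \<nu> ^ m + fps_X * (fps_deriv \<mu> * \<nu> ^ Suc m)"
    by (simp add: algebra_simps)
  then have "of_nat m * (fps_deriv (fps_X * \<mu>) * \<nu> ^ Suc m) $ m =
     of_nat m * (\<nu> ^ m) $ m + (of_nat m * (fps_deriv \<mu> * \<nu> ^ Suc m)) $ n"
    by (simp add: Suc fps_mult_of_nat_nth distrib_left del: power_Suc of_nat_Suc)
  also have "(of_nat m * (fps_deriv \<mu> * \<nu> ^ Suc m)) $ n = - (fps_deriv (\<nu> ^ m) $ n)"
    unfolding dp by simp
  also have "\<dots> = - (of_nat m * (\<nu> ^ m) $ m)"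
    unfolding fps_deriv_nth Suc by (simp del: power_Suc of_nat_Suc)
  finally have "of_nat m * (fps_deriv (fps_X * \<mu>) * \<nu> ^ Suc m) $ m = 0" by simp
  then show ?thesis using Suc by (simp del: power_Suc of_nat_Suc)
qed

text \<open>By linearity only the terms of A of degree below k count, and
  \<open>residue_power\<close> keeps the one with a simple pole, of degree k - 1.\<close>

lemma residue_change:
  fixes A \<mu> \<nu> :: "'a::{idom,semiring_char_0} fps"
  assumes "\<mu> * \<nu> = 1" "k > 0"
  shows "((A oo (fps_X * \<mu>)) * fps_deriv (fps_X * \<mu>) * \<nu> ^ k) $ (k - 1) = A $ (k - 1)"
proof -
  let ?\<eta> = "fps_X * \<mu>"
  let ?S = "\<Sum>j<k. fps_const (A $ j) * ?\<eta> ^ j"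
  have "(A oo ?\<eta>) $ n = ?S $ n" if "n \<le> k - 1" for n
  proof -
    have "(\<Sum>j<k. A $ j * (?\<eta> ^ j) $ n) = (\<Sum>j=0..n. A $ j * (?\<eta> ^ j) $ n)"
      using that assms(2) by (intro sum.mono_neutral_right) (auto simp: startsby_zero_power_prefix)
    then show ?thesis by (simp add: fps_compose_nth fps_sum_nth)
  qed
  then have "((A oo ?\<eta>) * (fps_deriv ?\<eta> * \<nu> ^ k)) $ (k - 1) = (?S * (fps_deriv ?\<eta> * \<nu> ^ k)) $ (k - 1)"
    unfolding fps_mult_nth by (intro sum.cong) auto
  also have "?S * (fps_deriv ?\<eta> * \<nu> ^ k) = (\<Sum>j<k. fps_const (A $ j) * (fps_X ^ j * (fps_deriv ?\<eta> * \<nu> ^ (k - j))))"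
    unfolding sum_distrib_right
  proof (intro sum.cong refl)
    fix j assume "j \<in> {..<k}"
    then have "\<nu> ^ k = \<nu> ^ j * \<nu> ^ (k - j)" by (simp flip: power_add)
    then have "\<mu> ^ j * \<nu> ^ k = \<nu> ^ (k - j)"
      using assms(1) by (simp add: mult.assoc[symmetric] power_mult_distrib[symmetric])
    then show "fps_const (A $ j) * ?\<eta> ^ j * (fps_deriv ?\<eta> * \<nu> ^ k) =
      fps_const (A $ j) * (fps_X ^ j * (fps_deriv ?\<eta> * \<nu> ^ (k - j)))"
      by (simp only: power_mult_distrib) (metis (no_types, lifting) mult.assoc mult.left_commute)
  qed
  also have "\<dots> $ (k - 1) = (\<Sum>j<k. if j = k - 1 then A $ (k - 1) else 0)"
    unfolding fps_sum_nth
  proof (intro sum.cong refl)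
    fix j assume j: "j \<in> {..<k}"
    then obtain m where m: "k - j = Suc m" by (metis Suc_diff_Suc lessThan_iff)
    then have "k - 1 - j = m" by simp
    then have "(fps_X ^ j * (fps_deriv ?\<eta> * \<nu> ^ (k - j))) $ (k - 1) = (if m = 0 then 1 else 0)"
      using j residue_power[OF assms(1), of m] unfolding m fps_X_power_mult_nth
      by (cases "m = 0") (simp_all del: power_Suc fps_deriv_mult fps_mult_nth_0)
    moreover have "m = 0 \<longleftrightarrow> j = k - 1" using m j by auto
    ultimately show "(fps_const (A $ j) * (fps_X ^ j * (fps_deriv ?\<eta> * \<nu> ^ (k - j)))) $ (k - 1)
      = (if j = k - 1 then A $ (k - 1) else 0)" by simp
  qed
  also have "\<dots> = A $ (k - 1)" using assms(2) by (simp add: sum.delta)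
  finally show ?thesis by (simp add: mult.assoc)
qed

definition ncoef :: "nat \<Rightarrow> nat \<Rightarrow> nat" where
  "ncoef k m = (k + m - 1) choose m"

lemma ncoef_0 [simp]: "ncoef k 0 = 1"
  by (simp add: ncoef_def)

lemma ncoef_Suc_Suc: "ncoef (Suc k) (Suc m) = ncoef (Suc k) m + ncoef k (Suc m)"
  by (cases k) (auto simp: ncoef_def)

text \<open>Multiplying by 1 - y lowers the exponent k by one.\<close>
lemma neg_binomial_truncated:
  fixes y :: "'a::comm_ring_1"
  assumes "subring_pred I" "I y"
  shows "\<exists>r. I r \<and> (1 - y) ^ k * (\<Sum>m\<le>M. of_nat (ncoef k m) * y ^ m) = 1 + y ^ Suc M * r"
proof (induction k)
  case 0
  interpret subring_pred I by fact
  have "(\<Sum>m\<le>M. of_nat (ncoef 0 m) * y ^ m) = (\<Sum>m\<le>M. if m = 0 then 1 else 0)"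
    by (intro sum.cong) (auto simp: ncoef_def binomial_eq_0)
  then show ?case by (intro exI[of _ 0]) (auto intro: zero)
next
  case (Suc k)
  interpret subring_pred I by fact
  let ?S = "\<lambda>k. \<Sum>m\<le>M. of_nat (ncoef k m) * y ^ m"
  have "(1 - y) * (\<Sum>m\<le>n. of_nat (ncoef (Suc k) m) * y ^ m) =
     (\<Sum>m\<le>n. of_nat (ncoef k m) * y ^ m) - of_nat (ncoef (Suc k) n) * y ^ Suc n" for n
  proof (induction n)
    case (Suc n)
    have "(1 - y) * (\<Sum>m\<le>Suc n. of_nat (ncoef (Suc k) m) * y ^ m) =
       (1 - y) * (\<Sum>m\<le>n. of_nat (ncoef (Suc k) m) * y ^ m) + (1 - y) * (of_nat (ncoef (Suc k) (Suc n)) * y ^ Suc n)"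
      by (simp add: distrib_left)
    also note Suc.IH
    also have "(\<Sum>m\<le>n. of_nat (ncoef k m) * y ^ m) - of_nat (ncoef (Suc k) n) * y ^ Suc n
       + (1 - y) * (of_nat (ncoef (Suc k) (Suc n)) * y ^ Suc n)
      = (\<Sum>m\<le>Suc n. of_nat (ncoef k m) * y ^ m) - of_nat (ncoef (Suc k) (Suc n)) * y ^ Suc (Suc n)"
      by (simp add: algebra_simps ncoef_Suc_Suc)
    finally show ?case .
  qed (simp add: algebra_simps)
  then have S: "(1 - y) * ?S (Suc k) = ?S k - of_nat (ncoef (Suc k) M) * y ^ Suc M" .
  obtain r where r: "I r" "(1 - y) ^ k * ?S k = 1 + y ^ Suc M * r" using Suc by blast
  have "(1 - y) ^ Suc k * ?S (Suc k) = (1 - y) ^ k * ((1 - y) * ?S (Suc k))" by (simp add: mult_ac)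
  also have "\<dots> = 1 + y ^ Suc M * (r - (1 - y) ^ k * of_nat (ncoef (Suc k) M))"
    unfolding S right_diff_distrib r(2) by (simp add: algebra_simps)
  finally show ?case
    using r assms(2) by (intro exI[of _ "r - (1 - y) ^ k * of_nat (ncoef (Suc k) M)"]) (auto intro!: closed)
qed

section \<open>Orders of two-variable series\<close>

context bp_prime
begin

text \<open>This ring is larger than the integral series: it contains the terms of the logarithm
  despite their denominators.\<close>

sublocale X0: subring_pred "xo 0"
  by unfold_locales (auto intro: xo_bp bp_series.one xo_diff xo_mult0)

definition xos :: "int \<Rightarrow> qpoly fps fps \<Rightarrow> bool" where
  "xos N A \<longleftrightarrow> (\<forall>m. xo N (A $ m))"

lemma xos_0_eq: "xos 0 = X0.fps_in"
  by (auto simp: xos_def X0.fps_in_def fun_eq_iff)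

sublocale XS: subring_pred "xos 0"
  unfolding xos_0_eq by (rule X0.fps_subring)

lemma xos_bp: "bp_series2 p A \<Longrightarrow> xos 0 A"
  by (auto simp: xos_def bp_series2_def intro: xo_bp)

lemma xos_mono: "xos N A \<Longrightarrow> N' \<le> N \<Longrightarrow> xos N' A"
  by (auto simp: xos_def intro: xo_mono)

lemma xos_zero: "xos N 0"
  by (simp add: xos_def xo_zero)

lemma xos_add: "xos N A \<Longrightarrow> xos N B \<Longrightarrow> xos N (A + B)"
  and xos_diff: "xos N A \<Longrightarrow> xos N B \<Longrightarrow> xos N (A - B)"
  and xos_neg: "xos N A \<Longrightarrow> xos N (- A)"
  by (auto simp: xos_def intro: xo_add xo_diff xo_neg)

lemma xos_mult: "xos N A \<Longrightarrow> xos N' B \<Longrightarrow> xos (N + N') (A * B)"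
  by (auto simp: xos_def fps_mult_nth intro!: xo_sum xo_mult)

lemma xos_mult0: "xos 0 A \<Longrightarrow> xos N B \<Longrightarrow> xos N (A * B)"
  using xos_mult[of 0 A N B] by simp

lemma xos_const: "xo N c \<Longrightarrow> xos N (fps_const c)"
  by (auto simp: xos_def intro: xo_zero)

lemma xos_X: "xos 0 fps_X"
  by (auto simp: xos_def fps_X_nth intro: X0.closed)

lemma xos_power: "xos N A \<Longrightarrow> xos (int n * N) (A ^ n)"
proof (induction n)
  case 0
  then show ?case by (auto intro: XS.one)
next
  case (Suc n)
  then show ?case using xos_mult[of N A "int n * N" "A ^ n"] by (simp add: algebra_simps)
qed

lemma xos_trans: "xos N (A - B) \<Longrightarrow> xos N (B - C) \<Longrightarrow> xos N (A - C)"
  using xos_add[of N "A - B" "B - C"] by simp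

lemma xo_trans: "xo N (A - B) \<Longrightarrow> xo N (B - C) \<Longrightarrow> xo N (A - C)"
  using xo_add[of N "A - B" "B - C"] by simp

lemma xos_diff_power:
  assumes "xos 0 A" "xos 0 B" "xos N (A - B)"
  shows "xos N (A ^ n - B ^ n)"
  unfolding power_diff_sumr2 using assms
  by (subst mult.commute) (intro xos_mult0 XS.sum XS.mult XS.power)

lemma xo_diff_power:
  assumes "xo 0 A" "xo 0 B" "xo N (A - B)"
  shows "xo N (A ^ n - B ^ n)"
  unfolding power_diff_sumr2 using assms
  by (subst mult.commute) (intro xo_mult0 X0.sum X0.mult X0.power)

lemma xos_cancel_X: "xos N (fps_X * A) \<Longrightarrow> xos N A"
  unfolding xos_def
proof
  fix m
  assume "\<forall>m. xo N ((fps_X * A) $ m)"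
  then have "xo N ((fps_X * A) $ Suc m)" by blast
  then show "xo N (A $ m)" by simp
qed

text \<open>Multiplication by an invertible c plus something of order 1 loses no order: each pass
  through D c = D (c + e) - D e improves the order of D by one.\<close>

lemma xo_unit_improve:
  assumes D: "xo 0 D" and c: "xo 0 c'" "c * c' = 1" and e: "xo 1 e" and N: "xo (int N) (D * (c + e))"
  shows "xo (int N) D"
proof -
  have "xo (int n) D" if "n \<le> N" for n
    using that
  proof (induction n)
    case 0
    then show ?case using D by simp
  next
    case (Suc n)
    have "xo (int (Suc n)) (D * e)"
      using xo_mult[of "int n" D 1 e] Suc e by (simp add: add.commute)
    moreover have "xo (int (Suc n)) (D * (c + e))" using N Suc.prems xo_mono by force
    ultimately have "xo (int (Suc n)) (D * (c + e) - D * e)" by (intro xo_diff)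
    then have "xo (int (Suc n)) (D * c)" by (simp add: distrib_left)
    from xo_mult0[OF c(1) this] have "xo (int (Suc n)) (c' * (D * c))" .
    also have "c' * (D * c) = D * (c * c')" by (simp add: mult_ac)
    finally show ?case using c(2) by simp
  qed
  then show ?thesis by blast
qed

section \<open>Rescaling and the logarithm relation\<close>

definition scl :: "qpoly fps fps \<Rightarrow> qpoly fps fps" where
  "scl G = Abs_fps (\<lambda>m. fps_X ^ m * G $ m)"

lemma scl_nth: "scl G $ m = fps_X ^ m * G $ m"
  by (simp add: scl_def)

lemma scl_add: "scl (a + b) = scl a + scl b"
  and scl_diff: "scl (a - b) = scl a - scl b"
  by (simp_all add: fps_eq_iff scl_nth algebra_simps)

lemma scl_sum: "scl (sum f S) = (\<Sum>i\<in>S. scl (f i))"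
proof (induction S rule: infinite_finite_induct)
  case (infinite A)
  then show ?case by (auto simp: fps_eq_iff scl_nth)
qed (auto simp: scl_add, auto simp: fps_eq_iff scl_nth)

lemma scl_mult: "scl (a * b) = scl a * scl b"
proof (rule fps_ext)
  fix n
  have "fps_X ^ n * (a $ i * b $ (n - i)) = (fps_X ^ i * a $ i) * (fps_X ^ (n - i) * b $ (n - i))"
    if "i \<le> n" for i
  proof -
    have "(fps_X :: qpoly fps) ^ n = fps_X ^ i * fps_X ^ (n - i)" using that by (simp flip: power_add)
    then show ?thesis by (simp add: mult_ac)
  qed
  then show "scl (a * b) $ n = (scl a * scl b) $ n"
    unfolding scl_nth fps_mult_nth sum_distrib_left by (intro sum.cong refl) (simp only: atLeastAtMost_iff)
qed

lemma scl_const: "scl (fps_const c) = fps_const c"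
  by (rule fps_ext) (simp add: scl_nth)

lemma scl_of_nat: "scl (of_nat n) = of_nat n"
  using scl_const[of "of_nat n"] by (simp add: fps_of_nat)

lemma scl_X: "scl fps_X = fps_const fps_X * fps_X"
proof (rule fps_ext)
  fix n
  show "scl fps_X $ n = (fps_const fps_X * fps_X) $ n"
    by (cases "n = 1") (auto simp: scl_nth fps_X_nth)
qed

lemma scl_power: "scl (a ^ n) = scl a ^ n"
  using scl_const[of 1] by (induction n) (auto simp: scl_mult)

lemma scl_prod: "scl (prod f S) = (\<Prod>i\<in>S. scl (f i))"
  using scl_const[of 1] by (induction S rule: infinite_finite_induct) (auto simp: scl_mult)

text \<open>The series \<open>Z i\<close> after the substitution \<open>x = \<xi> x'\<close> and division by \<open>\<xi>\<close>.\<close>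
definition Zh :: "nat \<Rightarrow> qpoly fps fps" where
  "Zh i = Abs_fps (\<lambda>m. if m = 0 then rho i else fps_X ^ (m - 1) * Z i $ m)"

lemma Zh_0: "Zh i $ 0 = rho i"
  by (simp add: Zh_def)

lemma scl_Z: "scl (Z i) = fps_const fps_X * Zh i"
  by (rule fps_ext) (auto simp: scl_nth Zh_def Z_nth_0 fmul_rho power_eq_if)

lemma bp_Zh: "bp_series2 p (Zh i)"
  using bp_Z[of i] bp_series_X bp_rho
  by (auto simp: bp_series2_def Zh_def intro!: bp_series.mult bp_series.power)

text \<open>The k-th term of log xi divided by xi. Its denominator p^k costs k q orders, and p^k - 1
  >= k q leaves a nonnegative order.\<close>

definition L :: "nat \<Rightarrow> qpoly fps" where
  "L k = fps_const (ell p k) * fps_X ^ (p ^ k - 1)"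

lemma p_power_ge: "1 + k * q \<le> p ^ k"
proof (induction k)
  case (Suc k)
  have "1 + Suc k * q \<le> p ^ k + 1 * q" using Suc by simp
  also have "\<dots> \<le> p ^ k + p ^ k * q" using p_pos by (intro add_left_mono mult_right_mono) auto
  also have "\<dots> = p ^ Suc k" using p_pos by (simp add: algebra_simps)
  finally show ?case .
qed auto

lemma bp_p_power_L: "of_nat p ^ k * L k = fps_X ^ (p ^ k - 1) * fps_const (of_nat p ^ k * ell p k)"
  unfolding L_def by (simp add: fps_of_nat[symmetric] mult_ac del: fps_of_nat flip: fps_const_mult fps_const_power)

lemma xo_L: "xo (int (p ^ k) - 1 - int (k * q)) (L k)"
proof -
  have "xo (int (p ^ k - 1)) (fps_X ^ (p ^ k - 1) * fps_const (of_nat p ^ k * ell p k))"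
    using xo_mult[OF xo_X xo_bp[OF bp_series_const[OF bp_ell]]] by simp
  from xo_div_p[OF bp_p_power_L this] show ?thesis
    using p_pos by (simp add: of_nat_diff)
qed

lemma xo_0_L: "xo 0 (L k)"
  using xo_mono[OF xo_L[of k], of 0] p_power_ge[of k] by linarith

text \<open>Truncating log \<open>Z i\<close> = i log xi + log x leaves an error of total degree at
  least p^(K+1), and p^K clears its denominators. The rescaling turns total degree into degree in
  xi, and dividing by xi accounts for the - 1.\<close>

lemma log_relation_raw:
  "xo (int (p ^ Suc K) - 1 - int (K * q))
     ((\<Sum>k<Suc K. fps_const (L k) * (Zh i ^ (p ^ k) - of_nat i - fps_X ^ (p ^ k))) $ m)"
proof -
  define n where "n = p ^ Suc K"
  let ?X = "fps_const fps_X :: qpoly fps fps" and ?Y = "fps_X :: qpoly fps fps"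
  let ?S = "\<lambda>C. \<Sum>k<Suc K. cst (ell p k) * C ^ (p ^ k)"
  let ?E = "\<Sum>k<Suc K. fps_const (L k) * (Zh i ^ (p ^ k) - of_nat i - fps_X ^ (p ^ k))"
  define \<Delta> where "\<Delta> = (\<Sum>k<Suc K. cst (ell p k) * (Z i ^ (p ^ k) - of_nat i * ?X ^ (p ^ k) - ?Y ^ (p ^ k)))"
  have XY: "ord2 1 ?X" "ord2 1 ?Y" by (auto simp: ord2_def)
  have "\<Delta> = ?S (Z i) - of_nat i * ?S ?X - ?S ?Y"
    unfolding \<Delta>_def sum_distrib_left sum_subtractf[symmetric]
    by (intro sum.cong refl) (simp only: right_diff_distrib mult.left_commute)
  also have "\<dots> = of_nat i * (comp2 (lg p) ?X - ?S ?X) + (comp2 (lg p) ?Y - ?S ?Y) - (comp2 (lg p) (Z i) - ?S (Z i))"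
    unfolding comp2_lg_Z by (simp add: right_diff_distrib)
  also have "ord2 n \<dots>"
    unfolding n_def by (intro ord2_diff ord2_add ord2_mult_left comp2_lg_approx XY ord_Z)
  finally have ord: "ord2 n \<Delta>" .
  have bpD: "bp_series2 p (of_nat p ^ K * \<Delta>)"
    unfolding \<Delta>_def sum_distrib_left
  proof (intro bp_series2.sum)
    fix k assume k: "k \<in> {..<Suc K}"
    have "(of_nat p ^ K :: qpoly fps fps) = cst (of_nat p ^ K)"
      by (simp add: fps_of_nat[symmetric] del: fps_of_nat flip: fps_const_power)
    also have "\<dots> = cst (of_nat p ^ (K - k) * of_nat p ^ k)" using k by (simp flip: power_add)
    finally have "of_nat p ^ K * (cst (ell p k) * (Z i ^ (p ^ k) - of_nat i * ?X ^ (p ^ k) - ?Y ^ (p ^ k)))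
      = cst (of_nat p ^ (K - k) * (of_nat p ^ k * ell p k)) * (Z i ^ (p ^ k) - of_nat i * ?X ^ (p ^ k) - ?Y ^ (p ^ k))"
      by (simp add: mult.assoc[symmetric])
    also have "bp_series2 p \<dots>"
    proof -
      have "bp_series2 p ?X" "bp_series2 p ?Y"
        by (auto simp: bp_series2_def fps_X_nth intro: bp_series_X bp_series.closed)
      then show ?thesis
        by (intro bp_series2.mult bp_series2.diff bp_series2.power bp_series2.of_nat bp_Z bp_cst
             bp_poly.mult[of p "of_nat p ^ (K - k)"] bp_poly.power bp_poly.of_nat bp_ell)
    qed
    finally show "bp_series2 p (of_nat p ^ K * (cst (ell p k) * (Z i ^ (p ^ k) - of_nat i * ?X ^ (p ^ k) - ?Y ^ (p ^ k))))" .
  qed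
  have sc: "scl \<Delta> = fps_const fps_X * ?E"
    unfolding \<Delta>_def scl_sum sum_distrib_left
  proof (intro sum.cong refl)
    fix k
    have Xk: "(fps_const fps_X :: qpoly fps fps) ^ (p ^ k) = fps_const fps_X * fps_const (fps_X ^ (p ^ k - 1))"
      using p_pos by (simp add: fps_const_power flip: power_Suc)
    have "scl (cst (ell p k) * (Z i ^ (p ^ k) - of_nat i * ?X ^ (p ^ k) - ?Y ^ (p ^ k)))
      = cst (ell p k) * ((?X * Zh i) ^ (p ^ k) - of_nat i * ?X ^ (p ^ k) - (?X * ?Y) ^ (p ^ k))"
      by (simp only: scl_mult scl_diff scl_power scl_Z scl_X scl_const scl_of_nat)
    also have "\<dots> = cst (ell p k) * (?X ^ (p ^ k) * (Zh i ^ (p ^ k) - of_nat i - ?Y ^ (p ^ k)))"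
      by (simp only: power_mult_distrib right_diff_distrib mult_ac)
    also have "\<dots> = fps_const fps_X * (fps_const (L k) * (Zh i ^ (p ^ k) - of_nat i - ?Y ^ (p ^ k)))"
      unfolding Xk L_def fps_const_mult[symmetric] by (simp only: mult_ac)
    finally show "scl (cst (ell p k) * (Z i ^ (p ^ k) - of_nat i * ?X ^ (p ^ k) - ?Y ^ (p ^ k)))
      = fps_const fps_X * (fps_const (L k) * (Zh i ^ (p ^ k) - of_nat i - fps_X ^ (p ^ k)))" .
  qed
  define h where "h = fps_shift n (fps_X ^ m * \<Delta> $ m)"
  have "(fps_X ^ m * \<Delta> $ m) = fps_X ^ n * h"
    unfolding h_def using ord by (intro fps_shift_eq) (auto simp: fps_X_power_mult_nth ord2_def)
  moreover have "fps_X * ?E $ m = fps_X ^ m * \<Delta> $ m"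
    using arg_cong[OF sc, of "\<lambda>f. f $ m"] by (simp add: scl_nth)
  moreover have "n \<ge> 1" using p_pos by (simp add: n_def)
  then have "(fps_X :: qpoly fps) ^ n = fps_X * fps_X ^ (n - 1)" by (simp flip: power_Suc)
  ultimately have "fps_X * ?E $ m = fps_X * (fps_X ^ (n - 1) * h)" by (simp add: mult.assoc)
  then have E: "?E $ m = fps_X ^ (n - 1) * h"
    unfolding mult_left_cancel[OF fps_X_neq_zero] .
  have "of_nat p ^ K * h = fps_shift n (fps_X ^ m * (of_nat p ^ K * \<Delta>) $ m)"
  proof -
    have c: "(of_nat p ^ K :: qpoly fps) = fps_const (of_nat p ^ K)" "(of_nat p ^ K :: qpoly fps fps) = fps_const (of_nat p ^ K)"
      by (simp_all add: fps_of_nat[symmetric] del: fps_of_nat flip: fps_const_power)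
    have "(of_nat p ^ K * \<Delta>) $ m = fps_const (of_nat p ^ K) * \<Delta> $ m"
      unfolding c by simp
    then show ?thesis unfolding h_def c(1) by (simp add: fps_eq_iff fps_X_power_mult_nth)
  qed
  also have "bp_series p \<dots>" using bpD bp_series_X
    by (intro bp_series_shift bp_series.mult bp_series.power) (auto simp: bp_series2_def)
  finally have "bp_series p (of_nat p ^ K * h)" .
  then have "xo (int (n - 1)) (fps_X ^ (n - 1) * (of_nat p ^ K * h))"
    using xo_mult[OF xo_X xo_bp] by simp
  moreover have "of_nat p ^ K * ?E $ m = fps_X ^ (n - 1) * (of_nat p ^ K * h)"
    unfolding E by (simp add: mult_ac)
  ultimately show ?thesis using xo_div_p \<open>n \<ge> 1\<close> by (fastforce simp: n_def of_nat_diff)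
qed

text \<open>The order in \<open>\<xi>\<close> of the first omitted term \<open>L (Suc K)\<close>.\<close>
definition prec :: "nat \<Rightarrow> int" where
  "prec K = int (p ^ Suc K) - 1 - int (Suc K * q)"

text \<open>The point xi is p-torsion modulo pbr, so its logarithm vanishes.\<close>
lemma log_relation: "xo (prec K) (\<Sum>k<Suc K. L k)"
proof -
  \<comment> \<open>At i = p and x = 0 the powers of \<open>rho p\<close> = \<open>pbr p\<close>
    vanish in the quotient, leaving - p times the wanted sum. Cancelling this p loses another q
    orders, which are included in \<open>prec\<close>.\<close>
  have "xo (int (p ^ Suc K) - 1 - int (K * q)) (\<Sum>k<Suc K. L k * (rho p ^ (p ^ k) - of_nat p))"
    using log_relation_raw[of K p 0] p_pos
    by (simp add: fps_sum_nth Zh_0 fps_power_zeroth power_0_left del: sum.lessThan_Suc)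
  moreover have "xo N (\<Sum>k<Suc K. L k * rho p ^ (p ^ k))" for N
  proof (intro xo_sum xo_mult0[OF xo_0_L])
    fix k
    have "rho p ^ (p ^ k) = pbr p * rho p ^ (p ^ k - 1)"
      using p_pos by (simp add: pbr_rho flip: power_Suc)
    then show "xo N (rho p ^ (p ^ k))"
      using xo_pbr[OF bp_series.power[OF bp_rho]] by simp
  qed
  ultimately have "xo (int (p ^ Suc K) - 1 - int (K * q))
     ((\<Sum>k<Suc K. L k * rho p ^ (p ^ k)) - (\<Sum>k<Suc K. L k * (rho p ^ (p ^ k) - of_nat p)))"
    by (intro xo_diff)
  also have "(\<Sum>k<Suc K. L k * rho p ^ (p ^ k)) - (\<Sum>k<Suc K. L k * (rho p ^ (p ^ k) - of_nat p))
    = of_nat p ^ 1 * (\<Sum>k<Suc K. L k)"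
    unfolding sum_subtractf[symmetric] sum_distrib_left by (intro sum.cong refl) (simp add: algebra_simps)
  finally have "xo (int (p ^ Suc K) - 1 - int (K * q) - int (1 * q)) (\<Sum>k<Suc K. L k)"
    by (rule xo_div_p[OF refl])
  then show ?thesis unfolding prec_def by (rule xo_mono) (simp only: mult_Suc of_nat_add mult_1)
qed

text \<open>Because log xi vanishes, the summand i log xi drops out, and \<open>Zh i\<close> has the
  same truncated logarithm as the rescaled x.\<close>

lemma log_relation_Zh:
  "xos (prec K) (\<Sum>k<Suc K. fps_const (L k) * (Zh i ^ (p ^ k) - fps_X ^ (p ^ k)))"
proof -
  have "xos (prec K) (\<Sum>k<Suc K. fps_const (L k) * (Zh i ^ (p ^ k) - of_nat i - fps_X ^ (p ^ k)))"
    unfolding xos_def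
  proof
    fix m
    show "xo (prec K) ((\<Sum>k<Suc K. fps_const (L k) * (Zh i ^ (p ^ k) - of_nat i - fps_X ^ (p ^ k))) $ m)"
      using xo_mono[OF log_relation_raw, of "prec K" K i m]
      unfolding prec_def mult_Suc of_nat_add by linarith
  qed
  moreover have "xos (prec K) (of_nat i * (\<Sum>k<Suc K. fps_const (L k)))"
  proof -
    have "(\<Sum>k<n. fps_const (L k)) = fps_const (\<Sum>k<n. L k)" for n
      by (induction n) auto
    then show ?thesis using log_relation[of K]
      by (intro xos_mult0 XS.of_nat) (simp add: xos_const del: sum.lessThan_Suc)
  qed
  ultimately have "xos (prec K) ((\<Sum>k<Suc K. fps_const (L k) * (Zh i ^ (p ^ k) - of_nat i - fps_X ^ (p ^ k)))
     + of_nat i * (\<Sum>k<Suc K. fps_const (L k)))" by (rule xos_add)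
  also have "(\<Sum>k<Suc K. fps_const (L k) * (Zh i ^ (p ^ k) - of_nat i - fps_X ^ (p ^ k)))
     + of_nat i * (\<Sum>k<Suc K. fps_const (L k)) = (\<Sum>k<Suc K. fps_const (L k) * (Zh i ^ (p ^ k) - fps_X ^ (p ^ k)))"
    unfolding sum_distrib_left sum.distrib[symmetric] by (intro sum.cong refl) (simp add: algebra_simps)
  finally show ?thesis .
qed

end

lemma fps_X_compose_self: "e $ 0 = 0 \<Longrightarrow> fps_X oo e = (e :: 'a::comm_ring_1 fps)"
  by (simp add: fps_eq_iff fps_compose_nth fps_X_nth if_distrib[of "\<lambda>x. x * _"] cong: if_cong)

lemma fps_deriv_prod_log:
  fixes f g :: "'b \<Rightarrow> 'a::comm_ring_1 fps"
  assumes "finite S" "\<And>i. i \<in> S \<Longrightarrow> f i * g i = 1"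
  shows "fps_deriv (prod f S) = prod f S * (\<Sum>i\<in>S. fps_deriv (f i) * g i)"
  using assms
proof (induction S rule: finite_induct)
  case (insert x S)
  have "fps_deriv (prod f (insert x S)) = f x * fps_deriv (prod f S) + fps_deriv (f x) * prod f S"
    using insert by simp
  also have "fps_deriv (f x) * prod f S = f x * prod f S * (fps_deriv (f x) * g x)"
  proof -
    have "f x * prod f S * (fps_deriv (f x) * g x) = (f x * g x) * (fps_deriv (f x) * prod f S)"
      by (simp only: mult_ac)
    then show ?thesis using insert.prems[of x] by simp
  qed
  also have "fps_deriv (prod f S) = prod f S * (\<Sum>i\<in>S. fps_deriv (f i) * g i)"
    using insert by auto
  finally show ?case
    using insert.hyps by (simp add: distrib_left mult.assoc)
qed auto

section \<open>The product over the multiples of xi and the class\<close>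

context bp_prime
begin

lemma ex_1: "ex p $ 1 = 1"
proof -
  have "(lg p oo ex p) $ 1 = ex p $ 1" using p2 by (intro lg_compose_low) (auto simp: ex_props)
  then show ?thesis by (simp add: ex_props)
qed

lemma ex_lg: "ex p oo lg p = fps_X"
proof -
  obtain e where e: "e $ 0 = 0" "ex p oo e = fps_X"
    using fps_compinv_ex1[OF ex_props(1) ex_1] by blast
  have "lg p = lg p oo (ex p oo e)" by (simp add: e)
  also have "\<dots> = (lg p oo ex p) oo e" using e by (intro fps_compose_assoc) (auto simp: ex_props)
  also have "\<dots> = e" using e by (simp add: ex_props fps_X_compose_self)
  finally show ?thesis using e by simp
qed

lemma Z_0: "Z 0 = fps_X"
proof -
  have X: "ord2 1 (fps_X :: qpoly fps fps)" by (auto simp: ord2_def)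
  have "comp2 (ex p) (comp2 (lg p) fps_X) = comp2 (ex p oo lg p) fps_X"
    by (rule comp2_compose[symmetric, OF X]) simp
  then show ?thesis
    unfolding Z_def fgl_add2_def using comp2_fps_X_self[OF X]
    using comp2_fps_const[of "lg p" 0] by (simp add: ex_lg fps_compose_0_right)
qed

lemma Z_1_0: "Z i $ 1 $ 0 = 1"
proof -
  have c: "comp2 (lg p) C $ 1 $ 0 = C $ 1 $ 0" for C
    using lg_1 by (simp add: comp2_def)
  have "comp2 (lg p) (Z i) $ 1 $ 0 = (of_nat i * comp2 (lg p) (fps_const fps_X) + comp2 (lg p) fps_X) $ 1 $ 0"
    by (simp add: comp2_lg_Z)
  also have "\<dots> = 1"
    by (simp add: comp2_fps_const fps_mult_of_nat_nth c[unfolded One_nat_def])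
  finally show ?thesis unfolding c .
qed

text \<open>The factor j = 0 of the product is x itself and absorbs the index shift in
  \<open>aa\<close>.\<close>

lemma aa_eq: "aa p k = (\<Prod>i=1..<p. Z i) $ k"
proof -
  have "{..<p} = insert 0 {1..<p}" using p_pos by auto
  then have "(\<Prod>j<p. Z j) = fps_X * (\<Prod>i=1..<p. Z i)" by (simp add: Z_0)
  then show ?thesis by (simp add: aa_def Z_def[symmetric])
qed

lemma bp_aa: "bp_series p (aa p k)"
proof -
  have "bp_series2 p (\<Prod>i=1..<p. Z i)" by (intro bp_series2.prod bp_Z)
  then show ?thesis by (simp add: aa_eq bp_series2_def)
qed

definition P :: "qpoly fps fps" where
  "P = (\<Prod>i=1..<p. Zh i)"

lemma bp_P: "bp_series2 p P"
  unfolding P_def by (intro bp_series2.prod bp_Zh)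

lemma scl_aa: "scl (Abs_fps (aa p)) = fps_const (fps_X ^ q) * P"
proof -
  have "Abs_fps (aa p) = (\<Prod>i=1..<p. Z i)" by (rule fps_ext) (simp add: aa_eq)
  then show ?thesis
    by (simp add: scl_prod scl_Z prod.distrib P_def)
qed

lemma aa_0: "aa p 0 = fps_X ^ q * P $ 0"
  using arg_cong[OF scl_aa, of "\<lambda>f. f $ 0"] by (simp add: scl_nth)

definition mcn :: "nat \<Rightarrow> nat \<Rightarrow> qpoly fps" where
  "mcn n k = (\<Sum>j\<le>k. (-1) ^ j * of_nat ((n + j) choose j) * (P $ 0) ^ (n - j) * ((P - fps_const (P $ 0)) ^ j) $ k)"

text \<open>The coefficient is homogeneous of degree n and of weight k in the a_i, and a_i xi^i is
  xi^q times a coefficient of \<open>P\<close>; this accounts for both powers of xi.\<close>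

lemma mc_coeff_mcn:
  assumes "k \<le> n"
  shows "fps_X ^ k * mc_coeff p n k = fps_X ^ (q * n) * mcn n k"
proof -
  let ?A = "Abs_fps (\<lambda>i. aa p i)"
  have "fps_X ^ k * (((?A - fps_const (aa p 0)) ^ j) $ k) = fps_X ^ (q * j) * ((P - fps_const (P $ 0)) ^ j) $ k" for j
  proof -
    have "fps_X ^ k * (((?A - fps_const (aa p 0)) ^ j) $ k) = scl ((?A - fps_const (aa p 0)) ^ j) $ k"
      by (simp add: scl_nth)
    also have "scl ((?A - fps_const (aa p 0)) ^ j) = (fps_const (fps_X ^ q) * (P - fps_const (P $ 0))) ^ j"
      by (simp add: scl_power scl_diff scl_const scl_aa aa_0 algebra_simps)
    finally show ?thesis by (simp add: power_mult_distrib fps_const_power flip: power_mult)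
  qed
  note e = this
  have "fps_X ^ k * mc_coeff p n k = (\<Sum>j\<le>k. (-1) ^ j * of_nat ((n + j) choose j) * aa p 0 ^ (n - j)
                    * (fps_X ^ k * (((?A - fps_const (aa p 0)) ^ j) $ k)))"
    unfolding mc_coeff_def Let_def sum_distrib_left by (intro sum.cong refl) (simp only: mult_ac)
  also have "\<dots> = fps_X ^ (q * n) * mcn n k"
    unfolding mcn_def sum_distrib_left
  proof (intro sum.cong refl)
    fix j assume "j \<in> {..k}"
    then have "q * n = q * (n - j) + q * j" using assms by (simp flip: distrib_left)
    then have X: "(fps_X :: qpoly fps) ^ (q * n) = (fps_X ^ q) ^ (n - j) * fps_X ^ (q * j)"
      by (simp only: power_add power_mult)
    show "(-1) ^ j * of_nat ((n + j) choose j) * aa p 0 ^ (n - j)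
                    * (fps_X ^ k * (((?A - fps_const (aa p 0)) ^ j) $ k)) =
      fps_X ^ (q * n) * ((-1) ^ j * of_nat ((n + j) choose j) * (P $ 0) ^ (n - j) * ((P - fps_const (P $ 0)) ^ j) $ k)"
      unfolding e unfolding aa_0 power_mult_distrib X by (simp only: mult_ac)
  qed
  finally show ?thesis .
qed

lemma bp_mc_coeff: "bp_series p (mc_coeff p n k)"
proof -
  have "bp_series2 p (Abs_fps (\<lambda>i. aa p i) - fps_const (aa p 0))"
    by (auto simp: bp_series2_def intro: bp_series.closed bp_aa)
  then have "bp_series p (((Abs_fps (\<lambda>i. aa p i) - fps_const (aa p 0)) ^ j) $ k)" for j
    using bp_series2.power[of p _ j] unfolding bp_series2_def by blast
  then show ?thesis unfolding mc_coeff_def Let_def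
    by (intro bp_series.sum bp_series.mult bp_series.power bp_aa bp_series.of_nat bp_series.neg bp_series.one)
qed

lemma cc_power: "cc p (p ^ k - 1) = of_nat p ^ k * ell p k"
proof -
  have "p ^ k - 1 + 1 = p ^ k" using p_pos by simp
  then have "{k'. k' \<le> p ^ k - 1 \<and> p ^ k' = p ^ k - 1 + 1} = {k}"
    using p2 exponents_less[of k] by (auto simp: power_inject_exp)
  then show ?thesis
    using qconst_of_nat[of "p ^ k"] by (simp add: cc_def)
qed

lemma cc_other: "Suc j \<notin> range (\<lambda>k. p ^ k) \<Longrightarrow> cc p j = 0"
  unfolding cc_def by (intro sum.neutral) (metis (mono_tags, lifting) Suc_eq_plus1 mem_Collect_eq rangeI)

lemma bp_cc: "bp_poly p (cc p j)"
proof (cases "Suc j \<in> range (\<lambda>k. p ^ k)")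
  case True
  then obtain k where "Suc j = p ^ k" by auto
  then have "j = p ^ k - 1" by simp
  then show ?thesis using cc_power[of k] bp_ell[of k] by simp
qed (simp add: cc_other bp_poly.zero)

lemma bp_MC: "bp_series p (MC p n)"
  unfolding MC_def by (intro bp_series.sum bp_series.mult bp_series_const bp_cc bp_mc_coeff)

lemma L_0 [simp]: "L 0 = 1"
  by (simp add: L_def)

lemma xo_L2: "xo (int (q ^ 2)) (L 2)"
proof (rule xo_mono[OF xo_L])
  obtain m where "p = Suc m" using p_pos by (cases p) auto
  then show "int (q ^ 2) \<le> int (p ^ 2) - 1 - int (2 * q)"
    by (simp add: power2_eq_square)
qed

definition ninv :: "nat \<Rightarrow> qpoly fps" where
  "ninv n = fps_const (qconst (1 / of_nat n))"

lemma ninv_mult: "n > 0 \<Longrightarrow> of_nat n * ninv n = 1"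
proof -
  assume "n > 0"
  have "of_nat n * ninv n = fps_const (of_nat n * qconst (1 / of_nat n))"
    unfolding ninv_def by (simp add: fps_of_nat[symmetric] del: fps_of_nat)
  then show ?thesis using of_nat_mult_qconst_inverse[of n] \<open>n > 0\<close> by simp
qed

lemma bp_ninv: "n > 0 \<Longrightarrow> coprime n p \<Longrightarrow> bp_series p (ninv n)"
  unfolding ninv_def using pint_inverse_of_int[of "int n" p]
  by (intro bp_series_const bp_poly_qconst) simp

lemma coprime_less: "0 < i \<Longrightarrow> i < p \<Longrightarrow> coprime i p"
  using prime by (metis coprime_commute nat_dvd_not_less prime_imp_coprime)

lemma rho_inverse:
  assumes "0 < i" "i < p"
  obtains r where "bp_series p r" "rho i * r = 1"
proof -
  have "bp_poly p (qconst (1 / of_nat i))"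
    using pint_inverse_of_int[of "int i" p] coprime_less[OF assms] assms by (intro bp_poly_qconst) simp
  moreover have "rho i $ 0 * qconst (1 / of_nat i) = 1"
    unfolding rho_0 using assms of_nat_mult_qconst_inverse[of i] by simp
  ultimately show ?thesis
    using bp_poly.fps_inverse_in[of p "rho i"] bp_rho[of i] that unfolding bp_series_eq by blast
qed

lemma xo_1I:
  assumes "bp_series p f" "f $ 0 = of_int (int p * m)"
  shows "xo 1 f"
proof -
  have "f - of_int (int p * m) = fps_X ^ 1 * fps_shift 1 (f - of_int (int p * m))"
    using assms(2) by (intro fps_shift_eq) (simp add: fps_of_int[symmetric] del: fps_of_int)
  moreover have "xo (int 1) (fps_X ^ 1 * fps_shift 1 (f - of_int (int p * m)))"
    using xo_mult[OF xo_X xo_bp[OF bp_series_shift], of "f - of_int (int p * m)" 1 1] assms(1)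
    by (simp add: bp_series.diff bp_series.of_int del: of_int_mult)
  ultimately have "xo 1 (f - of_int (int p * m))" by simp
  moreover have "xo 1 (of_nat p * of_int m)"
    using xo_mult_bp[OF bp_series.of_int xo_mono[OF xo_p, of 1]] q_pos by (simp add: mult.commute)
  ultimately have "xo 1 (f - of_int (int p * m) + of_nat p * of_int m)" by (rule xo_add)
  then show ?thesis by simp
qed

lemma xo_cong_mult:
  assumes "xo N (a - a')" "xo N (b - b')" "xo 0 a'" "xo 0 b"
  shows "xo N (a * b - a' * b')"
proof -
  have "a * b - a' * b' = b * (a - a') + a' * (b - b')" by (simp add: algebra_simps)
  then show ?thesis using assms by (simp add: xo_add xo_mult0)
qed

lemma xo_sym: "xo N (a - b) \<Longrightarrow> xo N (b - a)"
  using xo_neg[of N "a - b"] by simp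

lemma xo_cancel_nat:
  assumes "xo N (of_nat n * a - of_nat n * b)" "coprime n p" "n > 0"
  shows "xo N (a - b)"
proof -
  have "xo N (ninv n * (of_nat n * a - of_nat n * b))"
    using bp_ninv assms by (intro xo_mult_bp) auto
  also have "ninv n * (of_nat n * a - of_nat n * b) = (of_nat n * ninv n) * (a - b)"
    by (simp add: algebra_simps)
  finally show ?thesis using ninv_mult[OF assms(3)] by simp
qed

text \<open>The pair of hypotheses says that f' is the leading part of f in order N. Leading parts
  multiply, which is the calculus used to read off lowest terms.\<close>

lemma lead_mult:
  assumes "xo (N + 1) (f - f')" "xo N f'" "xo (N' + 1) (g - g')" "xo N' g'"
  shows "xo (N + N' + 1) (f * g - f' * g')"
proof -
  have "f * g - f' * g' = (f - f') * (g - g') + (f - f') * g' + f' * (g - g')" by (simp add: algebra_simps)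
  moreover have "xo (N + N' + 1) ((f - f') * (g - g'))"
    using xo_mult[OF assms(1,3)] by (rule xo_mono) simp
  moreover have "xo (N + N' + 1) ((f - f') * g')"
    using xo_mult[OF assms(1,4)] by (rule xo_mono) simp
  moreover have "xo (N + N' + 1) (f' * (g - g'))"
    using xo_mult[OF assms(2,3)] by (rule xo_mono) simp
  ultimately show ?thesis by (simp only: xo_add)
qed

lemma lead_power:
  assumes "xo (N + 1) (f - f')" "xo N f'"
  shows "xo (int n * N + 1) (f ^ n - f' ^ n)"
proof (induction n)
  case (Suc n)
  from lead_mult[OF assms Suc.IH xo_power[OF assms(2)]] show ?case by (simp add: algebra_simps)
qed (simp add: xo_zero)

end

section \<open>Odd primes\<close>

locale bp_odd = bp_prime +
  assumes odd: "p > 2"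
begin

section \<open>Multiples of xi as approximate roots of unity\<close>

abbreviation w :: "qpoly fps" where "w \<equiv> L 1"
abbreviation l :: "qpoly fps" where "l \<equiv> L 2"

text \<open>For odd p the logarithm is cut after \<open>L 2\<close>; this is the order of the
  omitted \<open>L 3\<close>.\<close>

definition NN :: nat where "NN = nat (prec 2)"

lemma int_NN: "int NN = prec 2"
  unfolding NN_def prec_def using p_power_ge[of "Suc 2"] by linarith

lemma NN_ge: "NN \<ge> 1"
proof -
  have "prec 2 \<ge> 1"
  proof -
    obtain m where m: "p = Suc (Suc m)" using p2 by (metis add_2_eq_Suc le_Suc_ex)
    have "int (p ^ Suc 2) - 1 - int (Suc 2 * q) \<ge> 1" unfolding m by (simp add: power3_eq_cube algebra_simps)
    then show ?thesis unfolding prec_def .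
  qed
  then show ?thesis by (simp add: NN_def)
qed

lemma sum3: "(\<Sum>k<Suc 2. f k) = f 0 + f 1 + (f 2 :: 'a::comm_monoid_add)"
  by (simp add: eval_nat_numeral)

lemma log_relation_2: "xo (int NN) (1 + w + l)"
  using log_relation[of 2] unfolding sum3 int_NN by simp

lemma log_relation_Zh_2: "xos (int NN) (Zh i + fps_const w * Zh i ^ p + fps_const l * Zh i ^ (p ^ 2)
   - (fps_X + fps_const w * fps_X ^ p + fps_const l * fps_X ^ (p ^ 2)))"
  using log_relation_Zh[of 2 i] unfolding sum3 int_NN by (simp add: algebra_simps)

lemma q_even: "even q"
  using prime odd prime_odd_nat by (metis even_diff_nat odd_one even_Suc odd_Suc_minus_one p_pos even_add add.commute le_add_diff_inverse less_imp_le_nat One_nat_def Suc_leI)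

lemma pSuc: "p = Suc q" using p_pos by simp

lemma psq: "p ^ 2 = Suc (q * Suc p)"
proof -
  obtain m where "p = Suc m" using p_pos by (cases p) auto
  then show ?thesis by (simp add: power2_eq_square)
qed

lemma geom: "(1 - Y) * (\<Sum>j=1..n. Y ^ j) = Y - Y ^ Suc n" for Y :: "'a::comm_ring_1"
proof (induction n)
  case (Suc n)
  have "(1 - Y) * (\<Sum>j=1..Suc n. Y ^ j) = (1 - Y) * (\<Sum>j=1..n. Y ^ j) + (1 - Y) * Y ^ Suc n"
    by (simp add: distrib_left)
  also have "\<dots> = Y - Y ^ Suc (Suc n)" unfolding Suc.IH by (simp add: algebra_simps)
  finally show ?case .
qed auto

text \<open>Both Y = \<open>rho i ^ q\<close> and 1 are approximate roots of 1 + w Y + l Y^(p+1).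
  The difference of the two values is (Y - 1) times a factor close to w, hence close to -1, which
  can be cancelled.\<close>

lemma rho_q:
  assumes i: "0 < i" "i < p"
  shows "xo (int NN) (rho i ^ q - 1)"
proof -
  obtain r where r: "bp_series p r" "rho i * r = 1" using rho_inverse[OF i] .
  define Y where "Y = rho i ^ q"
  have Y0: "xo 0 Y" unfolding Y_def by (intro X0.power xo_bp bp_rho)
  have "xo (int NN) (rho i + w * rho i ^ p + l * rho i ^ (p ^ 2))"
    using log_relation_Zh_2[of i] p_pos unfolding xos_def
    by (auto simp: Zh_0 fps_power_zeroth power_0_left dest!: spec[of _ 0])
  also have "rho i + w * rho i ^ p + l * rho i ^ (p ^ 2) = rho i * (1 + w * Y + l * Y ^ Suc p)"
  proof -
    have "rho i ^ p = rho i * Y" unfolding Y_def by (subst pSuc) (simp only: power_Suc)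
    moreover have "rho i ^ (p ^ 2) = rho i * Y ^ Suc p"
      unfolding Y_def psq by (simp only: power_Suc[of _ "q * Suc p"] power_mult)
    ultimately show ?thesis by (simp only:) (simp add: algebra_simps)
  qed
  finally have "xo (int NN) (r * (rho i * (1 + w * Y + l * Y ^ Suc p)))"
    using r(1) by (rule xo_mult_bp[rotated])
  also have "r * (rho i * (1 + w * Y + l * Y ^ Suc p)) = 1 + w * Y + l * Y ^ Suc p"
    using r(2) by (simp add: mult.assoc[symmetric] mult.commute[of r])
  finally have "xo (int NN) (1 + w * Y + l * Y ^ Suc p - (1 + w + l))"
    using log_relation_2 by (rule xo_diff)
  also have "1 + w * Y + l * Y ^ Suc p - (1 + w + l) = (Y - 1) * (- 1 + ((1 + w + l) + l * (\<Sum>j=1..p. Y ^ j)))"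
  proof -
    have "(Y - 1) * (\<Sum>j=1..p. Y ^ j) = Y ^ Suc p - Y"
      using geom[of Y p] by (simp add: algebra_simps)
    then have "(Y - 1) * (l * (\<Sum>j=1..p. Y ^ j)) = l * (Y ^ Suc p - Y)"
      by (metis mult.left_commute)
    then show ?thesis by (simp add: algebra_simps)
  qed
  finally have "xo (int NN) ((Y - 1) * (- 1 + ((1 + w + l) + l * (\<Sum>j=1..p. Y ^ j))))" .
  moreover have "xo 1 ((1 + w + l) + l * (\<Sum>j=1..p. Y ^ j))"
  proof (rule xo_add)
    show "xo 1 (1 + w + l)" using log_relation_2 NN_ge xo_mono by force
    have "1 \<le> q ^ 2" using q_pos by simp
    then have "xo 1 l" using xo_mono[OF xo_L2, of 1] by linarith
    then show "xo 1 (l * (\<Sum>j=1..p. Y ^ j))"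
      using xo_mult0[OF X0.sum[OF X0.power[OF Y0]]] by (simp add: mult.commute)
  qed
  ultimately show ?thesis
    unfolding Y_def[symmetric] using Y0
    by (intro xo_unit_improve[of "Y - 1" "- 1" "- 1" "(1 + w + l) + l * (\<Sum>j=1..p. Y ^ j)"] X0.diff X0.neg X0.one) simp_all
qed

text \<open>Uniqueness of Teichmueller representatives, as in Hensel's lemma: two approximate q-th
  roots of unity with the same residue agree, since the derivative q B^(q-1) is a unit.\<close>

lemma rho_eq_primroot_power:
  assumes i: "0 < i" "i < p" and g: "0 < g" "g < p" and ij: "[g ^ j = i] (mod p)"
  shows "xo (int NN) (rho g ^ j - rho i)"
proof -
  obtain r where r: "bp_series p r" "rho i * r = 1" using rho_inverse[OF i] .
  let ?A = "rho g ^ j" and ?B = "rho i"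
  have bp: "bp_series p ?A" "bp_series p ?B" by (auto intro: bp_series.power bp_rho)
  have "int p dvd int (g ^ j) - int i" using ij by (simp add: cong_iff_dvd_diff flip: cong_int_iff)
  then obtain m where m: "int (g ^ j) - int i = int p * m" by auto
  have AB: "xo 1 (?A - ?B)"
  proof (rule xo_1I)
    show "bp_series p (?A - ?B)" using bp by (rule bp_series.diff)
    show "(?A - ?B) $ 0 = of_int (int p * m)"
      unfolding m[symmetric] by (simp add: fps_power_zeroth rho_0)
  qed
  have "?A ^ q - ?B ^ q = (?A - ?B) * (of_nat q * ?B ^ (q - 1) + (\<Sum>a<q. ?B ^ (q - Suc a) * (?A ^ a - ?B ^ a)))"
  proof -
    have "(\<Sum>a<q. ?B ^ (q - Suc a) * ?A ^ a) = (\<Sum>a<q. ?B ^ (q - 1) + ?B ^ (q - Suc a) * (?A ^ a - ?B ^ a))"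
    proof (intro sum.cong refl)
      fix a assume "a \<in> {..<q}"
      then have "q - 1 = (q - Suc a) + a" by simp
      then have "?B ^ (q - 1) = ?B ^ (q - Suc a) * ?B ^ a" by (simp only: power_add)
      then show "?B ^ (q - Suc a) * ?A ^ a = ?B ^ (q - 1) + ?B ^ (q - Suc a) * (?A ^ a - ?B ^ a)"
        by (simp add: algebra_simps)
    qed
    then show ?thesis unfolding power_diff_sumr2 by (simp add: sum.distrib)
  qed
  moreover have "xo (int NN) (?A ^ q - ?B ^ q)"
  proof -
    have "xo (int NN) ((rho g ^ q) ^ j - 1 ^ j)"
      using rho_q[OF g] by (intro xo_diff_power) (auto intro: xo_bp bp_series.power bp_rho bp_series.one)
    moreover have "(rho g ^ q) ^ j = ?A ^ q" by (simp only: power_mult[symmetric] mult.commute)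
    ultimately have "xo (int NN) (?A ^ q - 1)" by (simp only: power_one)
    from xo_diff[OF this rho_q[OF i]] show ?thesis by simp
  qed
  ultimately have "xo (int NN) ((?A - ?B) * (of_nat q * ?B ^ (q - 1) + (\<Sum>a<q. ?B ^ (q - Suc a) * (?A ^ a - ?B ^ a))))"
    by simp
  moreover have "xo 1 (\<Sum>a<q. ?B ^ (q - Suc a) * (?A ^ a - ?B ^ a))"
    using AB bp by (intro xo_sum xo_mult0 xo_diff_power X0.power) (auto intro: xo_bp bp_rho)
  moreover have "(of_nat q * ?B ^ (q - 1)) * (ninv q * r ^ (q - 1)) = 1"
  proof -
    have "(of_nat q * ?B ^ (q - 1)) * (ninv q * r ^ (q - 1)) = (of_nat q * ninv q) * (?B * r) ^ (q - 1)"
      by (simp only: power_mult_distrib mult_ac)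
    then show ?thesis unfolding r(2) ninv_mult[OF q_pos] by (simp only: power_one mult_1)
  qed
  moreover have "xo 0 (ninv q * r ^ (q - 1))"
    using r(1) q_pos coprime_less[of q] p_pos
    by (intro xo_bp bp_series.mult bp_ninv bp_series.power) auto
  ultimately show ?thesis
    using xo_unit_improve[of "?A - ?B" "ninv q * r ^ (q - 1)" "of_nat q * ?B ^ (q - 1)" _ NN] bp
    by (auto intro: xo_bp bp_series.diff)
qed

text \<open>Running through a primitive root h makes this a geometric sum D with
  (\<open>rho h ^ m\<close> - 1) D close to 0. As h has order q > m modulo p, h^m - 1 is prime to p
  and the factor is a unit.\<close>

lemma power_sum:
  assumes m: "0 < m" "m < q"
  shows "xo (int NN) (\<Sum>i=1..<p. rho i ^ m)"
proof -
  obtain g where g: "residue_primroot p g"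
    using prime_primitive_root_exists[OF _ prime] odd by auto
  define h where "h = g mod p"
  have hg: "[h = g] (mod p)" by (simp add: h_def)
  have h: "residue_primroot p h"
    using g residue_primroot_cong[OF hg] by simp
  have bij: "bij_betw (\<lambda>i. h ^ i mod p) {..<totient p} (totatives p)"
    using residue_primroot_is_generator[OF _ h] odd by simp
  have tot: "totient p = q" "totatives p = {1..<p}"
    using prime by (auto simp: totient_prime totatives_prime)
  have hpos: "0 < h" "h < p"
  proof -
    show "h < p" using p_pos by (simp add: h_def)
    have "coprime p h" using h by (simp add: residue_primroot_def)
    then show "0 < h" using odd by (cases "h = 0") auto
  qed
  have "(\<Sum>i=1..<p. rho i ^ m) = (\<Sum>j<q. rho (h ^ j mod p) ^ m)"
    using sum.reindex_bij_betw[OF bij[unfolded tot], of "\<lambda>i. rho i ^ m"] by simp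
  moreover have "xo (int NN) ((\<Sum>j<q. (rho h ^ m) ^ j) - (\<Sum>j<q. rho (h ^ j mod p) ^ m))"
    unfolding sum_subtractf[symmetric]
  proof (rule xo_sum)
    fix j assume j: "j \<in> {..<q}"
    then have "h ^ j mod p \<in> {1..<p}" using bij unfolding tot bij_betw_def by blast
    then have "xo (int NN) (rho h ^ j - rho (h ^ j mod p))"
      using hpos by (intro rho_eq_primroot_power) auto
    then have "xo (int NN) ((rho h ^ j) ^ m - rho (h ^ j mod p) ^ m)"
      by (intro xo_diff_power) (auto intro: xo_bp bp_series.power bp_rho)
    also have "(rho h ^ j) ^ m = (rho h ^ m) ^ j" by (simp only: power_mult[symmetric] mult.commute)
    finally show "xo (int NN) ((rho h ^ m) ^ j - rho (h ^ j mod p) ^ m)" .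
  qed
  moreover have "xo (int NN) (\<Sum>j<q. (rho h ^ m) ^ j)"
  proof -
    let ?D = "\<Sum>j<q. (rho h ^ m) ^ j"
    define c where "c = int (h ^ m) - 1"
    have "ord p h = q" using h tot by (simp add: residue_primroot_def)
    then have "\<not> [h ^ m = 1] (mod p)" using m by (simp add: ord_divides' nat_dvd_not_less)
    then have nd: "\<not> int p dvd c"
      unfolding c_def by (metis cong_iff_dvd_diff cong_int_iff of_nat_1)
    then have "coprime (int p) c" using prime by (intro prime_imp_coprime) auto
    then have cop: "coprime c (int p)" by (simp add: coprime_commute)
    have c0: "c \<noteq> 0" using nd by auto
    define c' where "c' = fps_const (qconst (1 / of_int c))"
    have "of_int c * c' = fps_const (qconst (of_int c) * qconst (1 / of_int c))"
      unfolding c'_def by (simp add: fps_of_int[symmetric] del: fps_of_int)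
    then have cc': "of_int c * c' = 1" using c0 by (simp del: qconst_of_int flip: qconst_mult)
    have c'0: "xo 0 c'" unfolding c'_def
      using cop c0 by (intro xo_bp bp_series_const bp_poly_qconst pint_inverse_of_int)
    have e: "xo 1 (rho h ^ m - 1 - of_int c)"
    proof (rule xo_1I[where m = 0])
      show "bp_series p (rho h ^ m - 1 - of_int c)"
        by (intro bp_series.diff bp_series.power bp_rho bp_series.one bp_series.of_int)
      show "(rho h ^ m - 1 - of_int c) $ 0 = of_int (int p * 0)"
        by (simp add: fps_power_zeroth rho_0 c_def fps_of_int[symmetric] fps_of_nat[symmetric] del: fps_of_int fps_of_nat)
    qed
    have "(rho h ^ m) ^ q - 1 = (rho h ^ m - 1) * ?D"
      by (rule power_diff_1_eq)
    then have "?D * (of_int c + (rho h ^ m - 1 - of_int c)) = (rho h ^ q) ^ m - 1 ^ m"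
      by (simp add: mult.commute flip: power_mult)
    moreover have "xo (int NN) ((rho h ^ q) ^ m - 1 ^ m)"
      using rho_q[OF hpos] by (intro xo_diff_power) (auto intro: xo_bp bp_series.power bp_rho bp_series.one)
    ultimately have "xo (int NN) (?D * (of_int c + (rho h ^ m - 1 - of_int c)))" by simp
    moreover have "xo 0 ?D" by (intro xo_bp bp_series.sum bp_series.power bp_rho)
    ultimately show ?thesis
      using xo_unit_improve[OF _ c'0 cc' e] by blast
  qed
  ultimately show ?thesis using xo_diff by fastforce
qed

section \<open>The logarithmic derivative of the product\<close>

abbreviation lc :: "qpoly fps fps" where "lc \<equiv> fps_const l"
abbreviation wc :: "qpoly fps fps" where "wc \<equiv> fps_const w"

definition ua :: "qpoly fps fps" where
  "ua = wc + lc * fps_X ^ (p ^ 2 - p)"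

text \<open>\<open>fps_X * u\<close> is the truncated logarithm of the rescaled x. Taking residues
  against powers of it, rather than of x, makes the change of variable possible.\<close>

definition u :: "qpoly fps fps" where
  "u = 1 + fps_X ^ q * ua"

lemma xos_w: "xos 0 wc" and xos_l: "xos 0 lc"
  by (auto intro: xos_const xo_0_L)

lemma xos_u: "xos 0 u"
  unfolding u_def ua_def by (intro XS.add XS.one XS.mult XS.power xos_X xos_w xos_l)

lemma X_mult_u: "fps_X * u = fps_X + wc * fps_X ^ p + lc * fps_X ^ (p ^ 2)"
proof -
  have "fps_X * fps_X ^ q = (fps_X ^ p :: qpoly fps fps)" using p_pos by (simp flip: power_Suc)
  moreover have "p ^ 2 = p + (p ^ 2 - p)" using p_pos by (simp add: power2_eq_square)
  then have "fps_X ^ (p ^ 2) = fps_X ^ p * (fps_X ^ (p ^ 2 - p) :: qpoly fps fps)"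
    by (metis power_add)
  ultimately show ?thesis
    unfolding u_def ua_def by (simp add: distrib_left mult.assoc[symmetric])
qed

definition ui :: "qpoly fps fps" where
  "ui = (SOME g. xos 0 g \<and> u * g = 1)"

lemma ui: "xos 0 ui" "u * ui = 1"
proof -
  have "u $ 0 * 1 = 1" using q_pos by (simp add: u_def)
  then have "\<exists>g. xos 0 g \<and> u * g = 1"
    using X0.fps_inverse_in[of u 1] xos_u X0.one unfolding xos_0_eq by blast
  from someI_ex[OF this] show "xos 0 ui" "u * ui = 1" unfolding ui_def by auto
qed

text \<open>The series variable stands for \<tau> here: \<open>B\<close> is 1 + \<tau>, and
  \<open>\<theta>b\<close> is ((1 + \<tau>)^q - 1) / \<tau>, whose constant term q is a
  unit.\<close>

definition B :: "qpoly fps fps" where "B = 1 + fps_X"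
definition Bi :: "qpoly fps fps" where "Bi = Abs_fps (\<lambda>n. (-1) ^ n)"
definition \<theta>b :: "qpoly fps fps" where "\<theta>b = (\<Sum>a<q. B ^ a)"
definition \<theta>bi :: "qpoly fps fps" where "\<theta>bi = (SOME g. bp_series2 p g \<and> \<theta>b * g = 1)"

lemma bp_B: "bp_series2 p B"
  by (auto simp: B_def bp_series2_def fps_X_nth intro: bp_series.closed)

lemma bp_Bi: "bp_series2 p Bi"
  unfolding Bi_def bp_series2_def by (auto intro: bp_series.closed)

lemma B_Bi: "B * Bi = 1"
proof (rule fps_ext)
  fix n
  show "(B * Bi) $ n = (1 :: qpoly fps fps) $ n"
    by (cases n) (simp_all add: B_def Bi_def distrib_right)
qed

lemma \<theta>bi: "bp_series2 p \<theta>bi" "\<theta>b * \<theta>bi = 1"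
proof -
  have "\<theta>b $ 0 = of_nat q" by (simp add: \<theta>b_def fps_sum_nth fps_power_zeroth B_def)
  then have "\<theta>b $ 0 * ninv q = 1" using ninv_mult[OF q_pos] by simp
  moreover have "bp_series p (ninv q)" using q_pos coprime_less[of q] p_pos by (intro bp_ninv) auto
  moreover have "bp_series2 p \<theta>b" unfolding \<theta>b_def by (intro bp_series2.sum bp_series2.power bp_B)
  ultimately have "\<exists>g. bp_series2 p g \<and> \<theta>b * g = 1"
    using bp_series.fps_inverse_in[of p \<theta>b "ninv q"] unfolding bp_series2_eq by blast
  from someI_ex[OF this] show "bp_series2 p \<theta>bi" "\<theta>b * \<theta>bi = 1" unfolding \<theta>bi_def by auto
qed

definition Qs :: "nat \<Rightarrow> qpoly fps fps \<Rightarrow> qpoly fps fps" where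
  "Qs k Y = (\<Sum>m\<le>4. of_nat (ncoef k m) * (lc * (\<Sum>j=1..p. Y ^ j)) ^ m)"

definition As :: "nat \<Rightarrow> qpoly fps fps" where
  "As k = Bi ^ Suc k * Qs k (B ^ q) * \<theta>bi ^ k"

text \<open>With \<open>\<tau> = Zh i / rho i - 1\<close>, the
  logarithm relation reads \<open>- rho i (1 + \<tau>) \<eta> \<kappa> = x + w x ^ p + \<dots>\<close>, where \<open>\<eta> = (1 + \<tau>) ^ q - 1\<close> and
  \<open>\<kappa> = 1 - l ((1 + \<eta>) + \<dots> + (1 + \<eta>) ^ p)\<close>, and \<open>Qs k\<close> is the truncation of \<open>\<kappa> ^ (- k)\<close> at \<open>l ^ 5\<close>.\<close>
definition C :: "nat \<Rightarrow> qpoly fps" where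
  "C k = (-1) ^ k * As k $ (k - 1)"

lemma compose_of_nat: "(of_nat n :: qpoly fps fps) oo t = of_nat n"
  using fps_const_compose[of "of_nat n :: qpoly fps" t] by (simp add: fps_of_nat)

lemma Qs_compose:
  assumes "t $ 0 = 0"
  shows "Qs k Y oo t = Qs k (Y oo t)"
  unfolding Qs_def fps_compose_sum_distrib
  by (simp add: fps_compose_mult_distrib[OF assms] fps_compose_power[OF assms, symmetric]
      fps_compose_sum_distrib compose_of_nat)

text \<open>Two errors compete: the omitted \<open>L 3\<close>, and the omitted fifth power of l, as
  l has order q^2.\<close>

definition NM :: nat where "NM = min NN (5 * q ^ 2)"

lemma xos_NM: "xos (int NN) A \<Longrightarrow> xos (int NM) A"
  by (rule xos_mono) (auto simp: NM_def)

lemma xo_NM: "xo (int NN) A \<Longrightarrow> xo (int NM) A"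
  by (rule xo_mono) (auto simp: NM_def)

text \<open>The residue of dZ / Z against the k-th power of the logarithm of x. Up to the precision
  \<open>Zh i ^ q\<close> is (1 + \<tau>)^q for every i, so in the variable \<tau> the index i
  enters only through the scaling factor r^k.\<close>

lemma residue_of_log_derivative:
  assumes i: "0 < i" "i < p" and r: "bp_series p r" "rho i * r = 1"
  shows "\<exists>Zi. Zh i * Zi = 1 \<and> xos 0 Zi \<and>
     (\<forall>k>0. xo (int NM) ((fps_deriv (Zh i) * Zi * ui ^ k) $ (k - 1) - r ^ k * C k))"
proof -
  define T where "T = fps_const r * Zh i"
  define \<tau> where "\<tau> = T - 1"
  define \<mu> where "\<mu> = fps_shift 1 \<tau>"
  have bp_c: "bp_series p c \<Longrightarrow> bp_series2 p (fps_const c)" for c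
    by (auto simp: bp_series2_def intro: bp_series.zero)
  have bpT: "bp_series2 p T" unfolding T_def using r(1) by (intro bp_series2.mult bp_c bp_Zh)
  have \<tau>0: "\<tau> $ 0 = 0" using r(2) by (simp add: \<tau>_def T_def Zh_0 mult.commute)
  have \<tau>\<mu>: "\<tau> = fps_X * \<mu>" using fps_shift_eq[of 1 \<tau>] \<tau>0 by (simp add: \<mu>_def)
  have bp\<tau>: "bp_series2 p \<tau>" unfolding \<tau>_def by (intro bp_series2.diff bpT bp_series2.one)
  then have bp\<mu>: "bp_series2 p \<mu>" by (simp add: \<mu>_def bp_series2_def)
  have "\<exists>z. bp_series p z \<and> Z i $ 1 * z = 1"
    using bp_poly.fps_inverse_in[of p "Z i $ 1" 1] bp_Z[of i] Z_1_0 bp_poly.one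
    unfolding bp_series2_def bp_series_eq by simp
  then obtain z where z: "bp_series p z" "Z i $ 1 * z = 1" by blast
  have "\<mu> $ 0 = r * Z i $ 1" by (simp add: \<mu>_def \<tau>_def T_def Zh_def)
  then have "\<mu> $ 0 * (rho i * z) = (rho i * r) * (Z i $ 1 * z)" by (simp only: mult_ac)
  then have "\<mu> $ 0 * (rho i * z) = 1" unfolding r z by simp
  then obtain \<nu> where \<nu>: "bp_series2 p \<nu>" "\<mu> * \<nu> = 1"
    using bp_series.fps_inverse_in[of p \<mu> "rho i * z"] bp\<mu> z bp_rho bp_series.mult
    unfolding bp_series2_eq by blast
  define Ti where "Ti = Bi oo \<tau>"
  define \<theta> where "\<theta> = \<theta>b oo \<tau>"
  define \<theta>i where "\<theta>i = \<theta>bi oo \<tau>"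
  have BT: "B oo \<tau> = T"
    by (simp add: B_def fps_compose_add_distrib fps_X_compose_self[OF \<tau>0]) (simp add: \<tau>_def)
  have TTi: "T * Ti = 1"
    unfolding Ti_def BT[symmetric] fps_compose_mult_distrib[OF \<tau>0, symmetric] B_Bi by simp
  have \<theta>\<theta>i: "\<theta> * \<theta>i = 1"
    unfolding \<theta>_def \<theta>i_def fps_compose_mult_distrib[OF \<tau>0, symmetric] \<theta>bi by simp
  have \<theta>T: "\<theta> = (\<Sum>a<q. T ^ a)"
    unfolding \<theta>_def \<theta>b_def fps_compose_sum_distrib fps_compose_power[OF \<tau>0, symmetric] BT ..
  have bpTi: "bp_series2 p Ti" and bp\<theta>i: "bp_series2 p \<theta>i"
    unfolding Ti_def \<theta>i_def using bp_series.fps_compose_in[of p _ \<tau>] bp_Bi \<theta>bi bp\<tau>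
    unfolding bp_series2_eq by blast+
  have bp\<theta>: "bp_series2 p \<theta>" unfolding \<theta>T by (intro bp_series2.sum bp_series2.power bpT)
  define Y where "Y = T ^ q"
  have Y0: "xos 0 Y" unfolding Y_def by (intro XS.power xos_bp bpT)
  define y where "y = lc * (\<Sum>j=1..p. Y ^ j)"
  have y0: "xos 0 y" unfolding y_def by (intro XS.mult XS.sum XS.power Y0 xos_l)
  have yq: "xos (int (q ^ 2)) y"
    unfolding y_def using xos_mult[OF xos_const[OF xo_L2] XS.sum[OF XS.power[OF Y0]]] by simp
  have Z0: "xos 0 (Zh i)" by (intro xos_bp bp_Zh)
  have ZT: "Zh i = fps_const (rho i) * T"
    unfolding T_def using r(2) by (simp add: mult.assoc[symmetric])
  have Zq: "xos (int NN) (Zh i ^ q - Y)"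
  proof -
    have "Zh i ^ q - Y = Y * fps_const (rho i ^ q - 1)"
      unfolding ZT Y_def power_mult_distrib by (simp add: fps_const_power algebra_simps flip: fps_const_sub)
    then show ?thesis using rho_q[OF i] by (simp only:) (intro xos_mult0 Y0 xos_const)
  qed
  \<comment> \<open>The three estimates replace x u by the logarithm of \<open>Zh i\<close>, then
    \<open>Zh i ^ q\<close> by Y, then w by - 1 - l; after the last one the factor 1 - Y splits
    off.\<close>
  have e1: "xos (int NN) (fps_X * u - Zh i * (1 + wc * Zh i ^ q + lc * (Zh i ^ q) ^ Suc p))"
  proof -
    have "Zh i ^ p = Zh i * Zh i ^ q" by (subst pSuc) (simp only: power_Suc)
    moreover have "Zh i ^ (p ^ 2) = Zh i * (Zh i ^ q) ^ Suc p"
      unfolding psq by (simp only: power_Suc[of _ "q * Suc p"] power_mult)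
    ultimately have "Zh i + wc * Zh i ^ p + lc * Zh i ^ (p ^ 2) = Zh i * (1 + wc * Zh i ^ q + lc * (Zh i ^ q) ^ Suc p)"
      by (simp only:) (simp add: algebra_simps)
    then have "fps_X * u - Zh i * (1 + wc * Zh i ^ q + lc * (Zh i ^ q) ^ Suc p) =
       - (Zh i + wc * Zh i ^ p + lc * Zh i ^ (p ^ 2) - (fps_X + wc * fps_X ^ p + lc * fps_X ^ (p ^ 2)))"
      unfolding X_mult_u by (simp only:) simp
    then show ?thesis using xos_neg[OF log_relation_Zh_2[of i]] by (simp only:)
  qed
  have e2: "xos (int NN) (Zh i * (1 + wc * Zh i ^ q + lc * (Zh i ^ q) ^ Suc p) - Zh i * (1 + wc * Y + lc * Y ^ Suc p))"
  proof -
    have "Zh i * (1 + wc * Zh i ^ q + lc * (Zh i ^ q) ^ Suc p) - Zh i * (1 + wc * Y + lc * Y ^ Suc p)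
      = Zh i * (wc * (Zh i ^ q - Y) + lc * ((Zh i ^ q) ^ Suc p - Y ^ Suc p))"
      by (simp add: algebra_simps)
    moreover have "xos (int NN) ((Zh i ^ q) ^ Suc p - Y ^ Suc p)"
      by (intro xos_diff_power XS.power Z0 Y0 Zq)
    ultimately show ?thesis
      by (simp only:) (intro xos_mult0[OF Z0] xos_add xos_mult0[OF xos_w] xos_mult0[OF xos_l] Zq)
  qed
  have e3: "xos (int NN) (Zh i * (1 + wc * Y + lc * Y ^ Suc p) - Zh i * ((1 - Y) * (1 - y)))"
  proof -
    have g: "(1 - Y) * y = lc * (Y - Y ^ Suc p)"
      unfolding y_def geom[symmetric] by (simp only: mult_ac)
    have "(1 - Y) * (1 - y) = 1 - Y - (1 - Y) * y" by (simp add: algebra_simps)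
    then have "Zh i * (1 + wc * Y + lc * Y ^ Suc p) - Zh i * ((1 - Y) * (1 - y)) = Zh i * (Y * (1 + wc + lc))"
      unfolding g by (simp only:) (simp add: algebra_simps del: fps_const_add)
    also have "1 + wc + lc = fps_const (1 + w + l)" by (simp flip: fps_const_add)
    finally show ?thesis using log_relation_2 by (simp only:) (intro xos_mult0[OF Z0] xos_mult0[OF Y0] xos_const)
  qed
  define U where "U = - (fps_const (rho i) * T * \<mu> * \<theta>)"
  define W where "W = - (fps_const r * Ti * \<nu> * \<theta>i)"
  have UW: "U * W = 1"
  proof -
    have "U * W = (fps_const (rho i) * fps_const r) * (T * Ti) * (\<mu> * \<nu>) * (\<theta> * \<theta>i)"
      unfolding U_def W_def by (simp only: minus_mult_minus mult_ac)
    then show ?thesis using r TTi \<nu> \<theta>\<theta>i by simp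
  qed
  have U0: "xos 0 U" and W0: "xos 0 W"
    unfolding U_def W_def using r
    by (auto intro!: XS.neg XS.mult intro: xos_bp bp_c bp_rho bpT bp\<mu> bp\<theta> bpTi \<nu> bp\<theta>i)
  have Y1: "1 - Y = - (fps_X * \<mu> * \<theta>)"
  proof -
    have "Y - 1 = (T - 1) * (\<Sum>a<q. T ^ a)" unfolding Y_def by (rule power_diff_1_eq)
    then have "Y - 1 = fps_X * \<mu> * \<theta>" unfolding \<theta>T \<tau>\<mu>[symmetric] \<tau>_def .
    then show ?thesis by (simp add: algebra_simps)
  qed
  have "Zh i * ((1 - Y) * (1 - y)) = fps_X * (U * (1 - y))"
    unfolding Y1 U_def ZT by (simp only: mult_minus_left mult_minus_right mult_ac)
  then have "xos (int NN) (fps_X * (u - U * (1 - y)))"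
    using xos_trans[OF xos_trans[OF e1 e2] e3] by (simp only: right_diff_distrib)
  then have e4: "xos (int NN) (u - U * (1 - y))" by (rule xos_cancel_X)
  define Zi where "Zi = fps_const r * Ti"
  have ZZi: "Zh i * Zi = 1"
  proof -
    have "Zh i * Zi = (fps_const (rho i) * fps_const r) * (T * Ti)"
      unfolding ZT Zi_def by (simp only: mult_ac)
    then show ?thesis using r TTi by simp
  qed
  have Zi0: "xos 0 Zi" unfolding Zi_def using r by (intro XS.mult xos_bp bp_c bpTi)
  have dZ0: "xos 0 (fps_deriv (Zh i))"
    unfolding xos_def fps_deriv_nth
    using bp_Zh[of i] by (intro allI xo_bp bp_series.mult bp_series.of_nat) (auto simp: bp_series2_def)
  have dZ: "fps_deriv (Zh i) * Zi = Ti * fps_deriv (fps_X * \<mu>)"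
  proof -
    have "T = 1 + fps_X * \<mu>" using \<tau>\<mu> by (simp add: \<tau>_def algebra_simps)
    then have "fps_deriv (Zh i) * Zi = (fps_const (rho i) * fps_const r) * (Ti * fps_deriv (fps_X * \<mu>))"
      unfolding ZT Zi_def by (simp only:) (simp add: mult_ac del: fps_const_mult fps_deriv_mult)
    then show ?thesis using r by simp
  qed
  have "xo (int NM) ((fps_deriv (Zh i) * Zi * ui ^ k) $ (k - 1) - r ^ k * C k)" if k: "k > 0" for k
  proof -
    define Q where "Q = Qs k Y"
    have Q0: "xos 0 Q" unfolding Q_def Qs_def y_def[symmetric]
      by (intro XS.sum XS.mult XS.power XS.of_nat y0)
    obtain R where R: "xos 0 R" "(1 - y) ^ k * (\<Sum>m\<le>4. of_nat (ncoef k m) * y ^ m) = 1 + y ^ Suc 4 * R"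
      using neg_binomial_truncated[OF XS.subring_pred_axioms y0] by blast
    have QR: "(1 - y) ^ k * Q = 1 + y ^ 5 * R" using R(2) unfolding Q_def Qs_def y_def[symmetric] by simp
    have y5: "xos (int NM) (y ^ 5 * R)"
    proof (rule xos_mono)
      show "xos (int 5 * int (q ^ 2)) (y ^ 5 * R)"
        using xos_mult[OF xos_power[OF yq] R(1), of 5] by simp
      have "NM \<le> 5 * q ^ 2" by (simp add: NM_def)
      then show "int NM \<le> int 5 * int (q ^ 2)" by (metis of_nat_le_iff of_nat_mult)
    qed
    have "xos (int NM) (u ^ k - (U * (1 - y)) ^ k)"
      using e4 by (intro xos_diff_power xos_NM xos_u XS.mult U0 XS.diff XS.one y0)
    then have f1: "xos (int NM) (Q * (u ^ k - (U * (1 - y)) ^ k))" by (intro xos_mult0 Q0)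
    have "xos (int NM) (U ^ k * (y ^ 5 * R) + Q * (u ^ k - (U * (1 - y)) ^ k))"
      by (intro xos_add f1 xos_mult0 XS.power U0 y5)
    then have "xos (int NM) (ui ^ k * W ^ k * (U ^ k * (y ^ 5 * R) + Q * (u ^ k - (U * (1 - y)) ^ k)))"
      by (intro xos_mult0 XS.mult XS.power ui W0)
    also have "ui ^ k * W ^ k * (U ^ k * (y ^ 5 * R) + Q * (u ^ k - (U * (1 - y)) ^ k)) = W ^ k * Q - ui ^ k"
    proof -
      have "U ^ k * (y ^ 5 * R) + Q * (u ^ k - (U * (1 - y)) ^ k) =
        U ^ k * ((1 - y) ^ k * Q - 1) + Q * (u ^ k - U ^ k * (1 - y) ^ k)"
        unfolding QR power_mult_distrib by simp
      also have "\<dots> = Q * u ^ k - U ^ k" by (simp add: algebra_simps)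
      finally have "ui ^ k * W ^ k * (U ^ k * (y ^ 5 * R) + Q * (u ^ k - (U * (1 - y)) ^ k)) =
         W ^ k * Q * (u * ui) ^ k - ui ^ k * (U * W) ^ k"
        by (simp only: right_diff_distrib power_mult_distrib) (simp only: mult_ac)
      then show ?thesis by (simp add: UW ui)
    qed
    finally have "xos (int NM) (fps_deriv (Zh i) * Zi * (W ^ k * Q - ui ^ k))"
      by (intro xos_mult0 XS.mult dZ0 Zi0)
    then have g1: "xo (int NM) ((fps_deriv (Zh i) * Zi * (W ^ k * Q)) $ (k - 1) - (fps_deriv (Zh i) * Zi * ui ^ k) $ (k - 1))"
      unfolding right_diff_distrib xos_def by (simp only: fps_sub_nth)
    have "fps_deriv (Zh i) * Zi * (W ^ k * Q) = fps_const ((-1) ^ k * r ^ k) * ((As k oo \<tau>) * fps_deriv (fps_X * \<mu>) * \<nu> ^ k)"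
    proof -
      have As: "As k oo \<tau> = Ti ^ Suc k * Q * \<theta>i ^ k"
        unfolding As_def fps_compose_mult_distrib[OF \<tau>0] fps_compose_power[OF \<tau>0, symmetric]
          Ti_def[symmetric] \<theta>i_def[symmetric] Qs_compose[OF \<tau>0] BT Q_def Y_def ..
      have Wk: "W ^ k = fps_const ((-1) ^ k * r ^ k) * (Ti ^ k * \<nu> ^ k * \<theta>i ^ k)"
      proof -
        have m: "(- 1 :: qpoly fps fps) ^ k = fps_const ((-1) ^ k)"
          by (cases "even k") (auto simp flip: fps_const_neg)
        have "W ^ k = (- 1) ^ k * (fps_const r * Ti * \<nu> * \<theta>i) ^ k"
          unfolding W_def by (rule power_minus)
        also have "\<dots> = fps_const ((-1) ^ k) * fps_const (r ^ k) * (Ti ^ k * \<nu> ^ k * \<theta>i ^ k)"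
          unfolding m power_mult_distrib fps_const_power by (simp only: mult.assoc)
        finally show ?thesis by (simp only: fps_const_mult)
      qed
      show ?thesis unfolding dZ As Wk power_Suc by (simp only: mult_ac)
    qed
    then have "(fps_deriv (Zh i) * Zi * (W ^ k * Q)) $ (k - 1) = (-1) ^ k * r ^ k * As k $ (k - 1)"
      unfolding \<tau>\<mu> using residue_change[OF \<nu>(2) k, of "As k"] by simp
    also have "\<dots> = r ^ k * C k" unfolding C_def by (simp only: mult_ac)
    finally show ?thesis using xo_sym[OF g1] by (simp only:)
  qed
  then show ?thesis using ZZi Zi0 by blast
qed

lemma B_compose: "e $ 0 = 0 \<Longrightarrow> B oo e = 1 + e"
  by (simp add: B_def fps_compose_add_distrib fps_X_compose_self)

lemma Bi_power_compose:
  "Bi oo (B ^ q - 1) = Bi ^ q" "B oo (B ^ q - 1) = B ^ q"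
proof -
  let ?\<eta> = "B ^ q - 1"
  have \<eta>0: "?\<eta> $ 0 = 0" by (simp add: fps_power_zeroth B_def)
  show B: "B oo ?\<eta> = B ^ q"
    unfolding B_compose[OF \<eta>0] by simp
  have "(B oo ?\<eta>) * (Bi oo ?\<eta>) = 1"
    unfolding fps_compose_mult_distrib[OF \<eta>0, symmetric] B_Bi by simp
  then have "Bi ^ q * (B ^ q * (Bi oo ?\<eta>)) = Bi ^ q"
    unfolding B by (simp only: mult_1_right)
  also have "Bi ^ q * (B ^ q * (Bi oo ?\<eta>)) = (B * Bi) ^ q * (Bi oo ?\<eta>)"
    by (simp only: power_mult_distrib mult_ac)
  finally show "Bi oo ?\<eta> = Bi ^ q" by (simp only: B_Bi power_one mult_1)
qed

text \<open>The variable eta = (1 + tau)^q - 1 removes the q-th root from the residue.\<close>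
lemma C_eval:
  assumes "s > 0"
  shows "of_nat q * C (s * q) = (Bi ^ Suc s * Qs (s * q) B) $ (s * q - 1)"
proof -
  let ?\<eta> = "B ^ q - 1"
  let ?D = "Bi ^ Suc s * Qs (s * q) B"
  have k: "s * q > 0" using assms q_pos by simp
  have \<eta>: "?\<eta> = fps_X * \<theta>b"
    using power_diff_1_eq[of B q] unfolding \<theta>b_def by (simp add: B_def)
  have \<eta>0: "?\<eta> $ 0 = 0" by (simp add: fps_power_zeroth B_def)
  have h1: "?D oo ?\<eta> = (Bi ^ q) ^ Suc s * Qs (s * q) (B ^ q)"
    unfolding fps_compose_mult_distrib[OF \<eta>0] fps_compose_power[OF \<eta>0, symmetric] Qs_compose[OF \<eta>0]
      Bi_power_compose ..
  have h2: "fps_deriv ?\<eta> = of_nat q * B ^ (q - 1)"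
    using fps_deriv_power'[of B q] by (simp add: B_def)
  have h3: "(Bi ^ q) ^ Suc s * B ^ (q - 1) = Bi ^ Suc (s * q)"
  proof -
    have "q * Suc s = Suc (s * q) + (q - 1)" using q_pos unfolding mult_Suc_right mult.commute[of s q] by linarith
    then have "(Bi ^ q) ^ Suc s * B ^ (q - 1) = Bi ^ Suc (s * q) * (B * Bi) ^ (q - 1)"
      by (simp only: power_mult[symmetric] power_add power_mult_distrib mult_ac)
    then show ?thesis by (simp add: B_Bi)
  qed
  have "(?D oo ?\<eta>) * fps_deriv ?\<eta> * \<theta>bi ^ (s * q) =
     of_nat q * (((Bi ^ q) ^ Suc s * B ^ (q - 1)) * Qs (s * q) (B ^ q) * \<theta>bi ^ (s * q))"
    unfolding h1 h2 by (simp only: mult_ac)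
  then have "(?D oo ?\<eta>) * fps_deriv ?\<eta> * \<theta>bi ^ (s * q) = of_nat q * As (s * q)"
    unfolding As_def h3 .
  then have "?D $ (s * q - 1) = (of_nat q * As (s * q)) $ (s * q - 1)"
    using residue_change[OF \<theta>bi(2) k, of ?D] unfolding \<eta> by simp
  moreover have "(-1 :: qpoly fps) ^ (s * q) = 1" using q_even by simp
  ultimately show ?thesis unfolding C_def by (simp add: fps_mult_of_nat_nth)
qed

lemma ui_expand:
  defines "b \<equiv> ua * ui"
  shows "\<exists>R. ui ^ k = 1 - of_nat k * (fps_X ^ q * b) + fps_X ^ (2 * q) * R"
proof (induction k)
  case (Suc k)
  then obtain R where R: "ui ^ k = 1 - of_nat k * (fps_X ^ q * b) + fps_X ^ (2 * q) * R" by blast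
  have "u * ui = ui + fps_X ^ q * b" unfolding u_def b_def by (simp add: algebra_simps)
  then have ui1: "ui = 1 - fps_X ^ q * b" using ui(2) by (simp add: algebra_simps)
  have X2: "(fps_X :: qpoly fps fps) ^ (2 * q) = fps_X ^ q * fps_X ^ q"
    by (simp only: mult_2 power_add)
  have "ui ^ Suc k = (1 - fps_X ^ q * b) * (1 - of_nat k * (fps_X ^ q * b) + fps_X ^ (2 * q) * R)"
    unfolding R[symmetric] ui1[symmetric] by simp
  also have "\<dots> = 1 - of_nat (Suc k) * (fps_X ^ q * b) + fps_X ^ (2 * q) * (of_nat k * b ^ 2 + R - fps_X ^ q * b * R)"
    unfolding X2 by (simp add: algebra_simps power2_eq_square)
  finally show ?case by blast
qed (auto intro!: exI[of _ 0])

text \<open>The second correction in \<open>u\<close> has degree p^2 - 1 >= 2 q, so below x^(2 q)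
  only the term w x^q is felt, and only linearly.\<close>

lemma ui_nth:
  assumes "n < 2 * q"
  shows "(ui ^ k) $ n = (if n = 0 then 1 else if n = q then - (of_nat k * w) else 0)"
proof -
  define b where "b = ua * ui"
  have gen: "(ui ^ k) $ n = (if n = 0 then 1 else 0) - (if n < q then 0 else of_nat k * b $ (n - q))"
    if "n < 2 * q" for k n
  proof -
    obtain R where R: "ui ^ k = 1 - of_nat k * (fps_X ^ q * b) + fps_X ^ (2 * q) * R"
      using ui_expand[of k] unfolding b_def by blast
    show ?thesis unfolding R using that by (simp add: fps_X_power_mult_nth fps_mult_of_nat_nth)
  qed
  have ui_low: "ui $ n = (if n = 0 then 1 else 0)" if "n < q" for n
    using gen[of n 1] that by simp
  have ua_low: "ua $ n = (if n = 0 then w else 0)" if "n < q" for n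
  proof -
    have "p ^ 2 - p = q * p" by (simp add: power2_eq_square diff_mult_distrib)
    moreover have "q * 1 \<le> q * p" using p_pos by (intro mult_left_mono) auto
    ultimately have "n < p ^ 2 - p" using that by linarith
    then show ?thesis unfolding ua_def by (auto simp: fps_X_power_nth)
  qed
  have b: "b $ n = (if n = 0 then w else 0)" if "n < q" for n
  proof -
    have "b $ n = (\<Sum>j=0..n. if j = 0 then w * ui $ n else 0)"
      unfolding b_def fps_mult_nth using that by (intro sum.cong refl) (auto simp: ua_low)
    then show ?thesis using ui_low[OF that] by simp
  qed
  show ?thesis using gen[OF assms, of k] b[of "n - q"] assms q_pos by auto
qed

lemma xo_C: "xo 0 (C k)"
proof -
  have "xos 0 (As k)" unfolding As_def Qs_def
    by (intro XS.mult XS.power XS.sum XS.of_nat xos_bp bp_Bi bp_B \<theta>bi xos_l)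
  then show ?thesis unfolding C_def xos_def by (intro X0.mult X0.power X0.neg X0.one) blast
qed

text \<open>Summed over i, the residues carry the power sum of the r^k, which is negligible for 0 <
  k < q and close to q when q divides k. Undoing \<open>ui ^ k\<close> is harmless up to k = q; at k
  = 2 q its coefficient at x^q produces the correction with w.\<close>

lemma log_derivative:
  obtains \<Lambda> where "fps_deriv P = P * \<Lambda>" "xos 0 \<Lambda>"
    "\<And>k. 0 < k \<Longrightarrow> k < q \<Longrightarrow> xo (int NM) (\<Lambda> $ (k - 1))"
    "xo (int NM) (\<Lambda> $ (q - 1) - of_nat q * C q)"
    "xo (int NM) (\<Lambda> $ (2 * q - 1) - (of_nat q * C (2 * q) + of_nat (2 * q) * w * (of_nat q * C q)))"
proof -
  have "\<forall>i\<in>{1..<p}. \<exists>r. bp_series p r \<and> rho i * r = 1"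
    using rho_inverse by (metis atLeastLessThan_iff less_eq_Suc_le One_nat_def)
  then obtain r where r: "\<And>i. i \<in> {1..<p} \<Longrightarrow> bp_series p (r i)" "\<And>i. i \<in> {1..<p} \<Longrightarrow> rho i * r i = 1"
    by metis
  have "\<forall>i\<in>{1..<p}. \<exists>Zi. Zh i * Zi = 1 \<and> xos 0 Zi \<and>
     (\<forall>k>0. xo (int NM) ((fps_deriv (Zh i) * Zi * ui ^ k) $ (k - 1) - r i ^ k * C k))"
    using residue_of_log_derivative r by auto
  then obtain Zi where Zi: "\<And>i. i \<in> {1..<p} \<Longrightarrow> Zh i * Zi i = 1" "\<And>i. i \<in> {1..<p} \<Longrightarrow> xos 0 (Zi i)"
    "\<And>i k. i \<in> {1..<p} \<Longrightarrow> 0 < k \<Longrightarrow> xo (int NM) ((fps_deriv (Zh i) * Zi i * ui ^ k) $ (k - 1) - r i ^ k * C k)"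
    by metis
  define \<Lambda> where "\<Lambda> = (\<Sum>i=1..<p. fps_deriv (Zh i) * Zi i)"
  have dP: "fps_deriv P = P * \<Lambda>"
    unfolding P_def \<Lambda>_def by (rule fps_deriv_prod_log) (use Zi in auto)
  have \<Lambda>0: "xos 0 \<Lambda>" unfolding \<Lambda>_def
  proof (intro XS.sum XS.mult Zi)
    fix i
    show "xos 0 (fps_deriv (Zh i))"
      unfolding xos_def fps_deriv_nth
      using bp_Zh[of i] by (intro allI xo_bp bp_series.mult bp_series.of_nat) (auto simp: bp_series2_def)
  qed
  have F: "xo (int NM) ((\<Lambda> * ui ^ k) $ (k - 1) - (\<Sum>i=1..<p. r i ^ k) * C k)" if "k > 0" for k
    unfolding \<Lambda>_def sum_distrib_right fps_sum_nth sum_subtractf[symmetric]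
    using that by (intro xo_sum Zi(3))
  \<comment> \<open>As \<open>rho i ^ q\<close> is close to 1, r^k may be replaced by
    \<open>rho i ^ (q - k)\<close>, to which \<open>power_sum\<close> applies.\<close>
  have S0: "xo (int NM) (\<Sum>i=1..<p. r i ^ k)" if k: "0 < k" "k < q" for k
  proof -
    have "xo (int NN) ((\<Sum>i=1..<p. rho i ^ (q - k)) - (\<Sum>i=1..<p. r i ^ k))"
      unfolding sum_subtractf[symmetric]
    proof (rule xo_sum)
      fix i assume i: "i \<in> {1..<p}"
      have "q = (q - k) + k" using k by simp
      then have "rho i ^ q = rho i ^ (q - k) * rho i ^ k" by (metis power_add)
      then have "r i ^ k * (rho i ^ q - 1) = rho i ^ (q - k) * (rho i * r i) ^ k - r i ^ k"
        by (simp add: algebra_simps power_mult_distrib)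
      then have "rho i ^ (q - k) - r i ^ k = r i ^ k * (rho i ^ q - 1)" using r(2)[OF i] by simp
      then show "xo (int NN) (rho i ^ (q - k) - r i ^ k)"
        using rho_q[of i] i r(1)[OF i] by (simp only:) (intro xo_mult_bp bp_series.power, auto)
    qed
    moreover have "xo (int NN) (\<Sum>i=1..<p. rho i ^ (q - k))" using k by (intro power_sum) auto
    ultimately have "xo (int NN) (\<Sum>i=1..<p. r i ^ k)" using xo_diff by fastforce
    then show ?thesis by (rule xo_NM)
  qed
  have S1: "xo (int NM) ((\<Sum>i=1..<p. r i ^ (s * q)) - of_nat q)" for s
  proof -
    have "xo (int NN) ((\<Sum>i=1..<p. r i ^ (s * q)) - (\<Sum>i=1..<p. 1))"
      unfolding sum_subtractf[symmetric]
    proof (rule xo_sum)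
      fix i assume i: "i \<in> {1..<p}"
      have "r i ^ q * (rho i ^ q - 1) = (rho i * r i) ^ q - r i ^ q"
        by (simp add: algebra_simps power_mult_distrib)
      then have "1 - r i ^ q = r i ^ q * (rho i ^ q - 1)" using r(2)[OF i] by simp
      then have "xo (int NN) (1 - r i ^ q)"
        using rho_q[of i] i r(1)[OF i] by (simp only:) (intro xo_mult_bp bp_series.power, auto)
      then have "xo (int NN) ((r i ^ q) ^ s - 1 ^ s)"
        using r(1)[OF i] by (intro xo_diff_power xo_sym[of _ 1]) (auto intro: xo_bp bp_series.closed)
      then show "xo (int NN) (r i ^ (s * q) - 1)" by (simp add: mult.commute flip: power_mult)
    qed
    then show ?thesis by (intro xo_NM) (simp add: of_nat_diff)
  qed
  have low: "(\<Lambda> * ui ^ k) $ (k - 1) = \<Lambda> $ (k - 1)" if "0 < k" "k \<le> q" for k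
  proof -
    have "(\<Lambda> * ui ^ k) $ (k - 1) = (\<Sum>j=0..k-1. if j = k - 1 then \<Lambda> $ (k - 1) else 0)"
      unfolding fps_mult_nth using that by (intro sum.cong refl) (auto simp: ui_nth)
    then show ?thesis by simp
  qed
  have L1: "xo (int NM) (\<Lambda> $ (k - 1))" if k: "0 < k" "k < q" for k
  proof -
    have "xo (int NM) ((\<Sum>i=1..<p. r i ^ k) * C k)"
      using xo_mult0[OF xo_C S0[OF k]] by (simp add: mult.commute)
    moreover have "xo (int NM) (\<Lambda> $ (k - 1) - (\<Sum>i=1..<p. r i ^ k) * C k)" using F[of k] low[of k] k by simp
    ultimately show ?thesis using xo_add by fastforce
  qed
  have SC: "xo (int NM) ((\<Sum>i=1..<p. r i ^ (s * q)) * C (s * q) - of_nat q * C (s * q))" for s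
    using xo_mult0[OF xo_C S1[of s], of "s * q"] unfolding right_diff_distrib by (simp only: mult.commute)
  have L2: "xo (int NM) (\<Lambda> $ (q - 1) - of_nat q * C q)"
    using xo_trans[OF F[of "1 * q"] SC[of 1]] low[of q] q_pos by simp
  have hi: "(\<Lambda> * ui ^ (2 * q)) $ (2 * q - 1) = \<Lambda> $ (2 * q - 1) - of_nat (2 * q) * w * \<Lambda> $ (q - 1)"
  proof -
    have "(\<Lambda> * ui ^ (2 * q)) $ (2 * q - 1) = (\<Sum>j=0..2*q-1. (if j = 2 * q - 1 then \<Lambda> $ (2 * q - 1) else 0)
        + (if j = q - 1 then - (of_nat (2 * q) * w) * \<Lambda> $ (q - 1) else 0))"
      unfolding fps_mult_nth
    proof (intro sum.cong refl)
      fix j assume j: "j \<in> {0..2 * q - 1}"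
      then have "2 * q - 1 - j < 2 * q" using q_pos by simp
      note n = ui_nth[OF this, of "2 * q"]
      have "2 * q - 1 - j = 0 \<longleftrightarrow> j = 2 * q - 1" "2 * q - 1 - j = q \<longleftrightarrow> j = q - 1" "2 * q - 1 \<noteq> q - 1"
        using j q_pos by auto
      then show "\<Lambda> $ j * ui ^ (2 * q) $ (2 * q - 1 - j) = (if j = 2 * q - 1 then \<Lambda> $ (2 * q - 1) else 0)
        + (if j = q - 1 then - (of_nat (2 * q) * w) * \<Lambda> $ (q - 1) else 0)"
        unfolding n by (auto simp: mult.commute)
    qed
    also have "\<dots> = \<Lambda> $ (2 * q - 1) - of_nat (2 * q) * w * \<Lambda> $ (q - 1)"
      unfolding sum.distrib by (simp add: sum.delta)
    finally show ?thesis .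
  qed
  have L3: "xo (int NM) (\<Lambda> $ (2 * q - 1) - (of_nat q * C (2 * q) + of_nat (2 * q) * w * (of_nat q * C q)))"
  proof -
    have "xo (int NM) (\<Lambda> $ (2 * q - 1) - of_nat (2 * q) * w * \<Lambda> $ (q - 1) - of_nat q * C (2 * q))"
      using xo_trans[OF F[of "2 * q"] SC[of 2]] hi q_pos by simp
    moreover have "xo (int NM) (of_nat (2 * q) * w * (\<Lambda> $ (q - 1) - of_nat q * C q))"
      by (intro xo_mult0 L2 X0.mult X0.of_nat xo_0_L)
    ultimately have "xo (int NM) (\<Lambda> $ (2 * q - 1) - of_nat (2 * q) * w * \<Lambda> $ (q - 1) - of_nat q * C (2 * q)
       + of_nat (2 * q) * w * (\<Lambda> $ (q - 1) - of_nat q * C q))" by (rule xo_add)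
    then show ?thesis by (rule back_subst[of "xo (int NM)"]) (simp add: algebra_simps)
  qed
  show ?thesis by (rule that[OF dP \<Lambda>0 L1 L2 L3])
qed

section \<open>Coefficients of the product and the class for n = 2 q\<close>

lemma xo_P: "xo 0 (P $ k)"
  using bp_P unfolding bp_series2_def by (auto intro: xo_bp)

text \<open>Coefficientwise integration of P' = P \<Lambda>. The recursion divides by k < q and by
  q, which are prime to p; the factor 2 from 2 q stays on the left-hand side.\<close>

lemma P_coeffs:
  "\<And>k. 0 < k \<Longrightarrow> k < q \<Longrightarrow> xo (int NM) (P $ k)"
  "xo (int NM) (P $ q - P $ 0 * C q)"
  "xo (int NM) (2 * P $ (2 * q) - P $ 0 * (C (2 * q) + of_nat (2 * q) * w * C q + C q ^ 2))"
proof -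
  obtain \<Lambda> where dP: "fps_deriv P = P * \<Lambda>" and \<Lambda>0: "xos 0 \<Lambda>"
    and L1: "\<And>k. 0 < k \<Longrightarrow> k < q \<Longrightarrow> xo (int NM) (\<Lambda> $ (k - 1))"
    and L2: "xo (int NM) (\<Lambda> $ (q - 1) - of_nat q * C q)"
    and L3: "xo (int NM) (\<Lambda> $ (2 * q - 1) - (of_nat q * C (2 * q) + of_nat (2 * q) * w * (of_nat q * C q)))"
    using log_derivative by metis
  have rec: "of_nat k * P $ k = (\<Sum>j=0..k-1. P $ j * \<Lambda> $ (k - 1 - j))" if "k > 0" for k
    using arg_cong[OF dP, of "\<lambda>f. f $ (k - 1)"] that by (simp add: fps_mult_nth)
  have Lx: "xo 0 (\<Lambda> $ k)" for k using \<Lambda>0 by (simp add: xos_def)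
  have Ls: "xo (int NM) (\<Lambda> $ j)" if "j < q - 1" for j
    using L1[of "Suc j"] that by simp
  show P1: "xo (int NM) (P $ k)" if k: "0 < k" "k < q" for k
  proof -
    have "xo (int NM) (\<Sum>j=0..k-1. P $ j * \<Lambda> $ (k - 1 - j))"
      using k by (intro xo_sum xo_mult0[OF xo_P] Ls) auto
    then have "xo (int NM) (of_nat k * P $ k - of_nat k * 0)"
      by (simp only: rec[OF k(1)] mult_zero_right diff_zero)
    then have "xo (int NM) (P $ k - 0)"
      by (rule xo_cancel_nat[OF _ coprime_less k(1)]) (use k in simp_all)
    then show ?thesis by simp
  qed
  have cq: "coprime q p" using coprime_less[of q] q_pos p_pos by simp
  show P2: "xo (int NM) (P $ q - P $ 0 * C q)"
  proof -
    have "of_nat q * P $ q = P $ 0 * \<Lambda> $ (q - 1) + (\<Sum>j=1..q-1. P $ j * \<Lambda> $ (q - 1 - j))"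
      unfolding rec[OF q_pos] by (simp add: sum.atLeast_Suc_atMost)
    moreover have "xo (int NM) (\<Sum>j=1..q-1. P $ j * \<Lambda> $ (q - 1 - j))"
      by (intro xo_sum xo_mult0[OF xo_P] Ls) auto
    moreover have "xo (int NM) (P $ 0 * (\<Lambda> $ (q - 1) - of_nat q * C q))"
      by (intro xo_mult0[OF xo_P] L2)
    ultimately have "xo (int NM) (of_nat q * P $ q - of_nat q * (P $ 0 * C q))"
      by (simp only:) (drule (1) xo_add, simp add: algebra_simps)
    then show ?thesis using cq q_pos by (rule xo_cancel_nat)
  qed
  show "xo (int NM) (2 * P $ (2 * q) - P $ 0 * (C (2 * q) + of_nat (2 * q) * w * C q + C q ^ 2))"
  proof -
    let ?t = "\<lambda>j. P $ j * \<Lambda> $ (2 * q - 1 - j)"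
    have "of_nat (2 * q) * P $ (2 * q) = (\<Sum>j=0..2*q-1. ?t j)"
      using q_pos by (intro rec) simp
    also have "{0..2*q-1} = insert 0 (insert q ({1..<q} \<union> {q<..<2*q}))" using q_pos by auto
    also have "(\<Sum>j\<in>\<dots>. ?t j) = ?t 0 + (?t q + (\<Sum>j\<in>{1..<q} \<union> {q<..<2*q}. ?t j))"
      using q_pos by (subst sum.insert; simp)
    finally have e: "of_nat (2 * q) * P $ (2 * q) = P $ 0 * \<Lambda> $ (2 * q - 1) + P $ q * \<Lambda> $ (q - 1) + (\<Sum>j\<in>{1..<q} \<union> {q<..<2*q}. ?t j)"
    proof -
      assume "of_nat (2 * q) * P $ (2 * q) = ?t 0 + (?t q + (\<Sum>j\<in>{1..<q} \<union> {q<..<2*q}. ?t j))"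
      moreover have "2 * q - 1 - q = q - 1" by simp
      ultimately show ?thesis by (simp only: diff_zero add.assoc)
    qed
    have r: "xo (int NM) (\<Sum>j\<in>{1..<q} \<union> {q<..<2*q}. ?t j)"
    proof (rule xo_sum)
      fix j assume j: "j \<in> {1..<q} \<union> {q<..<2*q}"
      show "xo (int NM) (?t j)"
      proof (cases "j < q")
        case True
        then have "xo (int NM) (\<Lambda> $ (2 * q - 1 - j) * P $ j)" using j by (intro xo_mult0[OF Lx] P1) auto
        then show ?thesis by (simp add: mult.commute)
      next
        case False
        then show ?thesis using j by (intro xo_mult0[OF xo_P] Ls) auto
      qed
    qed
    have a: "xo (int NM) (P $ 0 * (\<Lambda> $ (2 * q - 1) - (of_nat q * C (2 * q) + of_nat (2 * q) * w * (of_nat q * C q))))"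
      by (intro xo_mult0[OF xo_P] L3)
    have b: "xo (int NM) (P $ q * \<Lambda> $ (q - 1) - (P $ 0 * C q) * (of_nat q * C q))"
      by (rule xo_cong_mult[OF P2 L2 X0.mult[OF xo_P xo_C] Lx])
    have "xo (int NM) (P $ 0 * (\<Lambda> $ (2 * q - 1) - (of_nat q * C (2 * q) + of_nat (2 * q) * w * (of_nat q * C q)))
       + (P $ q * \<Lambda> $ (q - 1) - (P $ 0 * C q) * (of_nat q * C q)) + (\<Sum>j\<in>{1..<q} \<union> {q<..<2*q}. ?t j))"
      by (intro xo_add a b r)
    also have "P $ 0 * (\<Lambda> $ (2 * q - 1) - (of_nat q * C (2 * q) + of_nat (2 * q) * w * (of_nat q * C q)))
       + (P $ q * \<Lambda> $ (q - 1) - (P $ 0 * C q) * (of_nat q * C q)) + (\<Sum>j\<in>{1..<q} \<union> {q<..<2*q}. ?t j)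
      = of_nat (2 * q) * P $ (2 * q) - P $ 0 * (of_nat q * C (2 * q) + of_nat (2 * q) * w * (of_nat q * C q))
         - (P $ 0 * C q) * (of_nat q * C q)"
      unfolding e by (simp only: right_diff_distrib) simp
    also have "\<dots> = of_nat q * (2 * P $ (2 * q)) - of_nat q * (P $ 0 * (C (2 * q) + of_nat (2 * q) * w * C q + C q ^ 2))"
    proof -
      have "of_nat (2 * q) = (2 * of_nat q :: qpoly fps)" by simp
      then show ?thesis by (simp only:) (simp only: power2_eq_square algebra_simps)
    qed
    finally show ?thesis using cq q_pos by (rule xo_cancel_nat)
  qed
qed

lemma fps_nth_0_prod: "(prod f S) $ 0 = (\<Prod>i\<in>S. f i $ 0)" for f :: "nat \<Rightarrow> qpoly fps fps"
  by (induction S rule: infinite_finite_induct) auto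

lemma P0_power: "xo (int NM) ((P $ 0) ^ (2 * q) - 1)"
proof -
  have "xo (int NN) ((\<Prod>i\<in>S. rho i ^ q) - 1)" if "finite S" "S \<subseteq> {1..<p}" for S
    using that
  proof (induction S rule: finite_induct)
    case (insert i S)
    have "xo (int NN) (rho i ^ q * (\<Prod>i\<in>S. rho i ^ q) - 1 * 1)"
      using insert rho_q[of i] by (intro xo_cong_mult X0.one xo_bp bp_series.prod bp_series.power bp_rho) auto
    then show ?case using insert by simp
  qed (simp add: xo_zero)
  from this[of "{1..<p}"] have "xo (int NN) ((P $ 0) ^ q - 1)"
    by (simp add: P_def Zh_0 fps_nth_0_prod prod_power_distrib del: One_nat_def)
  then have "xo (int NN) (((P $ 0) ^ q) ^ 2 - 1 ^ 2)"
    by (intro xo_diff_power X0.power xo_P X0.one)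
  then show ?thesis by (intro xo_NM) (simp add: mult.commute flip: power_mult)
qed

text \<open>To the precision P - P_0 starts with x^q, so its j-th power starts with x^(q j): only j
  = 1 reaches x^q, and only j = 1 and j = 2 reach x^(2 q).\<close>

lemma mcn_approx:
  "xo (int NM) (mcn n q - (- of_nat (n + 1) * (P $ 0) ^ (n - 1) * P $ q))"
  "xo (int NM) (mcn n (2 * q) - (- of_nat (n + 1) * (P $ 0) ^ (n - 1) * P $ (2 * q)
      + of_nat ((n + 2) choose 2) * (P $ 0) ^ (n - 2) * (P $ q) ^ 2))"
proof -
  define D where "D = P - fps_const (P $ 0)"
  define U where "U = fps_X ^ q * fps_shift q P"
  define cf where "cf j = (-1) ^ j * of_nat ((n + j) choose j) * (P $ 0) ^ (n - j)" for j
  have mcn: "mcn n k = (\<Sum>j\<le>k. cf j * (D ^ j) $ k)" for k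
    unfolding mcn_def D_def cf_def ..
  have cf0: "xo 0 (cf j)" for j unfolding cf_def
    by (intro X0.mult X0.power X0.neg X0.one X0.of_nat xo_P)
  have D0: "xos 0 D" unfolding D_def xos_def using xo_P by (auto intro: X0.diff xo_zero)
  have U0: "xos 0 U" unfolding U_def xos_def by (auto simp: fps_X_power_mult_nth intro: xo_P xo_zero)
  have "xos (int NM) (D - U)" unfolding xos_def
  proof
    fix k
    have "(D - U) $ k = (if 0 < k \<and> k < q then P $ k else 0)"
      using q_pos by (auto simp: D_def U_def fps_X_power_mult_nth)
    then show "xo (int NM) ((D - U) $ k)" using P_coeffs(1)[of k] by (auto intro: xo_zero)
  qed
  then have DU: "xos (int NM) (D ^ j - U ^ j)" for j by (intro xos_diff_power D0 U0)
  have ap: "xo (int NM) (mcn n k - (\<Sum>j\<le>k. cf j * (U ^ j) $ k))" for k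
  proof -
    have "mcn n k - (\<Sum>j\<le>k. cf j * (U ^ j) $ k) = (\<Sum>j\<le>k. cf j * ((D ^ j - U ^ j) $ k))"
      unfolding mcn sum_subtractf[symmetric] by (simp only: right_diff_distrib fps_sub_nth)
    then show ?thesis using DU unfolding xos_def by (simp only:) (intro xo_sum xo_mult0[OF cf0], blast)
  qed
  have Uj: "(U ^ j) $ k = (if k < q * j then 0 else (fps_shift q P ^ j) $ (k - q * j))" for j k
    unfolding U_def power_mult_distrib power_mult[symmetric] fps_X_power_mult_nth ..
  have "(\<Sum>j\<le>q. cf j * (U ^ j) $ q) = (\<Sum>j\<le>q. if j = 1 then cf 1 * P $ q else 0)"
  proof (intro sum.cong refl)
    fix j :: nat
    consider "j = 0" | "j = 1" | "j \<ge> 2" by linarith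
    then show "cf j * (U ^ j) $ q = (if j = 1 then cf 1 * P $ q else 0)"
    proof cases
      case 2
      have "(U ^ j) $ q = P $ q" unfolding Uj 2 by simp
      then show ?thesis using 2 by simp
    next
      case 3
      then have "q * 2 \<le> q * j" by (rule mult_le_mono2)
      then have "q < q * j" using q_pos by linarith
      then show ?thesis using 3 by (simp add: Uj)
    qed (use q_pos in \<open>auto simp: Uj\<close>)
  qed
  also have "\<dots> = cf 1 * P $ q" using q_pos by (simp add: sum.delta)
  finally show "xo (int NM) (mcn n q - (- of_nat (n + 1) * (P $ 0) ^ (n - 1) * P $ q))"
    using ap[of q] by (simp add: cf_def)
  have "(\<Sum>j\<le>2*q. cf j * (U ^ j) $ (2*q)) = (\<Sum>j\<le>2*q. (if j = 1 then cf 1 * P $ (2*q) else 0) + (if j = 2 then cf 2 * (P $ q) ^ 2 else 0))"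
  proof (intro sum.cong refl)
    fix j :: nat
    consider "j = 0" | "j = 1" | "j = 2" | "j \<ge> 3" by linarith
    then show "cf j * (U ^ j) $ (2*q) = (if j = 1 then cf 1 * P $ (2*q) else 0) + (if j = 2 then cf 2 * (P $ q) ^ 2 else 0)"
    proof cases
      case 2
      have "(U ^ j) $ (2 * q) = P $ (2 * q)" unfolding Uj 2 by (simp add: mult_2)
      then show ?thesis using 2 by simp
    next
      case 3
      have "(U ^ j) $ (2 * q) = (P $ q) ^ 2" unfolding Uj 3 by (simp add: fps_power_zeroth mult.commute)
      then show ?thesis using 3 by simp
    next
      case 4
      then have "q * 3 \<le> q * j" by (rule mult_le_mono2)
      then have "2 * q < q * j" using q_pos by linarith
      then show ?thesis using 4 by (simp add: Uj)
    qed (use q_pos in \<open>auto simp: Uj\<close>)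
  qed
  also have "\<dots> = cf 1 * P $ (2*q) + cf 2 * (P $ q) ^ 2" using q_pos unfolding sum.distrib by (simp add: sum.delta)
  finally show "xo (int NM) (mcn n (2 * q) - (- of_nat (n + 1) * (P $ 0) ^ (n - 1) * P $ (2 * q)
      + of_nat ((n + 2) choose 2) * (P $ 0) ^ (n - 2) * (P $ q) ^ 2))"
    using ap[of "2*q"] by (simp add: cf_def)
qed

text \<open>c_j is nonzero only if j + 1 is a power of p. With j <= 2 q and p^2 > 2 q + 1 this
  leaves c_0 = 1 and c_q = v_1, and v_1 xi^q is p w.\<close>

lemma MC_eq: "MC p (2 * q) = fps_X ^ (q * (2 * q) - 2 * q) * (mcn (2 * q) (2 * q) + of_nat p * w * mcn (2 * q) q)"
proof -
  let ?n = "2 * q"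
  have "MC p ?n = (\<Sum>k\<in>{q, ?n}. fps_const (cc p (?n - k)) * mc_coeff p ?n k)"
    unfolding MC_def
  proof (rule sum.mono_neutral_right)
    show "\<forall>k\<in>{..?n} - {q, ?n}. fps_const (cc p (?n - k)) * mc_coeff p ?n k = 0"
    proof
      fix k assume k: "k \<in> {..?n} - {q, ?n}"
      have "Suc (?n - k) \<notin> range (\<lambda>e. p ^ e)"
      proof
        assume "Suc (?n - k) \<in> range (\<lambda>e. p ^ e)"
        then obtain e where e: "Suc (?n - k) = p ^ e" by auto
        have "e \<noteq> 0" using e k by (intro notI) auto
        moreover have "e \<noteq> 1" using e k by (intro notI) auto
        ultimately have "p ^ 2 \<le> p ^ e" using p_pos by (intro power_increasing) auto
        moreover have "p * 2 \<le> p ^ 2" unfolding power2_eq_square using p2 by (rule mult_le_mono2)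
        ultimately show False using e p2 by linarith
      qed
      then show "fps_const (cc p (?n - k)) * mc_coeff p ?n k = 0" by (simp add: cc_other)
    qed
  qed (use q_pos in auto)
  also have "\<dots> = mc_coeff p ?n ?n + fps_const (v 1) * mc_coeff p ?n q"
  proof -
    have "cc p (?n - q) = v 1" using cc_power[of 1] ell_1 by simp
    moreover have "cc p (?n - ?n) = 1" using cc_power[of 0] by simp
    moreover have "q \<noteq> ?n" using q_pos by simp
    ultimately show ?thesis by simp
  qed
  finally have MC: "MC p ?n = mc_coeff p ?n ?n + fps_const (v 1) * mc_coeff p ?n q" .
  have v1: "fps_const (v 1) * fps_X ^ q = of_nat p * w"
  proof -
    have "of_nat p * w = fps_const (of_nat p * ell p 1) * fps_X ^ q"
      unfolding L_def by (simp add: fps_of_nat[symmetric] mult.assoc del: fps_of_nat flip: fps_const_mult)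
    then show ?thesis by (simp only: ell_1)
  qed
  have X2: "(fps_X :: qpoly fps) ^ ?n = fps_X ^ q * fps_X ^ q" by (simp only: mult_2 power_add)
  have "fps_X ^ ?n * MC p ?n = fps_X ^ ?n * mc_coeff p ?n ?n + (fps_const (v 1) * fps_X ^ q) * (fps_X ^ q * mc_coeff p ?n q)"
    unfolding MC distrib_left X2 by (simp only: mult_ac)
  also have "\<dots> = fps_X ^ (q * ?n) * (mcn ?n ?n + of_nat p * w * mcn ?n q)"
  proof -
    have a: "fps_X ^ ?n * mc_coeff p ?n ?n = fps_X ^ (q * ?n) * mcn ?n ?n" by (rule mc_coeff_mcn) simp
    have b: "fps_X ^ q * mc_coeff p ?n q = fps_X ^ (q * ?n) * mcn ?n q" by (rule mc_coeff_mcn) simp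
    show ?thesis unfolding a b v1 distrib_left by (simp only: mult_ac)
  qed
  also have "fps_X ^ (q * ?n) = fps_X ^ ?n * (fps_X ^ (q * ?n - ?n) :: qpoly fps)"
  proof -
    have "1 * ?n \<le> q * ?n" using q_pos by (intro mult_le_mono1) simp
    then have "q * ?n = ?n + (q * ?n - ?n)" by linarith
    then show ?thesis by (metis power_add)
  qed
  finally have "fps_X ^ ?n * MC p ?n = fps_X ^ ?n * (fps_X ^ (q * ?n - ?n) * (mcn ?n ?n + of_nat p * w * mcn ?n q))"
    by (simp only: mult.assoc)
  then show ?thesis by (subst (asm) mult_left_cancel) auto
qed

text \<open>By homogeneity P_0 survives only in its 2 q-th power, which is 1 to the precision.
  Doubling clears the halves in P_(2 q) and in the binomial coefficient.\<close>

theorem MC_main: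
  defines "a \<equiv> of_nat (2 * q + 1)"
  shows "xo (int (q * (2 * q) - 2 * q) + int NM)
     (2 * MC p (2 * q) - fps_X ^ (q * (2 * q) - 2 * q) * (a * (a * C q ^ 2 - C (2 * q) - 2 * a * w * C q)))"
proof -
  let ?n = "2 * q"
  let ?c1 = "C q" and ?c2 = "C (2 * q)"
  define x where "x = P $ 0"
  have x0: "xo 0 x" unfolding x_def by (rule xo_P)
  have n: "?n = Suc (?n - 1)" "?n = Suc (Suc (?n - 2))" using q_pos by auto
  have xn: "x ^ ?n = x ^ (?n - 1) * x" "x ^ ?n = x ^ (?n - 2) * x ^ 2"
    by (subst n(1), simp add: mult.commute) (subst n(2), simp add: power2_eq_square mult_ac)
  have a1: "(of_nat (?n + 1) :: qpoly fps) = a" by (simp add: a_def)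
  have m1: "xo (int NM) (mcn ?n q - (- a * x ^ ?n * ?c1))"
  proof -
    have "xo (int NM) (- a * x ^ (?n - 1) * (P $ q - x * ?c1))"
      unfolding x_def a_def by (intro xo_mult0 P_coeffs X0.mult X0.neg X0.of_nat X0.power xo_P)
    from xo_add[OF mcn_approx(1)[of ?n] this] show ?thesis
      unfolding a1 x_def[symmetric] xn(1) by (rule back_subst[of "xo (int NM)"]) (simp add: algebra_simps)
  qed
  have ch: "2 * of_nat ((?n + 2) choose 2) = (of_nat (?n + 2) * a :: qpoly fps)"
  proof -
    have "2 * ((?n + 2) choose 2) = (?n + 2) * (?n + 1)"
      by (simp add: choose_two)
    then show ?thesis unfolding a_def by (metis of_nat_mult of_nat_numeral)
  qed
  have m2: "xo (int NM) (2 * mcn ?n ?n - (- a * x ^ ?n * (?c2 + of_nat (2 * q) * w * ?c1 + ?c1 ^ 2) + of_nat (?n + 2) * a * x ^ ?n * ?c1 ^ 2))"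
  proof -
    have e1: "xo (int NM) (- a * x ^ (?n - 1) * (2 * P $ (2 * q) - x * (?c2 + of_nat (2 * q) * w * ?c1 + ?c1 ^ 2)))"
      unfolding x_def a_def by (intro xo_mult0 P_coeffs X0.mult X0.neg X0.of_nat X0.power xo_P)
    have "xo (int NM) ((P $ q) ^ 2 - (x * ?c1) ^ 2)"
      unfolding x_def by (intro xo_diff_power P_coeffs xo_P X0.mult xo_C)
    then have e2: "xo (int NM) (of_nat (?n + 2) * a * x ^ (?n - 2) * ((P $ q) ^ 2 - (x * ?c1) ^ 2))"
      unfolding a_def by (intro xo_mult0 X0.mult X0.of_nat X0.power x0)
    have e3: "xo (int NM) (2 * (mcn ?n ?n - (- a * x ^ (?n - 1) * P $ (2 * q) + of_nat ((?n + 2) choose 2) * x ^ (?n - 2) * (P $ q) ^ 2)))"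
      using mcn_approx(2)[of ?n] unfolding a1 x_def[symmetric] by (intro xo_mult0 X0.numeral)
    have "xo (int NM) (2 * (mcn ?n ?n - (- a * x ^ (?n - 1) * P $ (2 * q) + of_nat ((?n + 2) choose 2) * x ^ (?n - 2) * (P $ q) ^ 2))
        + - a * x ^ (?n - 1) * (2 * P $ (2 * q) - x * (?c2 + of_nat (2 * q) * w * ?c1 + ?c1 ^ 2))
        + of_nat (?n + 2) * a * x ^ (?n - 2) * ((P $ q) ^ 2 - (x * ?c1) ^ 2))"
      by (intro xo_add e1 e2 e3)
    also have "2 * (mcn ?n ?n - (- a * x ^ (?n - 1) * P $ (2 * q) + of_nat ((?n + 2) choose 2) * x ^ (?n - 2) * (P $ q) ^ 2))
        + - a * x ^ (?n - 1) * (2 * P $ (2 * q) - x * (?c2 + of_nat (2 * q) * w * ?c1 + ?c1 ^ 2))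
        + of_nat (?n + 2) * a * x ^ (?n - 2) * ((P $ q) ^ 2 - (x * ?c1) ^ 2)
       = 2 * mcn ?n ?n - (2 * of_nat ((?n + 2) choose 2) - of_nat (?n + 2) * a) * x ^ (?n - 2) * (P $ q) ^ 2
         - (- a * (x ^ (?n - 1) * x) * (?c2 + of_nat (2 * q) * w * ?c1 + ?c1 ^ 2) + of_nat (?n + 2) * a * (x ^ (?n - 2) * x ^ 2) * ?c1 ^ 2)"
      unfolding power_mult_distrib by (simp only: algebra_simps)
    finally show ?thesis unfolding ch xn[symmetric] by simp
  qed
  define t where "t = a * (a * ?c1 ^ 2 - ?c2 - 2 * a * w * ?c1)"
  have t0: "xo 0 t" unfolding t_def a_def
    by (intro X0.mult X0.diff X0.of_nat X0.power X0.numeral xo_C xo_0_L)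
  have "xo (int NM) (2 * mcn ?n ?n - (- a * x ^ ?n * (?c2 + of_nat (2 * q) * w * ?c1 + ?c1 ^ 2) + of_nat (?n + 2) * a * x ^ ?n * ?c1 ^ 2)
      + 2 * of_nat p * w * (mcn ?n q - (- a * x ^ ?n * ?c1)))"
    by (intro xo_add m2 xo_mult0 m1 X0.mult X0.numeral X0.of_nat xo_0_L)
  also have "2 * mcn ?n ?n - (- a * x ^ ?n * (?c2 + of_nat (2 * q) * w * ?c1 + ?c1 ^ 2) + of_nat (?n + 2) * a * x ^ ?n * ?c1 ^ 2)
      + 2 * of_nat p * w * (mcn ?n q - (- a * x ^ ?n * ?c1))
     = 2 * (mcn ?n ?n + of_nat p * w * mcn ?n q) - x ^ ?n * t"
  proof -
    \<comment> \<open>With a = 2 q + 1 = 2 p - 1 all multiplicities become polynomials in a, and the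
      bracket collapses.\<close>
    have h: "of_nat (2 * q) = a - 1" "of_nat (?n + 2) = a + 1" "2 * of_nat p = a + 1"
      unfolding a_def using p_pos by (simp_all add: of_nat_diff)
    have "2 * mcn ?n ?n - (- a * x ^ ?n * (?c2 + (a - 1) * w * ?c1 + ?c1 ^ 2) + (a + 1) * a * x ^ ?n * ?c1 ^ 2)
      + (a + 1) * w * (mcn ?n q - (- a * x ^ ?n * ?c1)) = 2 * mcn ?n ?n + (a + 1) * w * mcn ?n q - x ^ ?n * t"
      unfolding t_def by (simp add: algebra_simps power2_eq_square)
    then show ?thesis unfolding h(1,2) h(3) distrib_left mult.assoc[symmetric] h(3) .
  qed
  finally have "xo (int NM) (2 * (mcn ?n ?n + of_nat p * w * mcn ?n q) - x ^ ?n * t)" .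
  moreover have "xo (int NM) (x ^ ?n * t - t)"
  proof -
    have "x ^ ?n * t - t = t * (x ^ ?n - 1)" by (simp add: algebra_simps)
    then show ?thesis unfolding x_def by (simp only:) (intro xo_mult0 P0_power t0)
  qed
  ultimately have "xo (int NM) (2 * (mcn ?n ?n + of_nat p * w * mcn ?n q) - t)" by (rule xo_trans)
  from xo_mult[OF xo_X this, of "q * ?n - ?n"]
  show ?thesis unfolding MC_eq t_def by (rule back_subst[of "xo _"]) (simp add: algebra_simps)
qed

section \<open>Evaluation of the binomial sums\<close>

lemma B_power_nth: "(B ^ n) $ k = of_nat (n choose k)"
proof (induction n arbitrary: k)
  case (Suc n)
  show ?case
  proof (cases k)
    case (Suc k')
    have "(B ^ Suc n) $ k = (B ^ n) $ Suc k' + (B ^ n) $ k'"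
      using Suc by (simp add: B_def distrib_right)
    then show ?thesis unfolding Suc.IH by (simp add: Suc add.commute)
  qed (simp add: B_def fps_power_zeroth)
qed auto

lemma Bi_nth: "Bi $ n = (-1) ^ n"
  by (simp add: Bi_def)

lemma B_mult_nth: "(B * f) $ Suc n = f $ Suc n + f $ n"
  by (simp add: B_def distrib_right)

lemma Bi_cancel: "B * f = g \<Longrightarrow> f = Bi * g"
proof -
  assume "B * f = g"
  then have "Bi * g = (B * Bi) * f" by (auto simp: mult_ac)
  then show ?thesis by (simp add: B_Bi)
qed

lemma Bi2_nth: "(Bi ^ 2) $ n = (-1) ^ n * of_nat (n + 1)"
proof -
  have "Abs_fps (\<lambda>n. (-1) ^ n * of_nat (n + 1)) = Bi * Bi"
  proof (rule Bi_cancel, rule fps_ext)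
    fix n
    show "(B * Abs_fps (\<lambda>n. (-1) ^ n * of_nat (n + 1))) $ n = Bi $ n"
      by (cases n) (simp_all add: B_mult_nth Bi_nth algebra_simps, simp add: B_def)
  qed
  from arg_cong[OF this, of "\<lambda>f. f $ n"] show ?thesis by (simp add: power2_eq_square)
qed

lemma Bi3_nth: "(Bi ^ 3) $ n = (-1) ^ n * of_nat ((n + 2) choose 2)"
proof -
  have "Abs_fps (\<lambda>n. (-1) ^ n * of_nat ((n + 2) choose 2)) = Bi * Bi ^ 2"
  proof (rule Bi_cancel, rule fps_ext)
    fix n
    show "(B * Abs_fps (\<lambda>n. (-1) ^ n * of_nat ((n + 2) choose 2))) $ n = (Bi ^ 2) $ n"
    proof (cases n)
      case 0
      then show ?thesis by (simp add: B_def fps_power_zeroth Bi_nth numeral_2_eq_2)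
    next
      case (Suc m)
      have "(Suc m + 2) choose 2 = ((m + 2) choose 2) + (m + 2)"
        by (simp add: numeral_2_eq_2)
      then show ?thesis unfolding Suc B_mult_nth Bi2_nth by (simp add: algebra_simps)
    qed
  qed
  then have "Abs_fps (\<lambda>n. (-1) ^ n * of_nat ((n + 2) choose 2)) = Bi ^ 3"
    by (simp add: power3_eq_cube power2_eq_square mult.assoc)
  from arg_cong[OF this, of "\<lambda>f. f $ n"] show ?thesis by simp
qed

definition S :: "qpoly fps fps" where "S = (\<Sum>j=1..p. B ^ j)"

lemma X_S: "fps_X * S = B * (B ^ p - 1)"
proof -
  have "fps_X = B - 1" by (simp add: B_def)
  then have "fps_X * S = - ((1 - B) * S)" by (simp only: minus_diff_eq flip: mult_minus_left)
  also have "\<dots> = B * (B ^ p - 1)" unfolding S_def geom by (simp add: algebra_simps)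
  finally show ?thesis .
qed

text \<open>Since X S = B (B^p - 1), a power of the geometric sum becomes a binomial expression at
  the cost of moving the index by m.\<close>

lemma S_shift: "(Bi ^ s * S ^ m) $ n = (Bi ^ s * (B ^ m * (B ^ p - 1) ^ m)) $ (n + m)"
proof -
  have "Bi ^ s * (B ^ m * (B ^ p - 1) ^ m) = Bi ^ s * (fps_X * S) ^ m"
    unfolding X_S power_mult_distrib ..
  also have "\<dots> = fps_X ^ m * (Bi ^ s * S ^ m)" by (simp only: power_mult_distrib mult_ac)
  finally have e: "Bi ^ s * (B ^ m * (B ^ p - 1) ^ m) = fps_X ^ m * (Bi ^ s * S ^ m)" .
  show ?thesis unfolding e fps_X_power_mult_nth by simp
qed

lemma Bi_B: "Bi ^ (s + m) * (B ^ m * f) = Bi ^ s * f"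
proof -
  have "Bi ^ (s + m) * (B ^ m * f) = (B * Bi) ^ m * (Bi ^ s * f)"
    by (simp only: power_add power_mult_distrib mult_ac)
  then show ?thesis by (simp add: B_Bi)
qed

lemma numeral_mult_nth: "(numeral k * f) $ n = numeral k * f $ n" for f :: "qpoly fps fps"
  by (simp add: fps_numeral_fps_const)

text \<open>The binomial sums that arise as coefficients of powers of \<open>S\<close>.\<close>
definition mu2 :: int where "mu2 = int ((2 * p) choose p) - 2"
definition mu3 :: int where "mu3 = int ((3 * p + 1) choose (p + 1)) - 3 * int ((2 * p + 1) choose (p + 1)) + 3"
definition nu3 :: int where "nu3 = int ((3 * p) choose (2 * p)) - 3"
definition nu4 :: int where
  "nu4 = int ((4 * p + 1) choose (2 * p + 1)) - 4 * int ((3 * p + 1) choose (2 * p + 1)) + 6"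

lemma Bp_powers:
  "(B ^ p - 1) ^ 2 = B ^ (2 * p) - 2 * B ^ p + 1"
  "(B ^ p - 1) ^ 3 = B ^ (3 * p) - 3 * B ^ (2 * p) + 3 * B ^ p - 1"
  "(B ^ p - 1) ^ 4 = B ^ (4 * p) - 4 * B ^ (3 * p) + 6 * B ^ (2 * p) - 4 * B ^ p + 1"
proof -
  define b where "b = B ^ p"
  have b: "B ^ (2 * p) = b ^ 2" "B ^ (3 * p) = b ^ 3" "B ^ (4 * p) = b ^ 4"
    unfolding b_def by (simp_all add: mult.commute flip: power_mult)
  show "(B ^ p - 1) ^ 2 = B ^ (2 * p) - 2 * B ^ p + 1"
    "(B ^ p - 1) ^ 3 = B ^ (3 * p) - 3 * B ^ (2 * p) + 3 * B ^ p - 1"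
    "(B ^ p - 1) ^ 4 = B ^ (4 * p) - 4 * B ^ (3 * p) + 6 * B ^ (2 * p) - 4 * B ^ p + 1"
    unfolding b b_def[symmetric] by (simp_all add: eval_nat_numeral algebra_simps)
qed

text \<open>The zero at S^1 here and the zero at S^2 in \<open>nu_values\<close> are what removes
  the linear and the quadratic term in l from the final bracket.\<close>

lemma mu_values:
  "(Bi ^ 2 * S ^ 0) $ (q - 1) = - of_nat q"
  "(Bi ^ 2 * S ^ 1) $ (q - 1) = 0"
  "(Bi ^ 2 * S ^ 2) $ (q - 1) = of_int mu2"
  "(Bi ^ 2 * S ^ 3) $ (q - 1) = of_int mu3"
proof -
  have oq: "odd (q - 1)" using q_even q_pos by simp
  have qs: "q - 1 + 1 = q" "q - 1 + 2 = p" "q - 1 + 3 = p + 1" using p2 by auto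
  show "(Bi ^ 2 * S ^ 0) $ (q - 1) = - of_nat q"
    using oq q_pos by (simp add: Bi2_nth of_nat_diff del: One_nat_def)
  have "Bi ^ 2 * (B ^ 1 * (B ^ p - 1) ^ 1) = Bi ^ 1 * (B ^ p - 1)"
    using Bi_B[of 1 1 "B ^ p - 1"] by (simp add: numeral_2_eq_2)
  also have "\<dots> = B ^ q - Bi"
  proof -
    have "B ^ p = B ^ 1 * B ^ q" by (subst pSuc) (simp only: power_Suc power_one_right)
    then show ?thesis using Bi_B[of 0 1 "B ^ q"] by (simp add: right_diff_distrib)
  qed
  finally show "(Bi ^ 2 * S ^ 1) $ (q - 1) = 0"
    unfolding S_shift qs using q_even by (simp add: B_power_nth Bi_nth)
  have "Bi ^ 2 * (B ^ 2 * (B ^ p - 1) ^ 2) = (B ^ p - 1) ^ 2"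
    using Bi_B[of 0 2 "(B ^ p - 1) ^ 2"] by (simp only: add_0 power_0 mult_1)
  then show "(Bi ^ 2 * S ^ 2) $ (q - 1) = of_int mu2"
    unfolding S_shift qs using p_pos
    by (simp only: Bp_powers) (simp add: B_power_nth mu2_def fps_numeral_fps_const)
  have "Bi ^ 2 * (B ^ 3 * (B ^ p - 1) ^ 3) = B * (B ^ p - 1) ^ 3"
    using Bi_B[of 0 2 "B * (B ^ p - 1) ^ 3"] by (simp add: eval_nat_numeral mult_ac)
  also have "\<dots> = B ^ (3 * p + 1) - 3 * B ^ (2 * p + 1) + 3 * B ^ (p + 1) - B ^ 1"
    unfolding Bp_powers by (simp add: algebra_simps)
  finally have e: "Bi ^ 2 * (B ^ 3 * (B ^ p - 1) ^ 3) = \<dots>" .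
  have "1 choose (p + 1) = 0" using p_pos by (intro binomial_eq_0) simp
  then show "(Bi ^ 2 * S ^ 3) $ (q - 1) = of_int mu3"
    unfolding S_shift qs e fps_add_nth fps_sub_nth numeral_mult_nth B_power_nth mu3_def by simp
qed

lemma nu_values:
  "(Bi ^ 3 * S ^ 0) $ (2 * q - 1) = - (of_nat (2 * q + 1) * of_nat q)"
  "(Bi ^ 3 * S ^ 1) $ (2 * q - 1) = - of_nat (2 * q + 1)"
  "(Bi ^ 3 * S ^ 2) $ (2 * q - 1) = 0"
  "(Bi ^ 3 * S ^ 3) $ (2 * q - 1) = of_int nu3"
  "(Bi ^ 3 * S ^ 4) $ (2 * q - 1) = of_int nu4"
proof -
  have oq: "odd (2 * q - 1)" using q_pos by simp
  have qs: "2 * q - 1 + 1 = 2 * q" "2 * q - 1 + 2 = 2 * p - 1" "2 * q - 1 + 3 = 2 * p" "2 * q - 1 + 4 = 2 * p + 1"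
    using p2 by auto
  have "(2 * q - 1 + 2) choose 2 = (2 * q + 1) * q"
  proof -
    have "2 * q - 1 + 2 = 2 * q + 1" using q_pos by simp
    then show ?thesis by (simp add: choose_two)
  qed
  then show "(Bi ^ 3 * S ^ 0) $ (2 * q - 1) = - (of_nat (2 * q + 1) * of_nat q)"
    using oq by (simp add: Bi3_nth del: One_nat_def)
  have pq: "B ^ p = B ^ 2 * B ^ (p - 2)" "B ^ p = B ^ 1 * B ^ q" "B ^ (2 * p) = B ^ 1 * B ^ (2 * p - 1)"
  proof -
    have "p = 2 + (p - 2)" "p = 1 + q" "2 * p = 1 + (2 * p - 1)" using p2 by auto
    then show "B ^ p = B ^ 2 * B ^ (p - 2)" "B ^ p = B ^ 1 * B ^ q" "B ^ (2 * p) = B ^ 1 * B ^ (2 * p - 1)"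
      using power_add[of B 2 "p - 2"] power_add[of B 1 q] power_add[of B 1 "2 * p - 1"] by simp_all
  qed
  have "Bi ^ 3 * (B ^ 1 * (B ^ p - 1) ^ 1) = Bi ^ 2 * (B ^ p - 1)"
    using Bi_B[of 2 1 "B ^ p - 1"] by simp
  also have "\<dots> = B ^ (p - 2) - Bi ^ 2"
    unfolding right_diff_distrib pq(1) using Bi_B[of 0 2 "B ^ (p - 2)"]
    by (simp only: add_0 power_0 mult_1 mult_1_right)
  finally show "(Bi ^ 3 * S ^ 1) $ (2 * q - 1) = - of_nat (2 * q + 1)"
    unfolding S_shift qs using p2 by (simp add: B_power_nth Bi2_nth binomial_eq_0)
  have "Bi ^ 3 * (B ^ 2 * (B ^ p - 1) ^ 2) = Bi ^ 1 * (B ^ p - 1) ^ 2"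
    using Bi_B[of 1 2 "(B ^ p - 1) ^ 2"] by (simp add: numeral_3_eq_3)
  also have "\<dots> = Bi ^ (0 + 1) * (B ^ 1 * B ^ (2 * p - 1)) - 2 * (Bi ^ (0 + 1) * (B ^ 1 * B ^ q)) + Bi"
    unfolding Bp_powers pq(2)[symmetric] pq(3)[symmetric] by (simp add: algebra_simps)
  also have "\<dots> = B ^ (2 * p - 1) - 2 * B ^ q + Bi"
    unfolding Bi_B by simp
  finally show "(Bi ^ 3 * S ^ 2) $ (2 * q - 1) = 0"
    unfolding S_shift qs
    by (simp only:) (use p2 in \<open>simp add: B_power_nth Bi_nth fps_numeral_fps_const binomial_eq_0\<close>)
  have "Bi ^ 3 * (B ^ 3 * (B ^ p - 1) ^ 3) = (B ^ p - 1) ^ 3"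
    using Bi_B[of 0 3 "(B ^ p - 1) ^ 3"] by (simp only: add_0 power_0 mult_1)
  then show "(Bi ^ 3 * S ^ 3) $ (2 * q - 1) = of_int nu3"
    unfolding S_shift qs
    by (simp only: Bp_powers) (use p2 in \<open>simp add: B_power_nth nu3_def fps_numeral_fps_const binomial_eq_0\<close>)
  have "Bi ^ 3 * (B ^ 4 * (B ^ p - 1) ^ 4) = B * (B ^ p - 1) ^ 4"
    using Bi_B[of 0 3 "B * (B ^ p - 1) ^ 4"] by (simp add: eval_nat_numeral mult_ac)
  also have "\<dots> = B ^ (4 * p + 1) - 4 * B ^ (3 * p + 1) + 6 * B ^ (2 * p + 1) - 4 * B ^ (p + 1) + B ^ 1"
    unfolding Bp_powers by (simp add: algebra_simps)
  finally have e: "Bi ^ 3 * (B ^ 4 * (B ^ p - 1) ^ 4) = \<dots>" .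
  have z: "1 choose (2 * p + 1) = 0" "(p + 1) choose (2 * p + 1) = 0"
    using p_pos by (auto intro!: binomial_eq_0 simp del: binomial_Suc_Suc)
  show "(Bi ^ 3 * S ^ 4) $ (2 * q - 1) = of_int nu4"
    unfolding S_shift qs e fps_add_nth fps_sub_nth numeral_mult_nth B_power_nth nu4_def z
    by (simp del: binomial_Suc_Suc)
qed

text \<open>\<open>c2\<close>, \<open>c3\<close> are the coefficients of l^2, l^3 in q
  \<open>C q\<close>, and \<open>d3\<close>, \<open>d4\<close> those of l^3, l^4 in q
  \<open>C (2 * q)\<close>.\<close>

definition c2 :: int where "c2 = int (ncoef q 2) * mu2"
definition c3 :: int where "c3 = int (ncoef q 3) * mu3"
definition d3 :: int where "d3 = int (ncoef (2 * q) 3) * nu3"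
definition d4 :: int where "d4 = int (ncoef (2 * q) 4) * nu4"

lemma sum_atMost_4: "(\<Sum>m\<le>4. f m) = f 0 + f 1 + f 2 + f 3 + (f 4 :: qpoly fps)" for f :: "nat \<Rightarrow> qpoly fps"
  by (simp add: eval_nat_numeral)

lemma Qs_coeff: "(Bi ^ s * Qs k B) $ n = (\<Sum>m\<le>4. of_nat (ncoef k m) * l ^ m * (Bi ^ s * S ^ m) $ n)"
proof -
  have "Bi ^ s * Qs k B = (\<Sum>m\<le>4. fps_const (of_nat (ncoef k m) * l ^ m) * (Bi ^ s * S ^ m))"
    unfolding Qs_def S_def[symmetric] sum_distrib_left
    by (intro sum.cong refl)
       (simp add: power_mult_distrib fps_const_power mult_ac fps_of_nat[symmetric] del: fps_of_nat flip: fps_const_mult)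
  then show ?thesis by (simp add: fps_sum_nth)
qed

lemma C_values:
  "\<exists>c4. xo 0 c4 \<and> of_nat q * C q = - of_nat q + of_int c2 * l ^ 2 + of_int c3 * l ^ 3 + c4 * l ^ 4"
  "of_nat q * C (2 * q) = - (of_nat (2 * q + 1) * of_nat q) - of_nat (2 * q) * of_nat (2 * q + 1) * l
     + of_int d3 * l ^ 3 + of_int d4 * l ^ 4"
proof -
  define c4 where "c4 = of_nat (ncoef q 4) * (Bi ^ 2 * S ^ 4) $ (q - 1)"
  have n1: "ncoef k 1 = k" for k by (simp add: ncoef_def)
  have S0: "bp_series2 p S" unfolding S_def by (intro bp_series2.sum bp_series2.power bp_B)
  have "bp_series2 p (Bi ^ 2 * S ^ 4)" by (intro bp_series2.mult bp_series2.power S0 bp_Bi)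
  then have "xo 0 c4" unfolding c4_def bp_series2_def by (intro X0.mult X0.of_nat xo_bp) blast
  moreover have "of_nat q * C q = - of_nat q + of_int c2 * l ^ 2 + of_int c3 * l ^ 3 + c4 * l ^ 4"
  proof -
    have "of_nat q * C q = (Bi ^ 2 * Qs q B) $ (q - 1)"
      using C_eval[of 1] by (simp only: mult_1 Suc_1 zero_less_one)
    then show ?thesis unfolding Qs_coeff sum_atMost_4 mu_values c2_def c3_def c4_def by (simp add: mult_ac)
  qed
  ultimately show "\<exists>c4. xo 0 c4 \<and> of_nat q * C q = - of_nat q + of_int c2 * l ^ 2 + of_int c3 * l ^ 3 + c4 * l ^ 4"
    by blast
  have s3: "Suc 2 = 3" by simp
  show "of_nat q * C (2 * q) = - (of_nat (2 * q + 1) * of_nat q) - of_nat (2 * q) * of_nat (2 * q + 1) * l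
     + of_int d3 * l ^ 3 + of_int d4 * l ^ 4"
  proof -
    have "of_nat q * C (2 * q) = (Bi ^ 3 * Qs (2 * q) B) $ (2 * q - 1)"
      using C_eval[of 2] unfolding s3 by simp
    then show ?thesis unfolding Qs_coeff sum_atMost_4 nu_values d3_def d4_def n1 by (simp add: algebra_simps)
  qed
qed

definition T3 :: int where "T3 = 2 * int (2 * q + 1) * int q * c2 - int q * d3"
definition T4 :: int where "T4 = int (2 * q + 1) * c2 ^ 2 + 2 * int (2 * q + 1) * int q * c3 - int q * d4"

text \<open>Substituting w = \<epsilon> - 1 - l with negligible \<epsilon> cancels the powers of l
  below the third. The l^4 coefficient c4 of q \<open>C q\<close> cancels in degree 4 as well, so
  its order suffices and its value is never computed.\<close>

lemma bracket:
  defines "a \<equiv> of_nat (2 * q + 1)"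
  shows "xo (int NM) (of_nat q ^ 2 * (a * C q ^ 2 - C (2 * q) - 2 * a * w * C q) - (of_int T3 * l ^ 3 + of_int T4 * l ^ 4))"
proof -
  obtain c4 where c4: "xo 0 c4" and C1: "of_nat q * C q = - of_nat q + of_int c2 * l ^ 2 + of_int c3 * l ^ 3 + c4 * l ^ 4"
    using C_values(1) by blast
  define Q where "Q = (of_nat q :: qpoly fps)"
  define c2' c3' d3' d4' where "c2' = (of_int c2 :: qpoly fps)" and "c3' = (of_int c3 :: qpoly fps)"
    and "d3' = (of_int d3 :: qpoly fps)" and "d4' = (of_int d4 :: qpoly fps)"
  define \<epsilon> where "\<epsilon> = 1 + w + l"
  define M where "M = - Q + c2' * l ^ 2 + c3' * l ^ 3 + c4 * l ^ 4"
  define N where "N = - (a * Q) - 2 * Q * a * l + d3' * l ^ 3 + d4' * l ^ 4"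
  have C1': "Q * C q = M" using C1 unfolding Q_def M_def c2'_def c3'_def .
  have C2': "Q * C (2 * q) = N" using C_values(2) unfolding Q_def N_def d3'_def d4'_def a_def by simp
  have we: "w = \<epsilon> - 1 - l" by (simp add: \<epsilon>_def)
  have "Q ^ 2 * (a * C q ^ 2 - C (2 * q) - 2 * a * w * C q) = a * (Q * C q) ^ 2 - Q * (Q * C (2 * q)) - 2 * a * w * Q * (Q * C q)"
    by (simp add: algebra_simps power2_eq_square)
  also have "\<dots> = a * M ^ 2 - Q * N - 2 * a * (\<epsilon> - 1 - l) * Q * M" unfolding C1' C2' we ..
  also have "\<dots> = (2 * a * Q * c2' - Q * d3') * l ^ 3 + (a * c2' ^ 2 + 2 * a * Q * c3' - Q * d4') * l ^ 4
      + (l ^ 5 * (a * (2 * c2' * c3' + (c3' ^ 2 + 2 * c2' * c4) * l + 2 * c3' * c4 * l ^ 2 + c4 ^ 2 * l ^ 3) + 2 * a * Q * c4)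
         - 2 * a * Q * M * \<epsilon>)"
    unfolding M_def N_def by (simp add: algebra_simps eval_nat_numeral)
  also have "2 * a * Q * c2' - Q * d3' = of_int T3"
    unfolding T3_def a_def Q_def c2'_def d3'_def by simp
  also have "a * c2' ^ 2 + 2 * a * Q * c3' - Q * d4' = of_int T4"
    unfolding T4_def a_def Q_def c2'_def c3'_def d4'_def by simp
  finally have e: "Q ^ 2 * (a * C q ^ 2 - C (2 * q) - 2 * a * w * C q) - (of_int T3 * l ^ 3 + of_int T4 * l ^ 4) =
     l ^ 5 * (a * (2 * c2' * c3' + (c3' ^ 2 + 2 * c2' * c4) * l + 2 * c3' * c4 * l ^ 2 + c4 ^ 2 * l ^ 3) + 2 * a * Q * c4)
         - 2 * a * Q * M * \<epsilon>" by simp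
  have l5: "xo (int NM) (l ^ 5)"
  proof (rule xo_mono[OF xo_power[OF xo_L2]])
    have "NM \<le> 5 * q ^ 2" by (simp add: NM_def)
    then show "int NM \<le> int 5 * int (q ^ 2)" by (metis of_nat_le_iff of_nat_mult)
  qed
  have eps: "xo (int NM) \<epsilon>" unfolding \<epsilon>_def by (rule xo_NM[OF log_relation_2])
  have x: "xo 0 (a * (2 * c2' * c3' + (c3' ^ 2 + 2 * c2' * c4) * l + 2 * c3' * c4 * l ^ 2 + c4 ^ 2 * l ^ 3) + 2 * a * Q * c4)"
    "xo 0 (2 * a * Q * M)"
    unfolding M_def a_def Q_def c2'_def c3'_def
    by (intro X0.add X0.mult X0.power X0.numeral X0.of_nat X0.of_int X0.neg c4 xo_0_L)+
  have "xo (int NM) ((a * (2 * c2' * c3' + (c3' ^ 2 + 2 * c2' * c4) * l + 2 * c3' * c4 * l ^ 2 + c4 ^ 2 * l ^ 3) + 2 * a * Q * c4) * l ^ 5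
      - 2 * a * Q * M * \<epsilon>)" by (rule xo_diff[OF xo_mult0[OF x(1) l5] xo_mult0[OF x(2) eps]])
  then show ?thesis unfolding Q_def[symmetric] e by (simp only: mult.commute)
qed

section \<open>Leading terms for odd primes\<close>

abbreviation t :: "qpoly fps" where "t \<equiv> fps_const (v 1) * fps_X ^ q"

lemma xo_t: "xo (int q) t"
  by (rule xo_mult_bp[OF bp_series_const[OF bp_poly_v] xo_X])

lemma xo_t_power: "xo (int (n * q)) (t ^ n)"
  using xo_power[OF xo_t, of n] by (simp only: of_nat_mult)

text \<open>In the quotient p = - xi^q \<open>V\<close>, and \<open>V\<close> differs from v_1 only
  by a multiple of p and by terms of positive degree.\<close>

lemma p_lead: "xo (int q + 1) (of_nat p - (- t))"
proof -
  have "xo 1 (V - fps_const (v 1))"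
  proof -
    have "V - fps_const (v 1) = (V - fps_const (V $ 0)) - of_nat p * (of_nat p ^ (q - 1) * fps_const (v 1))"
    proof -
      have "(of_nat p :: qpoly fps) * (of_nat p ^ (q - 1) * fps_const (v 1)) = of_nat p ^ q * fps_const (v 1)"
        using q_pos by (cases q) (auto simp: mult.assoc)
      also have "\<dots> = fps_const (of_nat p ^ q * v 1)"
        by (simp add: fps_of_nat[symmetric] del: fps_of_nat flip: fps_const_mult fps_const_power)
      finally show ?thesis by (simp add: V_0 right_diff_distrib mult.commute flip: fps_const_sub)
    qed
    moreover have "xo 1 (V - fps_const (V $ 0))"
      using bp_V by (intro xo_1I[where m = 0] bp_series.diff bp_series_const) (auto simp: bp_series_def)
    moreover have "xo 1 (of_nat p * (of_nat p ^ (q - 1) * fps_const (v 1)))"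
    proof -
      have "xo (int q) ((of_nat p ^ (q - 1) * fps_const (v 1)) * of_nat p)"
        by (intro xo_mult0 X0.mult X0.power X0.of_nat xo_p xo_bp bp_series_const bp_poly_v)
      then have "xo (int q) (of_nat p * (of_nat p ^ (q - 1) * fps_const (v 1)))" by (simp only: mult.commute)
      then show ?thesis by (rule xo_mono) (use q_pos in linarith)
    qed
    ultimately show ?thesis by (simp only: xo_diff)
  qed
  from xo_mult[OF xo_X this, of q] have "xo (int q + 1) (fps_X ^ q * (V - fps_const (v 1)))" .
  moreover have "xo (int q + 1) (pbr p * 1)" by (intro xo_pbr bp_series.one)
  ultimately have "xo (int q + 1) (pbr p * 1 - fps_X ^ q * (V - fps_const (v 1)))" by (intro xo_diff)
  then show ?thesis unfolding pbr_V by (rule back_subst[of "xo _"]) (simp add: algebra_simps)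
qed

lemma p_power_lead: "xo (int (n * q) + 1) (of_nat p ^ n - (- t) ^ n)"
  using lead_power[OF p_lead xo_neg[OF xo_t], of n] by (simp only: of_nat_mult)

text \<open>The recursion gives p^2 \<open>ell p 2\<close> = v_1^(p+1) + p v_2, and the extra factor
  p moves the v_2 term to higher order.\<close>

lemma l_lead: "xo (int ((p + 1) * q) + 1) (of_nat p ^ 2 * l - t ^ (p + 1))"
proof -
  have "of_nat p * ell p 2 = v 2 + ell p 1 * v 1 ^ p"
    using ell_rec[of 2] by (simp add: eval_nat_numeral)
  then have "of_nat p ^ 2 * ell p 2 = of_nat p * v 2 + v 1 ^ (p + 1)"
    unfolding power2_eq_square mult.assoc
    using ell_1 by (simp add: distrib_left mult.assoc[symmetric])
  moreover have "p ^ 2 - 1 = q * (p + 1)" using psq by simp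
  ultimately have "of_nat p ^ 2 * l = fps_X ^ (q * (p + 1)) * fps_const (of_nat p * v 2 + v 1 ^ (p + 1))"
    using bp_p_power_L[of 2] by simp
  also have "\<dots> = of_nat p * (fps_const (v 2) * fps_X ^ (q * (p + 1))) + t ^ (p + 1)"
  proof -
    have "x * fps_const (of_nat p * v 2 + v 1 ^ (p + 1)) = of_nat p * (fps_const (v 2) * x) + fps_const (v 1) ^ (p + 1) * x" for x
      unfolding fps_const_add[symmetric] fps_const_mult[symmetric] fps_const_power[symmetric] fps_of_nat distrib_left
      by (simp only: mult_ac)
    from this[of "fps_X ^ (q * (p + 1))"] show ?thesis
      unfolding power_mult_distrib[of _ _ "p + 1"] power_mult[of _ q "p + 1", symmetric] .
  qed
  finally have "of_nat p ^ 2 * l - t ^ (p + 1) = of_nat p * (fps_const (v 2) * fps_X ^ (q * (p + 1)))"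
    by simp
  moreover have "xo (int q + int (q * (p + 1))) (of_nat p * (fps_const (v 2) * fps_X ^ (q * (p + 1))))"
    by (intro xo_mult[OF xo_p] xo_mult_bp xo_X bp_series_const bp_poly_v)
  ultimately show ?thesis
    using xo_mono[of "int q + int (q * (p + 1))" _ "int ((p + 1) * q) + 1"] q_pos
    by (simp add: mult.commute)
qed

text \<open>Formally l = t^(p+1) / p^2 and p = - t, so p^e l^3 = (-1)^e t^(3 (p+1) + e - 6).
  Multiplication by p^(6-e) makes this comparison free of denominators.\<close>

lemma l3_lead:
  assumes "e \<le> 6"
  shows "xo (int ((3 * p + e - 3) * q) + 1) (of_nat p ^ e * l ^ 3 - (- 1) ^ e * t ^ (3 * p + e - 3))"
proof -
  let ?n = "3 * p + e - 3"
  define G where "G = (- 1) ^ e * t ^ ?n"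
  have w: "(6 - e) * q + ?n * q = (3 * p + 3) * q"
    using assms p2 by (simp flip: add_mult_distrib)
  have 1: "xo (int ((3 * p + 3) * q) + 1) ((of_nat p ^ 2 * l) ^ 3 - (t ^ (p + 1)) ^ 3)"
  proof -
    have "3 * ((p + 1) * x) = (3 * p + 3) * x" for x by (simp add: algebra_simps)
    then have "int 3 * int ((p + 1) * q) = int ((3 * p + 3) * q)" unfolding of_nat_mult[symmetric] by simp
    then show ?thesis using lead_power[OF l_lead xo_t_power, of 3] by (simp only:)
  qed
  have G: "xo (int (?n * q)) G"
    unfolding G_def by (intro xo_mult0 X0.power X0.neg X0.one xo_t_power)
  have "xo (int ((6 - e) * q)) ((- t) ^ (6 - e))"
    using xo_power[OF xo_neg[OF xo_t_power[of 1]], of "6 - e"] by simp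
  from lead_mult[OF p_power_lead[of "6 - e"] this _ G, of G]
  have "xo (int ((6 - e) * q) + int (?n * q) + 1) (of_nat p ^ (6 - e) * G - (- t) ^ (6 - e) * G)"
    by (simp add: xo_zero)
  then have 2: "xo (int ((3 * p + 3) * q) + 1) (of_nat p ^ (6 - e) * G - (- t) ^ (6 - e) * G)"
    unfolding of_nat_add[symmetric] w .
  have "(- t) ^ (6 - e) * G = ((- 1) ^ (6 - e) * (- 1) ^ e) * (t ^ (6 - e) * t ^ ?n)"
    unfolding G_def power_minus[of t] by (simp only: mult_ac)
  also have "\<dots> = (t ^ (p + 1)) ^ 3"
  proof -
    have "6 - e + e = 6" "6 - e + ?n = (p + 1) * 3" using assms p2 by auto
    then show ?thesis unfolding power_add[symmetric] power_mult[symmetric] by (simp only:) simp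
  qed
  finally have "xo (int ((3 * p + 3) * q) + 1) ((of_nat p ^ 2 * l) ^ 3 - of_nat p ^ (6 - e) * G)"
    using xo_diff[OF 1 2] by simp
  moreover have "(of_nat p ^ 2 * l) ^ 3 = of_nat p ^ (6 - e) * (of_nat p ^ e * l ^ 3)"
  proof -
    have "(of_nat p :: qpoly fps) ^ 6 = of_nat p ^ (6 - e) * of_nat p ^ e" using assms by (simp flip: power_add)
    then show ?thesis by (simp add: power_mult_distrib flip: power_mult mult.assoc)
  qed
  ultimately have "xo (int ((3 * p + 3) * q) + 1) (of_nat p ^ (6 - e) * (of_nat p ^ e * l ^ 3 - G))"
    by (simp add: right_diff_distrib)
  from xo_div_p[OF refl this] have "xo (int ((3 * p + 3) * q) + 1 - int ((6 - e) * q)) (of_nat p ^ e * l ^ 3 - G)" .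
  then show ?thesis unfolding G_def w[symmetric] by (rule xo_mono) simp
qed

text \<open>The cubic term has order r q = 3 q^2 + e q: \<open>h1\<close> puts the quartic term
  above it and \<open>h2\<close> keeps it within the precision. Comparing 2 q^2 times the class with
  (2 q + 1) T3 l^3 turns the leading digit into the solution of the congruence
  \<open>h3\<close>.\<close>

theorem MC_lead:
  fixes c u' u4 :: int and e f :: nat
  defines "E \<equiv> q * (2 * q) - 2 * q" and "r \<equiv> 3 * p + e - 3"
  assumes e: "e \<le> 6" and T3: "T3 = int p ^ e * u'" and T4: "T4 = int p ^ f * u4"
    and h1: "r * q + 1 \<le> 4 * q ^ 2 + f * q" and h2: "r * q + 1 \<le> NM"
    and h3: "int p dvd int (2 * q + 1) * (- 1) ^ e * u' - 2 * int q ^ 2 * c"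
  shows "xo (int (Suc (E + r * q))) (MC p (2 * q) - fps_const (of_int c * v 1 ^ r) * fps_X ^ (E + r * q))"
proof -
  define a :: "qpoly fps" where "a = of_nat (2 * q + 1)"
  define m where "m = int (Suc (E + r * q))"
  define br where "br = a * C q ^ 2 - C (2 * q) - 2 * a * w * C q"
  define Q :: "qpoly fps" where "Q = of_nat q ^ 2"
  have Q0: "xo 0 Q" unfolding Q_def by (intro X0.power X0.of_nat)
  have a0: "xo 0 a" unfolding a_def by (rule X0.of_nat)
  have lev: "xo m (fps_X ^ E * f)" if "xo (int (r * q) + 1) f" for f
    by (rule xo_mono[OF xo_mult[OF xo_X that, of E]]) (unfold m_def, linarith)
  have "xo m (2 * MC p (2 * q) - fps_X ^ E * (a * br))"
    using MC_main unfolding a_def[symmetric] br_def[symmetric] E_def[symmetric]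
    by (rule xo_mono) (use h2 in \<open>unfold m_def, linarith\<close>)
  then have s1: "xo m (Q * (2 * MC p (2 * q) - fps_X ^ E * (a * br)))" by (rule xo_mult0[OF Q0])
  have "xo (int (r * q) + 1) (Q * br - (of_int T3 * l ^ 3 + of_int T4 * l ^ 4))"
    unfolding Q_def br_def a_def by (rule xo_mono[OF bracket]) (use h2 in linarith)
  moreover have "xo (int (r * q) + 1) (of_int T4 * l ^ 4)"
  proof -
    have "xo (int (f * q) + int 4 * int (q ^ 2)) (of_nat p ^ f * l ^ 4)"
      using xo_mult[OF xo_power[OF xo_p, of f] xo_power[OF xo_L2, of 4]] by simp
    moreover have "int (r * q) + 1 \<le> int (f * q) + int 4 * int (q ^ 2)"
    proof -
      have "int (r * q + 1) \<le> int (4 * q ^ 2 + f * q)" using h1 by (simp only: of_nat_le_iff)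
      then show ?thesis by linarith
    qed
    ultimately have "xo (int (r * q) + 1) (of_int u4 * (of_nat p ^ f * l ^ 4))"
      by (intro xo_mult0[OF X0.of_int]) (rule xo_mono)
    then show ?thesis unfolding T4 by (simp add: mult_ac)
  qed
  moreover have "xo (int (r * q) + 1) (of_int T3 * l ^ 3 - of_int u' * ((- 1) ^ e * t ^ r))"
  proof -
    have "xo (int (r * q) + 1) (of_int u' * (of_nat p ^ e * l ^ 3 - (- 1) ^ e * t ^ r))"
      unfolding r_def by (rule xo_mult0[OF X0.of_int l3_lead[OF e]])
    then show ?thesis unfolding T3 by (simp add: algebra_simps)
  qed
  ultimately have "xo (int (r * q) + 1) ((Q * br - (of_int T3 * l ^ 3 + of_int T4 * l ^ 4)) + of_int T4 * l ^ 4
       + (of_int T3 * l ^ 3 - of_int u' * ((- 1) ^ e * t ^ r)))" by (intro xo_add)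
  then have "xo (int (r * q) + 1) (Q * br - of_int u' * ((- 1) ^ e * t ^ r))" by (simp add: algebra_simps)
  then have s2: "xo m (fps_X ^ E * (a * (Q * br - of_int u' * ((- 1) ^ e * t ^ r))))"
    by (intro lev xo_mult0[OF a0])
  obtain k where k: "int (2 * q + 1) * (- 1) ^ e * u' - 2 * int q ^ 2 * c = int p * k" using h3 by blast
  have k': "a * (- 1) ^ e * of_int u' - 2 * Q * of_int c = of_nat p * of_int k"
    using arg_cong[OF k, of "of_int :: int \<Rightarrow> qpoly fps"] unfolding a_def Q_def by simp
  have s3: "xo m (fps_X ^ E * (of_nat p * of_int k * t ^ r))"
  proof (rule lev)
    have "xo (int q + int (r * q)) (of_nat p * (of_int k * t ^ r))"
      by (rule xo_mult[OF xo_p xo_mult0[OF X0.of_int xo_t_power]])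
    then show "xo (int (r * q) + 1) (of_nat p * of_int k * t ^ r)"
      using q_pos by (simp only: mult.assoc) (erule xo_mono, simp)
  qed
  have "xo m (Q * (2 * MC p (2 * q) - fps_X ^ E * (a * br)) + fps_X ^ E * (a * (Q * br - of_int u' * ((- 1) ^ e * t ^ r)))
      + fps_X ^ E * (of_nat p * of_int k * t ^ r))"
    by (intro xo_add s1 s2 s3)
  also have "Q * (2 * MC p (2 * q) - fps_X ^ E * (a * br)) + fps_X ^ E * (a * (Q * br - of_int u' * ((- 1) ^ e * t ^ r)))
      + fps_X ^ E * (of_nat p * of_int k * t ^ r)
     = of_nat (2 * q ^ 2) * MC p (2 * q) - of_nat (2 * q ^ 2) * (of_int c * t ^ r * fps_X ^ E)"
  proof -
    have q2: "of_nat (2 * q ^ 2) = 2 * Q" unfolding Q_def by simp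
    show ?thesis unfolding k'[symmetric] q2 by (simp add: algebra_simps)
  qed
  finally have "xo m (MC p (2 * q) - of_int c * t ^ r * fps_X ^ E)"
  proof (rule xo_cancel_nat)
    have "coprime q p" using coprime_less[of q] q_pos p_pos by simp
    moreover have "coprime 2 p" using coprime_less[of 2] odd by simp
    ultimately show "coprime (2 * q ^ 2) p" by simp
    show "0 < 2 * q ^ 2" using q_pos by simp
  qed
  also have "of_int c * t ^ r * fps_X ^ E = fps_const (of_int c * v 1 ^ r) * fps_X ^ (E + r * q)"
    by (simp add: power_mult_distrib power_add fps_of_int[symmetric] mult_ac fps_const_power del: fps_of_int
        flip: fps_const_mult power_mult)
  finally show ?thesis unfolding m_def .
qed

end

section \<open>The primes 3, 5, 7, 11 and 13\<close>

lemma digit_poly_monomial: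
  assumes "d < p"
  shows "digit_poly p (of_nat d * v i ^ n)"
proof -
  have "of_nat d * v i ^ n = Poly_Mapping.single (mon_scale n (Poly_Mapping.single i 1)) (of_nat d)"
    unfolding v_def single_power using mult_single[of 0 "of_nat d :: rat" "mon_scale n (Poly_Mapping.single i 1)" 1] by simp
  then show ?thesis
    using assms by (auto simp: digit_poly_def lookup_single when_def intro: exI[of _ 0])
qed

lemma (in bp_odd) lowest_term_MC:
  fixes ua ub :: int and c e f :: nat
  assumes "e \<le> 6" "T3 = int p ^ e * ua" "T4 = int p ^ f * ub"
    and "(3 * p + e - 3) * q + 1 \<le> 4 * q ^ 2 + f * q" "(3 * p + e - 3) * q + 1 \<le> NM"
    and "int p dvd int (2 * q + 1) * (- 1) ^ e * ua - 2 * int q ^ 2 * int c" "c < p"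
    and "m = q * (2 * q) - 2 * q + (3 * p + e - 3) * q" "n = 2 * q" "r = 3 * p + e - 3"
  shows "lowest_term p (MC p n) m (of_nat c * v 1 ^ r)"
proof (rule lowest_termI)
  show "bp_series p (MC p n)" by (rule bp_MC)
  show "digit_poly p (of_nat c * v 1 ^ r)" using assms(7) by (rule digit_poly_monomial)
  show "bp_poly p (of_nat c * v 1 ^ r)" by (intro bp_poly.mult bp_poly.power bp_poly.of_nat bp_poly_v)
  show "xo (int (Suc m)) (MC p n - fps_const (of_nat c * v 1 ^ r) * fps_X ^ m)"
    using MC_lead[OF assms(1-6)] unfolding assms(8-10) by simp
qed

lemma bp_oddI: "prime p \<Longrightarrow> p > 2 \<Longrightarrow> bp_odd p"
  by (simp add: bp_odd_def bp_prime_def bp_odd_axioms_def)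

lemmas bp_odd_numbers = bp_odd.T3_def bp_odd.T4_def bp_odd.c2_def bp_odd.c3_def bp_odd.d3_def bp_odd.d4_def
  bp_odd.mu2_def bp_odd.mu3_def bp_odd.nu3_def bp_odd.nu4_def

lemma lowest_term_3: "lowest_term 3 (MC 3 4) 22 (2 * v 1 ^ 9)"
proof -
  have o: "bp_odd 3" by (rule bp_oddI) simp_all
  have b: "(6 choose 3 :: nat) = 20" "(10 choose 4 :: nat) = 210"
    "(7 choose 4 :: nat) = 35" "(9 choose 6 :: nat) = 84"
    "(13 choose 7 :: nat) = 1716" "(10 choose 7 :: nat) = 120"
    "(3 choose 2 :: nat) = 3" "(4 choose 3 :: nat) = 4"
    "(6 choose 3 :: nat) = 20" "(7 choose 4 :: nat) = 35"
    by (simp_all add: binomial_fact' fact_numeral)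
  have T: "bp_odd.T3 3 = -2160" "bp_odd.T4 3 = -63720"
    by (simp_all add: bp_odd_numbers[OF o] ncoef_def b)
  \<comment> \<open>e is the 3-adic valuation of T3; f needs only to lift the quartic term above
    order 18, for which 2 is enough.\<close>
  have "lowest_term 3 (MC 3 4) 22 (of_nat 2 * v 1 ^ 9)"
    by (rule bp_odd.lowest_term_MC[OF o, where e = 3 and f = 2 and ua = "-80" and ub = "-7080"])
       (simp_all add: T bp_odd.NM_def[OF o] bp_odd.NN_def[OF o] bp_prime.prec_def[OF bp_odd.axioms(1)[OF o]])
  then show ?thesis by simp
qed

text \<open>From p = 5 on, Wolstenholme's congruence puts p^3 into \<open>mu2\<close> and
  \<open>nu3\<close>, and the coefficients \<open>ncoef q 2\<close> and
  \<open>ncoef (2 * q) 3\<close> add one more p; hence e = 4. Here 4 q^2 is exactly the order 64 of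
  the cubic term, so one factor 5 of T4 is used.\<close>

lemma lowest_term_5: "lowest_term 5 (MC 5 8) 88 (3 * v 1 ^ 16)"
proof -
  have o: "bp_odd 5" by (rule bp_oddI) simp_all
  have b: "(10 choose 5 :: nat) = 252" "(16 choose 6 :: nat) = 8008"
    "(11 choose 6 :: nat) = 462" "(15 choose 10 :: nat) = 3003"
    "(21 choose 11 :: nat) = 352716" "(16 choose 11 :: nat) = 4368"
    "(5 choose 2 :: nat) = 10" "(6 choose 3 :: nat) = 20"
    "(10 choose 3 :: nat) = 120" "(11 choose 4 :: nat) = 330"
    by (simp_all add: binomial_fact' fact_numeral)
  have T: "bp_odd.T3 5 = -1260000" "bp_odd.T4 5 = -376740000"
    by (simp_all add: bp_odd_numbers[OF o] ncoef_def b)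
  have "lowest_term 5 (MC 5 8) 88 (of_nat 3 * v 1 ^ 16)"
    by (rule bp_odd.lowest_term_MC[OF o, where e = 4 and f = 1 and ua = "-2016" and ub = "-75348000"])
       (simp_all add: T bp_odd.NM_def[OF o] bp_odd.NN_def[OF o] bp_prime.prec_def[OF bp_odd.axioms(1)[OF o]])
  then show ?thesis by simp
qed

lemma lowest_term_7: "lowest_term 7 (MC 7 12) 192 (4 * v 1 ^ 22)"
proof -
  have o: "bp_odd 7" by (rule bp_oddI) simp_all
  have b: "(14 choose 7 :: nat) = 3432" "(22 choose 8 :: nat) = 319770"
    "(15 choose 8 :: nat) = 6435" "(21 choose 14 :: nat) = 116280"
    "(29 choose 15 :: nat) = 77558760" "(22 choose 15 :: nat) = 170544"
    "(7 choose 2 :: nat) = 21" "(8 choose 3 :: nat) = 56"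
    "(14 choose 3 :: nat) = 364" "(15 choose 4 :: nat) = 1365"
    by (simp_all add: binomial_fact' fact_numeral)
  have T: "bp_odd.T3 7 = -242712288" "bp_odd.T4 7 = -559546211952"
    by (simp_all add: bp_odd_numbers[OF o] ncoef_def b)
  have "lowest_term 7 (MC 7 12) 192 (of_nat 4 * v 1 ^ 22)"
    by (rule bp_odd.lowest_term_MC[OF o, where e = 4 and f = 0 and ua = "-101088" and ub = "-559546211952"])
       (simp_all add: T bp_odd.NM_def[OF o] bp_odd.NN_def[OF o] bp_prime.prec_def[OF bp_odd.axioms(1)[OF o]])
  then show ?thesis by simp
qed

lemma lowest_term_11: "lowest_term 11 (MC 11 20) 520 (9 * v 1 ^ 34)"
proof -
  have o: "bp_odd 11" by (rule bp_oddI) simp_all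
  have b: "(22 choose 11 :: nat) = 705432" "(34 choose 12 :: nat) = 548354040"
    "(23 choose 12 :: nat) = 1352078" "(33 choose 22 :: nat) = 193536720"
    "(45 choose 23 :: nat) = 4116715363800" "(34 choose 23 :: nat) = 286097760"
    "(11 choose 2 :: nat) = 55" "(12 choose 3 :: nat) = 220"
    "(22 choose 3 :: nat) = 1540" "(23 choose 4 :: nat) = 8855"
    by (simp_all add: binomial_fact' fact_numeral)
  have T: "bp_odd.T3 11 = -2964170008800" "bp_odd.T4 11 = -332771476442605200"
    by (simp_all add: bp_odd_numbers[OF o] ncoef_def b)
  have "lowest_term 11 (MC 11 20) 520 (of_nat 9 * v 1 ^ 34)"
    by (rule bp_odd.lowest_term_MC[OF o, where e = 4 and f = 0 and ua = "-202456800" and ub = "-332771476442605200"])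
       (simp_all add: T bp_odd.NM_def[OF o] bp_odd.NN_def[OF o] bp_prime.prec_def[OF bp_odd.axioms(1)[OF o]])
  then show ?thesis by simp
qed

lemma lowest_term_13: "lowest_term 13 (MC 13 24) 744 (11 * v 1 ^ 40)"
proof -
  have o: "bp_odd 13" by (rule bp_oddI) simp_all
  have b: "(26 choose 13 :: nat) = 10400600" "(40 choose 14 :: nat) = 23206929840"
    "(27 choose 14 :: nat) = 20058300" "(39 choose 26 :: nat) = 8122425444"
    "(53 choose 27 :: nat) = 973469712824056" "(40 choose 27 :: nat) = 12033222880"
    "(13 choose 2 :: nat) = 78" "(14 choose 3 :: nat) = 364"
    "(26 choose 3 :: nat) = 2600" "(27 choose 4 :: nat) = 17550"
    by (simp_all add: binomial_fact' fact_numeral)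
  have T: "bp_odd.T3 13 = -252932925772800" "bp_odd.T4 13 = -188544501547482225600"
    by (simp_all add: bp_odd_numbers[OF o] ncoef_def b)
  have "lowest_term 13 (MC 13 24) 744 (of_nat 11 * v 1 ^ 40)"
    by (rule bp_odd.lowest_term_MC[OF o, where e = 4 and f = 0 and ua = "-8855884800" and ub = "-188544501547482225600"])
       (simp_all add: T bp_odd.NM_def[OF o] bp_odd.NN_def[OF o] bp_prime.prec_def[OF bp_odd.axioms(1)[OF o]])
  then show ?thesis by simp
qed

section \<open>The prime two\<close>

text \<open>One chain rule for both partial derivatives. A derivation that lowers the order by at
  most one is determined by its values on truncations, where it is the Leibniz rule.\<close>

lemma comp2_derivation:
  fixes D :: "'a::comm_ring_1 fps fps \<Rightarrow> 'a fps fps"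
  assumes add: "\<And>a b. D (a + b) = D a + D b" and mult: "\<And>a b. D (a * b) = D a * b + a * D b"
    and cst: "\<And>c. D (cst c) = 0" and ord: "\<And>n G. ord2 (Suc n) G \<Longrightarrow> ord2 n (D G)"
    and A: "ord2 1 A"
  shows "D (comp2 e A) = comp2 (fps_deriv e) A * D A"
proof (rule ord2_eqI)
  fix N
  have zero: "D 0 = 0" using cst[of 0] by simp
  have diff: "D (a - b) = D a - D b" for a b
    using add[of "a - b" b] by (simp add: algebra_simps)
  have sum: "D (\<Sum>k<n. f k) = (\<Sum>k<n. D (f k))" for f :: "nat \<Rightarrow> _" and n
    by (induction n) (auto simp: zero add)
  have pow: "D (A ^ k) = of_nat k * A ^ (k - 1) * D A" for k
  proof (induction k)
    case 0
    then show ?case using cst[of 1] by simp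
  next
    case (Suc k)
    then show ?case by (cases k) (simp_all add: mult algebra_simps)
  qed
  let ?S = "\<Sum>k<Suc N. cst (e $ k) * A ^ k"
  let ?T = "\<Sum>k<N. cst (fps_deriv e $ k) * A ^ k"
  have "D ?S = (\<Sum>k<Suc N. cst (e $ k) * (of_nat k * A ^ (k - 1) * D A))"
    by (simp only: sum mult cst pow) simp
  also have "\<dots> = (\<Sum>k<N. cst (e $ Suc k) * (of_nat (Suc k) * A ^ k * D A))"
    unfolding sum.lessThan_Suc_shift by simp
  also have "\<dots> = ?T * D A"
  proof -
    have "of_nat (Suc k) = cst (of_nat (Suc k) :: 'a)" for k
      by (simp only: fps_of_nat)
    then show ?thesis unfolding sum_distrib_right
      by (intro sum.cong refl) (simp add: mult_ac del: of_nat_Suc flip: fps_const_mult)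
  qed
  finally have DS: "D ?S = ?T * D A" .
  have "ord2 N (D (comp2 e A - ?S))" by (rule ord[OF comp2_approx[OF A]])
  then have 1: "ord2 N (D (comp2 e A) - ?T * D A)" unfolding diff DS .
  have "ord2 N ((comp2 (fps_deriv e) A - ?T) * D A)"
    by (rule ord2_mult_right[OF comp2_approx[OF A]])
  then have "ord2 N (comp2 (fps_deriv e) A * D A - ?T * D A)" by (simp add: algebra_simps)
  from ord2_diff[OF 1 this] show "ord2 N (D (comp2 e A) - comp2 (fps_deriv e) A * D A)" by simp
qed

definition fps_deriv_inner :: "'a::comm_ring_1 fps fps \<Rightarrow> 'a fps fps" where
  "fps_deriv_inner G = Abs_fps (\<lambda>m. fps_deriv (G $ m))"

lemma comp2_fps_deriv:
  fixes A :: "'a::comm_ring_1 fps fps"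
  assumes "ord2 1 A"
  shows "fps_deriv (comp2 e A) = comp2 (fps_deriv e) A * fps_deriv A"
proof (rule comp2_derivation[OF _ _ _ _ assms])
  show "ord2 n (fps_deriv G)" if "ord2 (Suc n) G" for n and G :: "'a fps fps"
    unfolding ord2_def
  proof (intro allI impI)
    fix i j assume "i + j < n"
    then have "G $ (i + 1) $ j = 0" using that by (simp add: ord2_def)
    then show "fps_deriv G $ i $ j = 0"
      by (simp only: fps_deriv_nth fps_mult_of_nat_nth mult_zero_right)
  qed
qed (simp_all add: algebra_simps)

lemma comp2_fps_deriv_inner:
  fixes A :: "'a::comm_ring_1 fps fps"
  assumes "ord2 1 A"
  shows "fps_deriv_inner (comp2 e A) = comp2 (fps_deriv e) A * fps_deriv_inner A"
proof (rule comp2_derivation[OF _ _ _ _ assms])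
  show "fps_deriv_inner (a * b) = fps_deriv_inner a * b + a * fps_deriv_inner b" for a b :: "'a fps fps"
  proof (rule fps_ext)
    fix n
    show "fps_deriv_inner (a * b) $ n = (fps_deriv_inner a * b + a * fps_deriv_inner b) $ n"
      by (simp add: fps_deriv_inner_def fps_mult_nth fps_deriv_sum sum.distrib add.commute)
  qed
  show "ord2 n (fps_deriv_inner G)" if "ord2 (Suc n) G" for n and G :: "'a fps fps"
    using that by (auto simp: ord2_def fps_deriv_inner_def)
qed (auto simp: fps_eq_iff fps_deriv_inner_def algebra_simps)

context bp_prime
begin

lemma fmul_1: "fmul p 1 = fps_X"
  by (simp add: fgl_add_def fps_compose_0_right ex_lg)

text \<open>Both partial derivatives of F(xi, x) have the same factor 1 / log' F, which gives a linear
  recursion for the coefficients of x^k.\<close>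
lemma Z_recursion:
  defines "L' \<equiv> fps_deriv (lg p)"
  shows "of_nat (Suc k) * Z 1 $ Suc k * L' = (\<Sum>j\<le>k. fps_const (L' $ j) * fps_deriv (Z 1 $ (k - j)))"
proof -
  let ?X = "fps_const fps_X :: qpoly fps fps" and ?Y = "fps_X :: qpoly fps fps"
  have XY: "ord2 1 ?X" "ord2 1 ?Y" by (auto simp: ord2_def)
  have lgZ: "comp2 (lg p) (Z 1) = comp2 (lg p) ?X + comp2 (lg p) ?Y"
    by (simp add: comp2_lg_Z[of 1, simplified])
  have "comp2 L' (Z 1) * fps_deriv (Z 1) = fps_deriv (comp2 (lg p) (Z 1))"
    unfolding L'_def by (rule comp2_fps_deriv[OF ord_Z, symmetric])
  also have "\<dots> = comp2 L' ?Y"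
    unfolding lgZ fps_deriv_add comp2_fps_deriv[OF XY(1)] comp2_fps_deriv[OF XY(2)] L'_def by simp
  finally have 1: "comp2 L' (Z 1) * fps_deriv (Z 1) = comp2 L' ?Y" .
  have i: "fps_deriv_inner (a + b) = fps_deriv_inner a + fps_deriv_inner b" for a b :: "qpoly fps fps"
    by (rule fps_ext) (simp add: fps_deriv_inner_def)
  have dX: "fps_deriv_inner ?X = 1" "fps_deriv_inner ?Y = 0"
    by (rule fps_ext, auto simp: fps_deriv_inner_def fps_X_nth)+
  have "comp2 L' (Z 1) * fps_deriv_inner (Z 1) = fps_deriv_inner (comp2 (lg p) (Z 1))"
    unfolding L'_def by (rule comp2_fps_deriv_inner[OF ord_Z, symmetric])
  also have "\<dots> = comp2 L' ?X"
    unfolding lgZ i comp2_fps_deriv_inner[OF XY(1)] comp2_fps_deriv_inner[OF XY(2)] L'_def dX by simp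
  also have "\<dots> = fps_const L'" by (simp add: comp2_fps_const)
  finally have 2: "comp2 L' (Z 1) * fps_deriv_inner (Z 1) = fps_const L'" .
  \<comment> \<open>Cross-multiplying the two partial derivatives exposes a common factor with
    constant term 1, which can be cancelled in this domain.\<close>
  have "comp2 L' (Z 1) * (fps_deriv (Z 1) * fps_const L') = comp2 L' (Z 1) * (fps_deriv_inner (Z 1) * comp2 L' ?Y)"
    unfolding mult.assoc[symmetric] 1 2 by (simp only: mult.commute)
  moreover have "comp2 L' (Z 1) $ 0 $ 0 = 1"
    using lg_1 by (simp add: comp2_def L'_def)
  then have "comp2 L' (Z 1) \<noteq> 0" by auto
  ultimately have e: "fps_deriv (Z 1) * fps_const L' = comp2 L' ?Y * fps_deriv_inner (Z 1)"
    by (simp add: mult.commute)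
  have c: "comp2 L' ?Y $ j = fps_const (L' $ j)" for j
  proof (rule fps_ext)
    fix n
    have "(\<Sum>k\<le>j + n. L' $ k * (?Y ^ k) $ j $ n) = (\<Sum>k\<le>j + n. if k = j then L' $ j * (if n = 0 then 1 else 0) else 0)"
      by (intro sum.cong) (auto simp: fps_X_power_nth)
    then show "comp2 L' ?Y $ j $ n = fps_const (L' $ j) $ n"
      by (simp add: comp2_def)
  qed
  from arg_cong[OF e, of "\<lambda>f. f $ k"] show ?thesis
    by (simp add: fps_mult_nth[of "comp2 L' ?Y"] c fps_deriv_inner_def atLeast0AtMost)
qed

end

text \<open>With \<open>x = log' \<xi>\<close>, \<open>t = v\<^sub>1 \<xi>\<close>, \<open>a = \<ell>\<^sub>2 \<xi>\<^sup>3\<close> and \<open>y, z, w\<close> the images of \<open>x\<close> under the first three powers of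
  \<open>\<xi> d/d\<xi>\<close>, the coefficients \<open>H k\<close> of \<open>F(\<xi>, x)\<close> satisfy \<open>k! H k = pNk / x ^ (2 k - 1)\<close>; \<open>pdNk\<close> is the derivative
  of \<open>pNk\<close>, and \<open>pGn\<close> is the resulting numerator of \<open>n! MC n\<close>.\<close>
definition pN2 :: "'a::comm_ring_1 \<Rightarrow> 'a \<Rightarrow> 'a \<Rightarrow> 'a" where
  "pN2 t x y = t * x ^ 2 - y"

definition pdN2 :: "'a::comm_ring_1 \<Rightarrow> 'a \<Rightarrow> 'a \<Rightarrow> 'a \<Rightarrow> 'a" where
  "pdN2 t x y z = t * x ^ 2 + 2 * t * x * y - z"

definition pK2 :: "'a::comm_ring_1 \<Rightarrow> 'a \<Rightarrow> 'a \<Rightarrow> 'a \<Rightarrow> 'a" where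
  "pK2 t x y z = x * pdN2 t x y z - 3 * pN2 t x y * y - pN2 t x y * x"

definition pN3 :: "'a::comm_ring_1 \<Rightarrow> 'a \<Rightarrow> 'a \<Rightarrow> 'a \<Rightarrow> 'a" where
  "pN3 t x y z = pK2 t x y z - 2 * t * x ^ 2 * y"

definition pdN3 :: "'a::comm_ring_1 \<Rightarrow> 'a \<Rightarrow> 'a \<Rightarrow> 'a \<Rightarrow> 'a
     \<Rightarrow> 'a" where
  "pdN3 t x y z w =
     x * (t * x ^ 2 + 4 * t * x * y + 2 * t * y ^ 2 + 2 * t * x * z - w)
     - 2 * pdN2 t x y z * y - 3 * pN2 t x y * z - pdN2 t x y z * x - pN2 t x y * y
     - 2 * (t * x ^ 2 * y + 2 * t * x * y ^ 2 + t * x ^ 2 * z)"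

definition pN4 :: "'a::comm_ring_1 \<Rightarrow> 'a \<Rightarrow> 'a \<Rightarrow> 'a \<Rightarrow> 'a
     \<Rightarrow> 'a \<Rightarrow> 'a" where
  "pN4 t x y z w a = x * pdN3 t x y z w - 5 * pN3 t x y z * y - 2 * pN3 t x y z * x
     + 3 * t * x ^ 2 * pK2 t x y z + 24 * a * x ^ 6"

definition pG2 :: "'a::comm_ring_1 \<Rightarrow> 'a \<Rightarrow> 'a \<Rightarrow> 'a" where
  "pG2 t x y = - 3 * pN2 t x y + 12 * x - 6 * t * x ^ 2"

definition pG4 :: "'a::comm_ring_1 \<Rightarrow> 'a \<Rightarrow> 'a \<Rightarrow> 'a \<Rightarrow> 'a
     \<Rightarrow> 'a \<Rightarrow> 'a" where
  "pG4 t x y z w a = - 5 * pN4 t x y z w a + 120 * pN3 t x y z * x + 90 * pN2 t x y ^ 2 * x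
     - 1260 * pN2 t x y * x ^ 2 + 1680 * x ^ 3
     + t * (- 20 * pN3 t x y z * x ^ 2 + 360 * pN2 t x y * x ^ 3 - 840 * x ^ 4) - 480 * a * x ^ 6"

text \<open>Cofactors of \<open>e = \<ell>\<^sub>4 \<xi>\<^sup>1\<^sup>5\<close>, whose order 11 is beyond the required precision: only the integrality of
  the coefficients matters.\<close>
definition pR2 :: "'a::comm_ring_1 \<Rightarrow> 'a \<Rightarrow> 'a \<Rightarrow> 'a" where
  "pR2 a c e = 198 + 1512 * e + 1764 * e^2 + 1152 * c + 3276 * c * e + 1836 * c^2 + 216 * a + 2268 * a *
     e + 2232 * a * c + 540 * a^2"

definition pR4 :: "'a::comm_ring_1 \<Rightarrow> 'a \<Rightarrow> 'a \<Rightarrow> 'a" where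
  "pR4 a c e = 1050 + 441600 * e + 14713300 * e^2 + 92610000 * e^3 + 220480400 * e^4 + 261228800 * e^5 +
     154624400 * e^6 + 68200 * c + 7098900 * c * e + 109597600 * c * e^2 + 449604400 * c * e^3 +
     754051200 * c * e^4 + 617537200 * c * e^5 + 1263100 * c^2 + 47312000 * c^2 * e + 349636000 * c^2 *
     e^2 + 861616000 * c^2 * e^3 + 1015691600 * c^2 * e^4 + 8872800 * c^3 + 130600800 * c^3 * e +
     505478400 * c^3 * e^2 + 893583600 * c^3 * e^3 + 23662800 * c^4 + 161740800 * c^4 * e + 455943600 *
     c^4 * e^2 + 26870400 * c^5 + 135421200 * c^5 * e + 21740400 * c^6 + 1800 * a + 355100 * a * e +
     19832400 * a * e^2 + 171519600 * a * e^3 + 467577600 * a * e^4 + 219931600 * a * e^5 + 204600 * a *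
     c + 16534800 * a * c * e + 244305600 * a * c * e^2 + 976080000 * a * c * e^3 + 796034400 * a * c *
     e^4 + 4548400 * a * c^2 + 125421600 * a * c^2 * e + 802278400 * a * c^2 * e^2 + 1090759600 * a *
     c^2 * e^3 + 27748800 * a * c^3 + 324806400 * a * c^3 * e + 749716800 * a * c^3 * e^2 + 64800000 * a
     * c^4 + 277182000 * a * c^4 * e + 52725600 * a * c^5 + 11200 * a^2 + 1119600 * a^2 * e + 39995200 *
     a^2 * e^2 + 204624000 * a^2 * e^3 + 216090000 * a^2 * e^4 + 643200 * a^2 * c + 37689600 * a^2 * c *
     e + 327264000 * a^2 * c * e^2 + 552426000 * a^2 * c * e^3 + 11352000 * a^2 * c^2 + 194265600 * a^2
     * c^2 * e + 539991200 * a^2 * c^2 * e^2 + 50745600 * a^2 * c^3 + 254656800 * a^2 * c^3 * e +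
     58222800 * a^2 * c^4 + 25200 * a^3 + 3516800 * a^3 * e + 39155200 * a^3 * e^2 + 94334800 * a^3 *
     e^3 + 1868800 * a^3 * c + 45830400 * a^3 * c * e + 174708800 * a^3 * c * e^2 + 17766400 * a^3 * c^2
     + 118143200 * a^3 * c^2 * e + 34612800 * a^3 * c^3 + 97200 * a^4 + 3724800 * a^4 * e + 20375600 *
     a^4 * e^2 + 2870400 * a^4 * c + 26581200 * a^4 * c * e + 11299600 * a^4 * c^2 + 172800 * a^5 +
     2300400 * a^5 * e + 1903200 * a^5 * c + 129200 * a^6"

text \<open>The arguments are t, log' and its derivatives with \<open>L 1\<close> eliminated by the
  logarithm relation. The grouping 2^k m a^i c^j displays the order bound k + i + 4 j of each term,
  since 2, a and c have orders 1, 1 and 4.\<close>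

lemma pG2_value:
  fixes a c e :: "'a::idom"
  shows "pG2 (-2 - 2 * e - 2 * c - 2 * a) (-1 + 14 * e + 6 * c + 2 * a) (-2 + 238 * e + 54 * c + 10 * a)
     = 2 * (36 * a ^ 3 + 18 * c + (2 ^ 3 * (27 * (a ^ 0 * c ^ 2)) + 2 ^ 2 * (81 * (a ^ 0 * c ^ 3)) + 2 ^
     3 * (9 * (a ^ 1 * c ^ 1)) + 2 ^ 2 * (135 * (a ^ 1 * c ^ 2)) + 2 ^ 2 * (63 * (a ^ 2 * c ^ 1)) + e *
     pR2 a c e))"
  unfolding pG2_def pN2_def pR2_def power_0 by Groebner_Basis.algebra

lemma pG4_value:
  fixes a c e :: "'a::idom"
  shows "pG4 (-2 - 2 * e - 2 * c - 2 * a) (-1 + 14 * e + 6 * c + 2 * a) (-2 + 238 * e + 54 * c + 10 * a)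
     (-2 + 3598 * e + 390 * c + 34 * a) (-2 + 53998 * e + 2742 * c + 106 * a) a
    = 24 * (400 * a ^ 5 + 600 * a ^ 2 * c + (2 ^ 3 * (125 * (a ^ 0 * c ^ 2)) + 2 ^ 2 * (16575 * (a ^ 0 *
     c ^ 3)) + 2 ^ 4 * (38475 * (a ^ 0 * c ^ 4)) + 2 ^ 4 * (105975 * (a ^ 0 * c ^ 5)) + 2 ^ 7 * (14175 *
     (a ^ 0 * c ^ 6)) + 2 ^ 4 * (91125 * (a ^ 0 * c ^ 7)) + 2 ^ 2 * (3475 * (a ^ 1 * c ^ 2)) + 2 ^ 4 *
     (25575 * (a ^ 1 * c ^ 3)) + 2 ^ 4 * (143775 * (a ^ 1 * c ^ 4)) + 2 ^ 7 * (39825 * (a ^ 1 * c ^ 5))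
     + 2 ^ 4 * (253125 * (a ^ 1 * c ^ 6)) + 2 ^ 4 * (5225 * (a ^ 2 * c ^ 2)) + 2 ^ 10 * (1125 * (a ^ 2 *
     c ^ 3)) + 2 ^ 7 * (38475 * (a ^ 2 * c ^ 4)) + 2 ^ 4 * (323325 * (a ^ 2 * c ^ 5)) + 2 ^ 4 * (325 *
     (a ^ 3 * c ^ 1)) + 2 ^ 11 * (125 * (a ^ 3 * c ^ 2)) + 2 ^ 8 * (8925 * (a ^ 3 * c ^ 3)) + 2 ^ 4 *
     (231525 * (a ^ 3 * c ^ 4)) + 2 ^ 4 * (1425 * (a ^ 4 * c ^ 1)) + 2 ^ 7 * (4325 * (a ^ 4 * c ^ 2)) +
     2 ^ 4 * (97575 * (a ^ 4 * c ^ 3)) + 2 ^ 7 * (525 * (a ^ 5 * c ^ 1)) + 2 ^ 4 * (23975 * (a ^ 5 * c ^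
     2)) + 2 ^ 7 * (25 * (a ^ 6 * c ^ 0)) + 2 ^ 4 * (3175 * (a ^ 6 * c ^ 1)) + 2 ^ 4 * (175 * (a ^ 7 * c
     ^ 0)) + e * pR4 a c e))"
  unfolding pG4_def pN4_def pdN3_def pN3_def pK2_def pdN2_def pN2_def pR4_def power_0 by Groebner_Basis.algebra

locale bp_two = bp_prime +
  assumes two: "p = 2"
begin

section \<open>Orders and leading parts at p = 2\<close>

lemma q_eq_1: "p - 1 = 1" using two by simp

lemma of_nat_p: "(of_nat p :: 'a::semiring_1) = 2" using two by simp

abbreviation l1 :: "qpoly fps" where "l1 \<equiv> L 1"
abbreviation la :: "qpoly fps" where "la \<equiv> L 2"
abbreviation lc :: "qpoly fps" where "lc \<equiv> L 3"
abbreviation le :: "qpoly fps" where "le \<equiv> L 4"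

lemma xo_a: "xo 1 la" and xo_c: "xo 4 lc" and xo_e: "xo 11 le"
proof -
  have "int (p ^ 2) - 1 - int (2 * (p - 1)) = 1" "int (p ^ 3) - 1 - int (3 * (p - 1)) = 4"
    "int (p ^ 4) - 1 - int (4 * (p - 1)) = 11" using two by simp_all
  then show "xo 1 la" "xo 4 lc" "xo 11 le"
    using xo_L[of 2] xo_L[of 3] xo_L[of 4] by (simp_all only:)
qed

lemma sum_lessThan_5: "(\<Sum>k<5. f k) = f 0 + f 1 + f 2 + f 3 + f 4" for f :: "nat \<Rightarrow> qpoly fps"
  by (simp add: eval_nat_numeral)

text \<open>Stopping at \<open>L 3\<close> would give precision 11 only. For n = 4 the result is
  needed to order 11 after a division by 24, which loses three orders, so \<open>L 4\<close> has to
  be included.\<close>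

lemma log_relation_4: "xo 26 (1 + l1 + la + lc + le)"
proof -
  have "prec 4 = 26" unfolding prec_def using two by simp
  moreover have "Suc 4 = (5::nat)" by simp
  ultimately show ?thesis using log_relation[of 4] by (simp only: sum_lessThan_5 L_0)
qed

lemma xo_two: "xo 1 2"
  using xo_p unfolding q_eq_1 of_nat_p by simp

lemma xo_two_power: "xo (int k) (2 ^ k)"
  using xo_power[OF xo_two, of k] by simp

lemma xo_half: "xo N (2 ^ j * f) \<Longrightarrow> xo (N - int j) f"
  using xo_div_p[of j f "2 ^ j * f" N] unfolding q_eq_1 of_nat_p by simp

abbreviation tt :: "qpoly fps" where "tt \<equiv> fps_const (v 1) * fps_X"
abbreviation uu :: "qpoly fps" where "uu \<equiv> fps_const (v 2) * fps_X ^ 3"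
abbreviation w3 :: "qpoly fps" where "w3 \<equiv> fps_const (v 3) * fps_X ^ 7"

lemma L_eq: "l1 = fps_const (ell p 1) * fps_X" "la = fps_const (ell p 2) * fps_X ^ 3"
  "lc = fps_const (ell p 3) * fps_X ^ 7"
proof -
  have "p ^ 1 - 1 = 1" "p ^ 2 - 1 = 3" "p ^ 3 - 1 = 7" using two by simp_all
  then show "l1 = fps_const (ell p 1) * fps_X" "la = fps_const (ell p 2) * fps_X ^ 3"
    "lc = fps_const (ell p 3) * fps_X ^ 7"
    unfolding L_def by (simp_all only: power_one_right)
qed

lemma two_const: "2 * (fps_const c * f) = fps_const (2 * c) * f" for c :: qpoly
  by (simp add: fps_numeral_fps_const mult.assoc[symmetric])

lemma tt_eq: "2 * l1 = tt"
  unfolding L_eq two_const using ell_1 unfolding of_nat_p by (simp only:)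

lemma la_eq: "2 * la = uu + l1 * tt ^ 2"
proof -
  have "2 * ell p 2 = v 2 + ell p 1 * v 1 ^ 2"
    using ell_rec[of 2] unfolding of_nat_p by (simp add: numeral_2_eq_2 two[unfolded numeral_2_eq_2])
  then show ?thesis unfolding L_eq two_const
    by (simp only:) (simp add: algebra_simps eval_nat_numeral flip: fps_const_add fps_const_mult)
qed

lemma lc_eq: "2 * lc = w3 + l1 * uu ^ 2 + la * tt ^ 4"
proof -
  have "2 * ell p 3 = (\<Sum>i<3. ell p i * v (3 - i) ^ (p ^ i))"
    using ell_rec[of 3] unfolding of_nat_p by simp
  also have "\<dots> = v 3 + ell p 1 * v 2 ^ (p ^ 1) + ell p 2 * v 1 ^ (p ^ 2)"
    by (simp add: numeral_3_eq_3 numeral_2_eq_2)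
  also have "p ^ 1 = 2" using two by simp
  also have "p ^ 2 = 4" using two by simp
  finally have "2 * ell p 3 = v 3 + ell p 1 * v 2 ^ 2 + ell p 2 * v 1 ^ 4" .
  then show ?thesis unfolding L_eq two_const
    by (simp only:) (simp add: algebra_simps eval_nat_numeral flip: fps_const_add fps_const_mult)
qed

lemma xo_tt: "xo 1 tt" and xo_uu: "xo 3 uu" and xo_w3: "xo 7 w3"
  using xo_mult_bp[OF bp_series_const[OF bp_poly_v[of p 1]] xo_X[of 1]]
    xo_mult_bp[OF bp_series_const[OF bp_poly_v[of p 2]] xo_X[of 3]]
    xo_mult_bp[OF bp_series_const[OF bp_poly_v[of p 3]] xo_X[of 7]] by simp_all

lemma xo_l1_plus: "xo 1 (l1 + 1)"
proof -
  have "xo 1 (1 + l1 + la + lc + le)" "xo 1 lc" "xo 1 le"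
    using log_relation_4 xo_c xo_e by (auto elim: xo_mono)
  from xo_diff[OF xo_diff[OF xo_diff[OF this(1) xo_a] this(2)] this(3)]
  show ?thesis by (simp add: algebra_simps)
qed

lemma xo_l1_minus: "xo 1 (l1 - 1)"
  using xo_diff[OF xo_l1_plus xo_two] by simp

lemma xo_mult': "xo N f \<Longrightarrow> xo N' g \<Longrightarrow> M \<le> N + N' \<Longrightarrow> xo M (f * g)"
  using xo_mult xo_mono by blast

lemma xo_power': "xo N f \<Longrightarrow> M \<le> int n * N \<Longrightarrow> xo M (f ^ n)"
  using xo_power xo_mono by blast

text \<open>Both summands have order 5 only: each begins with - t^6 / 2, and the halves add up to a
  term of order 6. The exact identity performs this cancellation before estimating; signs in order 6
  do not matter, as 2 has order 1.\<close>

lemma cubic_lead: "xo 7 (4 * la ^ 3 + 2 * lc - (tt ^ 6 + uu ^ 2))"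
proof -
  have e: "4 * la ^ 3 + 2 * lc - (tt ^ 6 + uu ^ 2) = la * uu ^ 2 + la * (uu * tt ^ 3)
     + la * (tt ^ 4 * ((l1 + 1) * (l1 - 1))) + uu * tt ^ 4 + (l1 - 1) * tt ^ 6 + w3 + (l1 - 1) * uu ^ 2"
    using tt_eq la_eq lc_eq by Groebner_Basis.algebra
  show ?thesis unfolding e
  proof (intro xo_add)
    show "xo 7 (la * uu ^ 2)" by (rule xo_mult'[OF xo_a xo_power[OF xo_uu]]) simp
    show "xo 7 (la * (uu * tt ^ 3))" by (rule xo_mult'[OF xo_a xo_mult[OF xo_uu xo_power[OF xo_tt]]]) simp
    show "xo 7 (la * (tt ^ 4 * ((l1 + 1) * (l1 - 1))))"
      by (rule xo_mult'[OF xo_a xo_mult[OF xo_power[OF xo_tt] xo_mult[OF xo_l1_plus xo_l1_minus]]]) simp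
    show "xo 7 (uu * tt ^ 4)" by (rule xo_mult'[OF xo_uu xo_power[OF xo_tt]]) simp
    show "xo 7 ((l1 - 1) * tt ^ 6)" by (rule xo_mult'[OF xo_l1_minus xo_power[OF xo_tt]]) simp
    show "xo 7 w3" by (rule xo_w3)
    show "xo 7 ((l1 - 1) * uu ^ 2)" by (rule xo_mult'[OF xo_l1_minus xo_power[OF xo_uu]]) simp
  qed
qed

text \<open>(2 a)^2 times the cubic form leads with t^4 (t^6 + u^2). The remaining 16 a^2 c leads
  with - t^10, as 2 c contains a t^4, so the powers of t alone cancel and t^4 u^2 is left.\<close>

lemma quintic_lead: "xo 11 (16 * la ^ 5 + 24 * la ^ 2 * lc - tt ^ 4 * uu ^ 2)"
proof -
  have t2: "xo 2 (- (tt ^ 2))" using xo_neg[OF xo_power[OF xo_tt, of 2]] by simp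
  have "2 * la - - (tt ^ 2) = uu + (l1 + 1) * tt ^ 2" unfolding la_eq by (simp add: algebra_simps)
  moreover have "xo 3 ((l1 + 1) * tt ^ 2)" by (rule xo_mult'[OF xo_l1_plus xo_power[OF xo_tt]]) simp
  ultimately have a: "xo (2 + 1) (2 * la - - (tt ^ 2))" using xo_add[OF xo_uu] by simp
  have a2: "xo (4 + 1) ((2 * la) ^ 2 - tt ^ 4)" using lead_power[OF a t2, of 2] by (simp flip: power_mult)
  have a3: "xo (6 + 1) ((2 * la) ^ 3 - - (tt ^ 6))" using lead_power[OF a t2, of 3]
    by (simp flip: power_mult)
  have t4: "xo 4 (tt ^ 4)" and t6: "xo 6 (- (tt ^ 6))"
    using xo_power[OF xo_tt, of 4] xo_neg[OF xo_power[OF xo_tt, of 6]] by simp_all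
  have k: "xo 6 (tt ^ 6 + uu ^ 2)"
    using xo_add[OF xo_power'[OF xo_tt, of 6 6] xo_power'[OF xo_uu, of 6 2]] by simp
  have p1: "xo 11 ((2 * la) ^ 2 * (4 * la ^ 3 + 2 * lc) - tt ^ 4 * (tt ^ 6 + uu ^ 2))"
    using lead_mult[OF a2 t4 _ k, of "4 * la ^ 3 + 2 * lc"] cubic_lead by simp
  have p2: "xo 11 ((2 * la) ^ 3 * tt ^ 4 - - (tt ^ 6) * tt ^ 4)"
    using lead_mult[OF a3 t6 _ t4, of "tt ^ 4"] by (simp add: xo_zero)
  have p3: "xo 11 (2 ^ 3 * (la ^ 2 * (w3 + l1 * uu ^ 2)))"
  proof (rule xo_mult'[OF xo_two_power xo_mult[OF xo_power[OF xo_a]]])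
    show "xo 6 (w3 + l1 * uu ^ 2)"
      by (rule xo_add[OF xo_mono[OF xo_w3] xo_mult0[OF xo_0_L xo_power'[OF xo_uu]]]) simp_all
  qed simp
  have e: "16 * la ^ 5 + 24 * la ^ 2 * lc - tt ^ 4 * uu ^ 2 =
     ((2 * la) ^ 2 * (4 * la ^ 3 + 2 * lc) - tt ^ 4 * (tt ^ 6 + uu ^ 2))
     + ((2 * la) ^ 3 * tt ^ 4 - - (tt ^ 6) * tt ^ 4) + 2 ^ 3 * (la ^ 2 * (w3 + l1 * uu ^ 2))"
    using lc_eq by Groebner_Basis.algebra
  show ?thesis unfolding e by (intro xo_add p1 p2 p3)
qed

section \<open>Coefficients of the formal group law through the Euler operator\<close>

definition th :: "qpoly fps \<Rightarrow> qpoly fps" where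
  "th f = fps_X * fps_deriv f"

lemma th_simps: "th (a + b) = th a + th b" "th (a - b) = th a - th b" "th (a * b) = th a * b + a * th b"
  "th (numeral n) = 0" "th 1 = 0" "th (- a) = - th a"
  by (simp_all add: th_def algebra_simps)

lemma th_tt: "th tt = tt"
  by (simp add: th_def)

lemma th_nth: "th f $ n = of_nat n * f $ n"
  by (cases n) (simp_all add: th_def)

lemma th_L: "th (L k) = of_nat (p ^ k - 1) * L k"
  by (rule fps_ext) (simp add: th_nth L_def fps_X_power_nth fps_mult_of_nat_nth)

definition Lf :: "qpoly fps" where "Lf = fps_deriv (lg p)"

lemma xo_low: "bp_series p f \<Longrightarrow> (\<And>n. n < N \<Longrightarrow> f $ n = 0) \<Longrightarrow> xo (int N) f"
  using xo_mult[OF xo_X xo_bp[OF bp_series_shift], of f N N] fps_shift_eq[of N f] by simp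

text \<open>The next term of log' has degree 2^5 - 1 = 31. All coefficients of log' are integral,
  because p^k \<open>ell p k\<close> is, so the error loses nothing to denominators, and the Euler
  operator preserves its order.\<close>

lemma Lf_approx: "xo 31 ((th ^^ j) Lf - (\<Sum>k<5. of_nat (p ^ k * (p ^ k - 1) ^ j) * L k))"
proof -
  define R where "R = Lf - (\<Sum>k<5. of_nat (p ^ k) * L k)"
  have thsum: "th (\<Sum>k<5. f k) = (\<Sum>k<5. th (f k))" for f :: "nat \<Rightarrow> _"
    unfolding sum_lessThan_5 th_simps ..
  have thn: "th (of_nat n * f) = of_nat n * th f" for n f
    by (simp add: th_def algebra_simps)
  have "(th ^^ j) R = (th ^^ j) Lf - (\<Sum>k<5. of_nat (p ^ k * (p ^ k - 1) ^ j) * L k)"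
  proof (induction j)
    case 0
    then show ?case by (simp add: R_def)
  next
    case (Suc j)
    have "(\<Sum>k<5. of_nat (p ^ k * (p ^ k - 1) ^ j) * th (L k))
        = (\<Sum>k<5. of_nat (p ^ k * (p ^ k - 1) ^ Suc j) * L k)"
      unfolding th_L by (intro sum.cong refl) (simp add: mult_ac)
    then show ?case unfolding funpow.simps o_apply Suc th_simps(2) thsum thn by (simp only:)
  qed
  moreover have "bp_series p ((th ^^ j) R) \<and> (\<forall>n<31. ((th ^^ j) R) $ n = 0)"
  proof (induction j)
    case 0
    have "bp_series p Lf" unfolding bp_series_def
    proof
      fix n
      show "bp_poly p (Lf $ n)"
      proof (cases "Suc n \<in> range (\<lambda>k. p ^ k)")
        case True
        then obtain k where k: "Suc n = p ^ k" by auto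
        have "Lf $ n = of_nat (Suc n) * lg p $ Suc n" by (simp add: Lf_def)
        then show ?thesis unfolding k lg_nth_power using bp_ell[of k] by simp
      qed (simp add: Lf_def lg_nth_other bp_poly.zero)
    qed
    moreover have "bp_series p (of_nat (p ^ k) * L k)" for k
      using bp_p_power_L[of k] bp_series.mult[OF bp_series.power[OF bp_series_X] bp_series_const[OF bp_ell]]
      by (simp only: of_nat_power)
    ultimately have "bp_series p R" unfolding R_def by (intro bp_series.diff bp_series.sum)
    moreover have "R $ n = 0" if n: "n < 31" for n
    proof -
      have Ln: "(of_nat (p ^ k) * L k) $ n = (if Suc n = p ^ k then of_nat (p ^ k) * ell p k else 0)" for k
      proof -
        have "n = p ^ k - 1 \<longleftrightarrow> Suc n = p ^ k" using p_pos by (metis Suc_pred' diff_Suc_1 zero_less_power)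
        then show ?thesis by (simp add: L_def fps_mult_of_nat_nth fps_X_power_nth del: of_nat_power)
      qed
      have Lfn: "Lf $ n = of_nat (Suc n) * lg p $ Suc n" by (simp add: Lf_def)
      show ?thesis
      proof (cases "Suc n \<in> range (\<lambda>k. p ^ k)")
        case True
        then obtain k where k: "Suc n = p ^ k" by auto
        have "p ^ k < p ^ 5" using n k two by simp
        then have k5: "k < 5" using p2 by (simp add: power_less_imp_less_exp)
        have "(\<Sum>k<5. of_nat (p ^ k) * L k) $ n
            = (\<Sum>k'<5. if k' = k then of_nat (p ^ k) * ell p k else 0)"
          unfolding fps_sum_nth Ln k using p2 by (intro sum.cong refl) (auto simp: power_inject_exp)
        then show ?thesis using k5 unfolding R_def fps_sub_nth Lfn k lg_nth_power by simp
      next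
        case False
        then have "Suc n \<noteq> p ^ k" for k by blast
        then have "(\<Sum>k<5. of_nat (p ^ k) * L k) $ n = 0"
          unfolding fps_sum_nth Ln by (intro sum.neutral) auto
        then show ?thesis unfolding R_def fps_sub_nth Lfn using lg_nth_other[OF False] by simp
      qed
    qed
    ultimately show ?case by simp
  next
    case (Suc j)
    have "bp_series p (th f)" if "bp_series p f" for f
      using that unfolding th_def bp_series_def
      by (auto intro!: bp_poly.mult bp_poly.zero bp_poly.of_nat simp del: of_nat_Suc)
    moreover have "th f $ n = 0" if "\<forall>n<31. f $ n = 0" "n < 31" for f n
      using that by (cases n) (auto simp: th_def)
    ultimately show ?case using Suc by simp
  qed
  ultimately show ?thesis using xo_low[of "(th ^^ j) R" 31] by simp
qed

definition H :: "nat \<Rightarrow> qpoly fps" where "H k = Zh 1 $ k"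

lemma H_0: "H 0 = 1"
  unfolding H_def Zh_0 rho_def fmul_1 by (rule fps_ext) (simp add: fps_X_nth)

lemma H_Suc: "H (Suc k) = fps_X ^ k * Z 1 $ Suc k"
  by (simp add: H_def Zh_def)

lemma Lf_nth: "Lf $ 0 = 1" "Lf $ 1 = v 1" "Lf $ 2 = 0" "Lf $ 3 = 4 * ell p 2"
proof -
  have pk: "p ^ 1 = 2" "p ^ 2 = 4" using two by simp_all
  have L: "Lf $ n = of_nat (Suc n) * lg p $ Suc n" for n by (simp add: Lf_def)
  have l2: "lg p $ 2 = ell p 1" "lg p $ 4 = ell p 2"
    using lg_nth_power[of 1] lg_nth_power[of 2] unfolding pk by simp_all
  have s: "Suc 0 = 1" "Suc 1 = 2" "Suc 2 = 3" "Suc 3 = 4" by simp_all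
  show "Lf $ 0 = 1" unfolding L s lg_1 by simp
  show "Lf $ 1 = v 1" unfolding L s l2 using ell_1 unfolding of_nat_p by simp
  show "Lf $ 3 = 4 * ell p 2" unfolding L s l2 by simp
  have "3 \<noteq> p ^ k" for k
  proof (cases k)
    case (Suc j)
    then have "even (p ^ k)" using two by simp
    then show ?thesis by (metis odd_numeral)
  qed simp
  then have "lg p $ 3 = 0" by (intro lg_nth_other) auto
  then show "Lf $ 2 = 0" unfolding L s by simp
qed

text \<open>This is \<open>Z_recursion\<close> multiplied by xi^k; the terms - H 2 and - 2 H 3 come
  from differentiating the scaling powers of xi. The coefficients of log' that enter are 1, v_1, 0
  and 4 \<open>ell p 2\<close>.\<close>

lemma H_rec:
  "H 1 * Lf = 1"
  "2 * H 2 * Lf = th (H 1) + tt"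
  "3 * H 3 * Lf = th (H 2) - H 2 + tt * th (H 1)"
  "4 * H 4 * Lf = th (H 3) - 2 * H 3 + tt * (th (H 2) - H 2) + 4 * la"
proof -
  let ?Z = "\<lambda>k. Z 1 $ k"
  note rec = Z_recursion[folded Lf_def]
  have Z0: "fps_deriv (?Z 0) = 1" unfolding Z_nth_0 fmul_1 by simp
  have s: "Suc 0 = 1" "Suc 1 = 2" "Suc 2 = 3" "Suc 3 = 4" by simp_all
  have a1: "{..1::nat} = {0, 1}" and a2: "{..2::nat} = {0, 1, 2}" and a3: "{..3::nat} = {0, 1, 2, 3}" by auto
  have H: "H 1 = ?Z 1" "H 2 = fps_X * ?Z 2" "H 3 = fps_X ^ 2 * ?Z 3" "H 4 = fps_X ^ 3 * ?Z 4"
    using H_Suc[of 0] H_Suc[of 1] H_Suc[of 2] H_Suc[of 3] unfolding s by simp_all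
  have r0: "?Z 1 * Lf = 1" using rec[of 0] by (simp add: Z0[unfolded One_nat_def] Lf_nth)
  have r1: "2 * ?Z 2 * Lf = fps_deriv (?Z 1) + fps_const (v 1)"
    using rec[of 1] unfolding s a1 by (simp add: Z0[unfolded One_nat_def] Lf_nth[unfolded One_nat_def])
  have r2: "3 * ?Z 3 * Lf = fps_deriv (?Z 2) + fps_const (v 1) * fps_deriv (?Z 1)"
    using rec[of 2] unfolding s a2 by (simp add: Z0[unfolded One_nat_def] Lf_nth[unfolded One_nat_def])
  have r3: "4 * ?Z 4 * Lf = fps_deriv (?Z 3) + fps_const (v 1) * fps_deriv (?Z 2) + fps_const (4 * ell p 2)"
    using rec[of 3] unfolding s a3 by (simp add: Z0[unfolded One_nat_def] Lf_nth[unfolded One_nat_def])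
  show "H 1 * Lf = 1" unfolding H by (rule r0)
  have t1: "th (H 1) = fps_X * fps_deriv (?Z 1)" unfolding H th_def ..
  have t2: "th (H 2) - H 2 = fps_X ^ 2 * fps_deriv (?Z 2)" unfolding H th_def
    by (simp add: power2_eq_square algebra_simps)
  have t3: "th (H 3) - 2 * H 3 = fps_X ^ 3 * fps_deriv (?Z 3)" unfolding H th_def
    by (simp add: eval_nat_numeral algebra_simps)
  have "2 * H 2 * Lf = fps_X * (2 * ?Z 2 * Lf)" unfolding H by (simp only: mult_ac)
  also have "\<dots> = th (H 1) + tt" unfolding r1 t1 by (simp add: algebra_simps)
  finally show "2 * H 2 * Lf = th (H 1) + tt" .
  have "3 * H 3 * Lf = fps_X ^ 2 * (3 * ?Z 3 * Lf)" unfolding H by (simp only: mult_ac)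
  also have "\<dots> = th (H 2) - H 2 + tt * th (H 1)" unfolding r2 t2 t1
    by (simp add: power2_eq_square algebra_simps)
  finally show "3 * H 3 * Lf = th (H 2) - H 2 + tt * th (H 1)" .
  have "4 * H 4 * Lf = fps_X ^ 3 * (4 * ?Z 4 * Lf)" unfolding H by (simp only: mult_ac)
  also have "\<dots> = th (H 3) - 2 * H 3 + tt * (th (H 2) - H 2) + fps_const (4 * ell p 2) * fps_X ^ 3"
    unfolding r3 t3 t2 by (simp add: eval_nat_numeral algebra_simps del: fps_const_mult)
  also have "fps_const (4 * ell p 2) * fps_X ^ 3 = 4 * la"
    unfolding L_eq by (simp add: fps_numeral_fps_const mult.assoc[symmetric])
  finally show "4 * H 4 * Lf = th (H 3) - 2 * H 3 + tt * (th (H 2) - H 2) + 4 * la" .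
qed

abbreviation y1 :: "qpoly fps" where "y1 \<equiv> th Lf"
abbreviation y2 :: "qpoly fps" where "y2 \<equiv> th (th Lf)"
abbreviation y3 :: "qpoly fps" where "y3 \<equiv> th (th (th Lf))"

lemma th_pN2: "th t = t \<Longrightarrow> th (pN2 t x (th x)) = pdN2 t x (th x) (th (th x))"
  unfolding pN2_def pdN2_def power2_eq_square th_simps by (simp add: algebra_simps)

lemma th_pN3:
  assumes t: "th t = t"
  shows "th (pN3 t x (th x) (th (th x))) = pdN3 t x (th x) (th (th x)) (th (th (th x)))"
  unfolding pN3_def pK2_def th_simps th_pN2[OF t] unfolding pdN2_def power2_eq_square th_simps t
  unfolding pdN3_def pdN2_def pN2_def power2_eq_square by (simp add: algebra_simps)

lemma H_values:
  "2 * H 2 * Lf ^ 3 = pN2 tt Lf y1"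
  "6 * H 3 * Lf ^ 5 = pN3 tt Lf y1 y2"
  "24 * H 4 * Lf ^ 7 = pN4 tt Lf y1 y2 y3 la"
proof -
  \<comment> \<open>\<open>A1\<close> to \<open>A5\<close> are quotient rules and recursion steps
    with the powers of log' cleared, over free variables; primes denote the image under
    \<open>th\<close>.\<close>
  have A1: "2 * h' * L ^ 4 = L * P - 3 * N * y"
    if "2 * h' * L ^ 3 + 6 * h * L ^ 2 * y = P" "2 * h * L ^ 3 = N" for h h' L N P y :: "qpoly fps"
    unfolding that[symmetric] by Groebner_Basis.algebra
  have A2: "2 * (h' - h) * L ^ 4 = L * P - 3 * N * y - N * L"
    if "2 * h' * L ^ 4 = L * P - 3 * N * y" "2 * h * L ^ 3 = N" for h h' L N P y :: "qpoly fps"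
  proof -
    have "2 * (h' - h) * L ^ 4 = 2 * h' * L ^ 4 - 2 * h * L ^ 3 * L" by Groebner_Basis.algebra
    then show ?thesis by (simp only: that)
  qed
  have A3: "6 * h * L ^ 5 = K - 2 * t * L ^ 2 * y"
    if "3 * h * L = g' - g + t * f'" "2 * (g' - g) * L ^ 4 = K" "f' * L ^ 2 = - y"
    for f' g g' h K L t y :: "qpoly fps"
  proof -
    have "6 * h * L ^ 5 = 2 * (3 * h * L) * L ^ 4" by Groebner_Basis.algebra
    also have "\<dots> = 2 * (g' - g) * L ^ 4 + 2 * t * L ^ 2 * (f' * L ^ 2)"
      unfolding that(1) by Groebner_Basis.algebra
    finally show ?thesis unfolding that by simp
  qed
  have A4: "6 * h' * L ^ 6 = L * P - 5 * N * y"
    if "6 * h' * L ^ 5 + 30 * h * L ^ 4 * y = P" "6 * h * L ^ 5 = N" for h h' L N P y :: "qpoly fps"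
    unfolding that[symmetric] by Groebner_Basis.algebra
  have A5: "24 * h * L ^ 7 = L * P - 5 * N * y - 2 * N * L + 3 * t * L ^ 2 * K + 24 * a * L ^ 6"
    if "4 * h * L = f' - 2 * f + t * (g' - g) + 4 * a" "6 * f' * L ^ 6 = L * P - 5 * N * y"
      "2 * (g' - g) * L ^ 4 = K" "6 * f * L ^ 5 = N"
    for a f f' g g' h K L N P t y :: "qpoly fps"
  proof -
    have "24 * h * L ^ 7 = 6 * (4 * h * L) * L ^ 6" by Groebner_Basis.algebra
    also have "\<dots> = 6 * f' * L ^ 6 - 2 * (6 * f * L ^ 5) * L + 3 * t * L ^ 2 * (2 * (g' - g) * L ^ 4)
        + 24 * a * L ^ 6"
      unfolding that(1) by Groebner_Basis.algebra
    finally show ?thesis by (simp only: that)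
  qed
  have t1: "th (H 1) * Lf ^ 2 = - y1"
  proof -
    have "th (H 1) * Lf + H 1 * y1 = 0"
      using arg_cong[OF H_rec(1), of th] by (simp add: th_simps)
    then show ?thesis using H_rec(1) by Groebner_Basis.algebra
  qed
  show h2: "2 * H 2 * Lf ^ 3 = pN2 tt Lf y1"
    unfolding pN2_def using H_rec(2) t1 by Groebner_Basis.algebra
  note d2 = th_pN2[OF th_tt, of Lf]
  have t2: "2 * th (H 2) * Lf ^ 4 = Lf * pdN2 tt Lf y1 y2 - 3 * pN2 tt Lf y1 * y1"
  proof -
    have "2 * th (H 2) * Lf ^ 3 + 6 * H 2 * Lf ^ 2 * y1 = pdN2 tt Lf y1 y2"
      using arg_cong[OF h2, of th] unfolding d2 power3_eq_cube power2_eq_square th_simps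
      by (simp add: algebra_simps)
    then show ?thesis using h2 by (rule A1)
  qed
  have k2: "2 * (th (H 2) - H 2) * Lf ^ 4 = pK2 tt Lf y1 y2"
    unfolding pK2_def using t2 h2 by (rule A2)
  show h3: "6 * H 3 * Lf ^ 5 = pN3 tt Lf y1 y2"
    unfolding pN3_def using H_rec(3) k2 t1 by (rule A3)
  note d3 = th_pN3[OF th_tt, of Lf]
  have t3: "6 * th (H 3) * Lf ^ 6 = Lf * pdN3 tt Lf y1 y2 y3 - 5 * pN3 tt Lf y1 y2 * y1"
  proof -
    have "6 * th (H 3) * Lf ^ 5 + 30 * H 3 * Lf ^ 4 * y1 = pdN3 tt Lf y1 y2 y3"
      using arg_cong[OF h3, of th] unfolding d3 by (simp add: th_simps algebra_simps eval_nat_numeral)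
    then show ?thesis using h3 by (rule A4)
  qed
  show "24 * H 4 * Lf ^ 7 = pN4 tt Lf y1 y2 y3 la"
    unfolding pN4_def using H_rec(4) t3 k2 h3 by (rule A5)
qed

section \<open>The class as a polynomial in \<open>la\<close>, \<open>lc\<close> and
  \<open>le\<close>\<close>

lemma MC_sum: "MC p n = (\<Sum>k\<le>n. fps_const (cc p (n - k)) * fps_X ^ (n - k) * mcn n k)"
proof -
  have "fps_X ^ n * MC p n
      = fps_X ^ n * (\<Sum>k\<le>n. fps_const (cc p (n - k)) * fps_X ^ (n - k) * mcn n k)"
    unfolding MC_def sum_distrib_left
  proof (intro sum.cong refl)
    fix k assume k: "k \<in> {..n}"
    then have X: "(fps_X :: qpoly fps) ^ n = fps_X ^ (n - k) * fps_X ^ k" by (simp flip: power_add)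
    have "fps_X ^ k * mc_coeff p n k = fps_X ^ n * mcn n k"
      using mc_coeff_mcn[of k n] k unfolding q_eq_1 by simp
    then show "fps_X ^ n * (fps_const (cc p (n - k)) * mc_coeff p n k) =
      fps_X ^ n * (fps_const (cc p (n - k)) * fps_X ^ (n - k) * mcn n k)"
      unfolding X[THEN arg_cong, of "\<lambda>x. x * (_ * mc_coeff p n k)"]
      by (metis (no_types, lifting) X mult.assoc mult.left_commute)
  qed
  then show ?thesis by (subst (asm) mult_left_cancel) auto
qed

lemma cc_values: "cc p 0 = 1" "cc p 1 = v 1" "cc p 2 = 0" "cc p 3 = 4 * ell p 2" "cc p 4 = 0"
proof -
  have pk: "p ^ 0 - 1 = 0" "p ^ 1 - 1 = 1" "p ^ 2 - 1 = 3" using two by simp_all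
  show "cc p 0 = 1" using cc_power[of 0] unfolding pk by simp
  show "cc p 1 = v 1" using cc_power[of 1] ell_1 unfolding pk by simp
  show "cc p 3 = 4 * ell p 2" using cc_power[of 2] unfolding pk of_nat_p by simp
  have o: "n \<notin> range (\<lambda>k. p ^ k)" if "odd n" "n \<noteq> 1" for n :: nat
  proof
    assume "n \<in> range (\<lambda>k. p ^ k)"
    then obtain k where k: "n = p ^ k" by auto
    then have "k \<noteq> 0" using that by (intro notI) simp
    then have "even n" using k two by simp
    then show False using that by simp
  qed
  show "cc p 2 = 0" "cc p 4 = 0" by (rule cc_other[OF o]; simp)+
qed

lemma P_eq: "P = Zh 1"
proof -
  have "{1..<p} = {1}" using two by auto
  then show ?thesis by (simp add: P_def)
qed

lemma D_powers:
  defines "D \<equiv> Zh 1 - 1"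
  shows "D $ 0 = 0" "\<And>k. k > 0 \<Longrightarrow> D $ k = H k"
    "(D ^ 2) $ 2 = H 1 ^ 2" "(D ^ 2) $ 3 = 2 * H 1 * H 2" "(D ^ 2) $ 4 = 2 * H 1 * H 3 + H 2 ^ 2"
    "(D ^ 3) $ 3 = H 1 ^ 3" "(D ^ 3) $ 4 = 3 * H 1 ^ 2 * H 2" "(D ^ 4) $ 4 = H 1 ^ 4"
proof -
  show D0: "D $ 0 = 0" using H_0 by (simp add: D_def H_def)
  show Dk: "D $ k = H k" if "k > 0" for k using that by (simp add: D_def H_def)
  have D: "D = fps_X * fps_shift 1 D" using fps_shift_eq[of 1 D] D0 by simp
  define G where "G = fps_shift 1 D"
  have G: "G $ 0 = H 1" "G $ 1 = H 2" "G $ 2 = H 3" by (simp_all add: G_def Dk numeral_2_eq_2 numeral_3_eq_3)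
  have Dn: "(D ^ j) $ (j + n) = (G ^ j) $ n" for j n
    unfolding G_def by (subst D) (simp add: power_mult_distrib fps_X_power_mult_nth)
  show "(D ^ 2) $ 2 = H 1 ^ 2" "(D ^ 3) $ 3 = H 1 ^ 3" "(D ^ 4) $ 4 = H 1 ^ 4"
    using Dn[of 2 0] Dn[of 3 0] Dn[of 4 0] by (simp_all add: fps_power_zeroth G)
  note G = G G[unfolded One_nat_def]
  have Dn': "(D ^ j) $ m = (G ^ j) $ n" if "m = j + n" for j m n
    unfolding that by (rule Dn)
  have e: "(D ^ 2) $ 3 = (G ^ 2) $ 1" "(D ^ 2) $ 4 = (G ^ 2) $ 2" "(D ^ 3) $ 4 = (G ^ 3) $ 1"
    by (rule Dn', simp)+
  show "(D ^ 2) $ 3 = 2 * H 1 * H 2" unfolding e unfolding power2_eq_square using G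
    by (simp add: fps_mult_nth)
  show "(D ^ 2) $ 4 = 2 * H 1 * H 3 + H 2 ^ 2" unfolding e unfolding power2_eq_square using G
    by (simp add: fps_mult_nth numeral_2_eq_2)
  show "(D ^ 3) $ 4 = 3 * H 1 ^ 2 * H 2" unfolding e unfolding power2_eq_square power3_eq_cube using G
    by (simp add: fps_mult_nth algebra_simps)
qed

lemma mcn_eq: "mcn n k = (\<Sum>j\<le>k. (-1) ^ j * of_nat ((n + j) choose j) * ((Zh 1 - 1) ^ j) $ k)"
proof -
  have P0: "P $ 0 = 1" using H_0 by (simp add: P_eq H_def)
  show ?thesis unfolding mcn_def P0 unfolding P_eq by simp
qed

lemma MC2_value: "2 * Lf ^ 3 * MC p 2 = pG2 tt Lf y1"
proof -
  have a1: "{..1::nat} = {0, 1}" and a2: "{..2::nat} = {0, 1, 2}" by auto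
  have m1: "mcn 2 1 = - 3 * H 1" and m2: "mcn 2 2 = - 3 * H 2 + 6 * H 1 ^ 2"
    unfolding mcn_eq a1 a2 using D_powers
    by (simp_all add: binomial_fact' fact_numeral[where 'a = nat] One_nat_def[symmetric] del: One_nat_def)
  have "MC p 2 = tt * mcn 2 1 + mcn 2 2"
    unfolding MC_sum a2 by (simp add: cc_values cc_values[unfolded One_nat_def])
  then show ?thesis unfolding m1 m2 pG2_def using H_values(1) H_rec(1) by Groebner_Basis.algebra
qed

lemma MC4_value: "24 * Lf ^ 7 * MC p 4 = pG4 tt Lf y1 y2 y3 la"
proof -
  have a1: "{..1::nat} = {0, 1}" and a3: "{..3::nat} = {0, 1, 2, 3}" and a4: "{..4::nat} = {0, 1, 2, 3, 4}" by auto
  have m1: "mcn 4 1 = - 5 * H 1" and m3: "mcn 4 3 = - 5 * H 3 + 30 * H 1 * H 2 - 35 * H 1 ^ 3"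
    and m4: "mcn 4 4 = - 5 * H 4 + 15 * (2 * H 1 * H 3 + H 2 ^ 2) - 105 * H 1 ^ 2 * H 2 + 70 * H 1 ^ 4"
    unfolding mcn_eq a1 a3 a4 using D_powers
    by (simp_all add: binomial_fact' fact_numeral[where 'a = nat] One_nat_def[symmetric] del: One_nat_def)
  have "fps_const (4 * ell p 2) * fps_X ^ 3 = 4 * la"
    unfolding L_eq by (simp add: fps_numeral_fps_const mult.assoc[symmetric])
  then have "MC p 4 = 4 * la * mcn 4 1 + tt * mcn 4 3 + mcn 4 4"
    unfolding MC_sum a4 by (simp add: cc_values cc_values[unfolded One_nat_def])
  then show ?thesis unfolding m1 m3 m4 pG4_def using H_values H_rec(1) by Groebner_Basis.algebra
qed

text \<open>Both sides are required to have order at least 0, which makes this a congruence for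
  products, so polynomials can be evaluated at approximate arguments.\<close>

definition near :: "qpoly fps \<Rightarrow> qpoly fps \<Rightarrow> bool" where
  "near a b \<longleftrightarrow> xo 26 (a - b) \<and> xo 0 a \<and> xo 0 b"

lemma near_mult: "near a b \<Longrightarrow> near c d \<Longrightarrow> near (a * c) (b * d)"
  unfolding near_def by (auto intro: xo_cong_mult X0.mult)

lemma near_add: "near a b \<Longrightarrow> near c d \<Longrightarrow> near (a + c) (b + d)"
  unfolding near_def using xo_add[of 26 "a - b" "c - d"] by (auto intro: X0.add simp: algebra_simps)

lemma near_diff: "near a b \<Longrightarrow> near c d \<Longrightarrow> near (a - c) (b - d)"
  unfolding near_def using xo_diff[of 26 "a - b" "c - d"] by (auto intro: X0.diff simp: algebra_simps)

lemma near_power: "near a b \<Longrightarrow> near (a ^ n) (b ^ n)"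
  unfolding near_def by (auto intro: xo_diff_power X0.power)

lemma near_refl: "xo 0 a \<Longrightarrow> near a a"
  by (simp add: near_def xo_zero)

lemma near_numeral: "near (numeral n) (numeral n)" "near (- numeral n) (- numeral n)"
  by (auto intro!: near_refl X0.numeral X0.neg)

lemmas near_rules = near_mult near_add near_diff near_power near_numeral

text \<open>The j-th Euler derivative of log' has coefficient 2^k (2^k - 1)^j at \<open>L k\<close>.
  Replacing \<open>l1\<close> by - 1 - \<open>la\<close> - \<open>lc\<close> - \<open>le\<close>
  lowers the constant and every other coefficient by 2.\<close>

lemma near_base:
  "near tt (-2 - 2 * le - 2 * lc - 2 * la)"
  "near Lf (-1 + 14 * le + 6 * lc + 2 * la)"
  "near y1 (-2 + 238 * le + 54 * lc + 10 * la)"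
  "near y2 (-2 + 3598 * le + 390 * lc + 34 * la)"
  "near y3 (-2 + 53998 * le + 2742 * lc + 106 * la)"
proof -
  have l1: "xo 26 (l1 - (- 1 - la - lc - le))" using log_relation_4 by (simp add: algebra_simps)
  have X: "xo 0 la" "xo 0 lc" "xo 0 le" "xo 0 l1" by (rule xo_0_L)+
  have gen: "near f (of_int c0 + of_int ca * la + of_int cc * lc + of_int ce * le)"
    if f: "xo 26 (f - (of_int b0 + of_int b1 * l1 + of_int ba * la + of_int bc * lc + of_int be * le))"
    and b: "c0 = b0 - b1" "ca = ba - b1" "cc = bc - b1" "ce = be - b1"
    for f and c0 ca cc ce b0 b1 ba bc be :: int
  proof -
    have "xo 26 (of_int b1 * (l1 - (- 1 - la - lc - le)))" by (rule xo_mult0[OF X0.of_int l1])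
    from xo_add[OF f this]
    have d: "xo 26 (f - (of_int c0 + of_int ca * la + of_int cc * lc + of_int ce * le))"
      unfolding b by (simp add: algebra_simps)
    have m: "xo 0 (of_int c0 + of_int ca * la + of_int cc * lc + of_int ce * le)"
      by (intro X0.add X0.mult X0.of_int X)
    have "xo 0 f" using xo_add[OF xo_mono[OF d, of 0] m] by simp
    then show ?thesis using d m by (simp add: near_def)
  qed
  have tt: "tt = of_int 0 + of_int 2 * l1 + of_int 0 * la + of_int 0 * lc + of_int 0 * le"
    using tt_eq by simp
  show "near tt (-2 - 2 * le - 2 * lc - 2 * la)"
  proof -
    have "-2 - 2 * le - 2 * lc - 2 * la
      = of_int (- 2) + of_int (- 2) * la + of_int (- 2) * lc + of_int (- 2) * le" by simp
    then show ?thesis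
      by (simp only:) (rule gen[of tt 0 2 0 0 0]; simp add: tt[symmetric, simplified] xo_zero)
  qed
  have pk: "p ^ 0 = 1" "p ^ 1 = 2" "p ^ 2 = 4" "p ^ 3 = 8" "p ^ 4 = 16" using two by simp_all
  have a: "xo 26 ((th ^^ j) Lf - (of_int (0 ^ j) + of_int 2 * l1 + of_int (4 * 3 ^ j) * la
      + of_int (8 * 7 ^ j) * lc + of_int (16 * 15 ^ j) * le))" for j
  proof -
    have "xo 26 ((th ^^ j) Lf - (\<Sum>k<5. of_nat (p ^ k * (p ^ k - 1) ^ j) * L k))"
      by (rule xo_mono[OF Lf_approx]) simp
    then show ?thesis unfolding sum_lessThan_5 pk by (cases j) simp_all
  qed
  have iter: "(th ^^ 0) Lf = Lf" "(th ^^ 1) Lf = y1" "(th ^^ 2) Lf = y2" "(th ^^ 3) Lf = y3"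
    by (simp_all add: eval_nat_numeral)
  show "near Lf (-1 + 14 * le + 6 * lc + 2 * la)"
  proof -
    have "-1 + 14 * le + 6 * lc + 2 * la
      = of_int (-1) + of_int 2 * la + of_int 6 * lc + of_int 14 * le"
      by simp
    moreover have "near ((th ^^ 0) Lf) (of_int (-1) + of_int 2 * la + of_int 6 * lc + of_int 14 * le)"
      by (rule gen[OF a]) simp_all
    ultimately show ?thesis by (simp only: iter)
  qed
  show "near y1 (-2 + 238 * le + 54 * lc + 10 * la)"
  proof -
    have "-2 + 238 * le + 54 * lc + 10 * la
      = of_int (-2) + of_int 10 * la + of_int 54 * lc + of_int 238 * le"
      by simp
    moreover have "near ((th ^^ 1) Lf) (of_int (-2) + of_int 10 * la + of_int 54 * lc + of_int 238 * le)"
      by (rule gen[OF a]) simp_all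
    ultimately show ?thesis by (simp only: iter)
  qed
  show "near y2 (-2 + 3598 * le + 390 * lc + 34 * la)"
  proof -
    have "-2 + 3598 * le + 390 * lc + 34 * la
      = of_int (-2) + of_int 34 * la + of_int 390 * lc + of_int 3598 * le"
      by simp
    moreover have "near ((th ^^ 2) Lf) (of_int (-2) + of_int 34 * la + of_int 390 * lc + of_int 3598 * le)"
      by (rule gen[OF a]) simp_all
    ultimately show ?thesis by (simp only: iter)
  qed
  show "near y3 (-2 + 53998 * le + 2742 * lc + 106 * la)"
  proof -
    have "-2 + 53998 * le + 2742 * lc + 106 * la
      = of_int (-2) + of_int 106 * la + of_int 2742 * lc + of_int 53998 * le"
      by simp
    moreover have "near ((th ^^ 3) Lf) (of_int (-2) + of_int 106 * la + of_int 2742 * lc + of_int 53998 * le)"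
      by (rule gen[OF a]) simp_all
    ultimately show ?thesis by (simp only: iter)
  qed
qed

lemma xo_term: "N \<le> int (k + i + 4 * j) \<Longrightarrow> xo N (2 ^ k * (numeral m * (la ^ i * lc ^ j)))"
  by (rule xo_mult'[OF xo_two_power xo_mult0[OF X0.numeral xo_mult[OF xo_power[OF xo_a] xo_power[OF xo_c]]]]) simp

lemma MC2_approx: "xo 7 (Lf ^ 3 * MC p 2 - (4 * la ^ 3 + 2 * lc))"
proof -
  let ?r = "2 ^ 3 * (27 * (la ^ 0 * lc ^ 2)) + 2 ^ 2 * (81 * (la ^ 0 * lc ^ 3)) + 2 ^ 3 * (9 * (la ^ 1 *
     lc ^ 1)) + 2 ^ 2 * (135 * (la ^ 1 * lc ^ 2)) + 2 ^ 2 * (63 * (la ^ 2 * lc ^ 1)) + le * pR2 la lc le"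
  have X: "xo 0 la" "xo 0 lc" "xo 0 le" by (rule xo_0_L)+
  have "near (pG2 tt Lf y1) (2 * (36 * la ^ 3 + 18 * lc + (?r)))"
    unfolding pG2_value[symmetric] pG2_def pN2_def by (intro near_rules near_base)
  then have "xo 26 (2 ^ 1 * (Lf ^ 3 * MC p 2 - (36 * la ^ 3 + 18 * lc + (?r))))"
    unfolding near_def MC2_value[symmetric] by (simp add: algebra_simps)
  from xo_half[OF this] have 1: "xo 7 (Lf ^ 3 * MC p 2 - (36 * la ^ 3 + 18 * lc + (?r)))"
    by (rule xo_mono) simp
  have "xo 11 (le * pR2 la lc le)"
    unfolding pR2_def using xo_mult0[OF _ xo_e]
    by (subst mult.commute) (intro xo_mult0[OF _ xo_e] X0.add X0.mult X0.power X0.numeral X)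
  \<comment> \<open>36 = 4 + 2^5 and 18 = 2 + 2^4; the surplus terms have order 8 and join the
    remainder.\<close>
  then have 2: "xo 7 (?r + (2 ^ 5 * (1 * (la ^ 3 * lc ^ 0)) + 2 ^ 4 * (1 * (la ^ 0 * lc ^ 1))))"
    using xo_term[of 7 5 3 0 Num.One] xo_term[of 7 4 0 1 Num.One]
    by (intro xo_add xo_term) (auto elim: xo_mono)
  from xo_add[OF 1 2] show ?thesis by (simp add: algebra_simps)
qed

lemma MC4_approx: "xo 11 (Lf ^ 7 * MC p 4 - (16 * la ^ 5 + 24 * la ^ 2 * lc))"
proof -
  let ?r = "2 ^ 3 * (125 * (la ^ 0 * lc ^ 2)) + 2 ^ 2 * (16575 * (la ^ 0 * lc ^ 3)) + 2 ^ 4 * (38475 *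
     (la ^ 0 * lc ^ 4)) + 2 ^ 4 * (105975 * (la ^ 0 * lc ^ 5)) + 2 ^ 7 * (14175 * (la ^ 0 * lc ^ 6)) + 2
     ^ 4 * (91125 * (la ^ 0 * lc ^ 7)) + 2 ^ 2 * (3475 * (la ^ 1 * lc ^ 2)) + 2 ^ 4 * (25575 * (la ^ 1 *
     lc ^ 3)) + 2 ^ 4 * (143775 * (la ^ 1 * lc ^ 4)) + 2 ^ 7 * (39825 * (la ^ 1 * lc ^ 5)) + 2 ^ 4 *
     (253125 * (la ^ 1 * lc ^ 6)) + 2 ^ 4 * (5225 * (la ^ 2 * lc ^ 2)) + 2 ^ 10 * (1125 * (la ^ 2 * lc ^
     3)) + 2 ^ 7 * (38475 * (la ^ 2 * lc ^ 4)) + 2 ^ 4 * (323325 * (la ^ 2 * lc ^ 5)) + 2 ^ 4 * (325 *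
     (la ^ 3 * lc ^ 1)) + 2 ^ 11 * (125 * (la ^ 3 * lc ^ 2)) + 2 ^ 8 * (8925 * (la ^ 3 * lc ^ 3)) + 2 ^
     4 * (231525 * (la ^ 3 * lc ^ 4)) + 2 ^ 4 * (1425 * (la ^ 4 * lc ^ 1)) + 2 ^ 7 * (4325 * (la ^ 4 *
     lc ^ 2)) + 2 ^ 4 * (97575 * (la ^ 4 * lc ^ 3)) + 2 ^ 7 * (525 * (la ^ 5 * lc ^ 1)) + 2 ^ 4 * (23975
     * (la ^ 5 * lc ^ 2)) + 2 ^ 7 * (25 * (la ^ 6 * lc ^ 0)) + 2 ^ 4 * (3175 * (la ^ 6 * lc ^ 1)) + 2 ^
     4 * (175 * (la ^ 7 * lc ^ 0)) + le * pR4 la lc le"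
  have X: "xo 0 la" "xo 0 lc" "xo 0 le" by (rule xo_0_L)+
  have "near (pG4 tt Lf y1 y2 y3 la) (24 * (400 * la ^ 5 + 600 * la ^ 2 * lc + (?r)))"
    unfolding pG4_value[symmetric] pG4_def pN4_def pdN3_def pN3_def pK2_def pdN2_def pN2_def
    by (intro near_rules near_base near_refl X)
  \<comment> \<open>24 = 2^3 * 3: cancelling 2^3 costs three of the 26 orders, cancelling 3 costs
    none.\<close>
  then have "xo 26 (2 ^ 3 * (3 * (Lf ^ 7 * MC p 4 - (400 * la ^ 5 + 600 * la ^ 2 * lc + (?r)))))"
    unfolding near_def MC4_value[symmetric] by (simp add: algebra_simps)
  from xo_half[OF this] have "xo 11 (of_nat 3 * (Lf ^ 7 * MC p 4)
      - of_nat 3 * (400 * la ^ 5 + 600 * la ^ 2 * lc + (?r)))"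
    by (rule xo_mono[THEN back_subst[of "xo 11"]]) (simp_all add: right_diff_distrib)
  then have 1: "xo 11 (Lf ^ 7 * MC p 4 - (400 * la ^ 5 + 600 * la ^ 2 * lc + (?r)))"
    by (rule xo_cancel_nat) (simp_all add: two)
  have "xo 11 (le * pR4 la lc le)"
    unfolding pR4_def
    by (subst mult.commute) (intro xo_mult0[OF _ xo_e] X0.add X0.mult X0.power X0.numeral X)
  \<comment> \<open>400 = 16 + 2^7 * 3 and 600 = 24 + 2^6 * 9; both surplus terms have order
    12.\<close>
  then have 2: "xo 11 (?r + (2 ^ 7 * (3 * (la ^ 5 * lc ^ 0)) + 2 ^ 6 * (9 * (la ^ 2 * lc ^ 1))))"
    by (intro xo_add xo_term) simp_all
  from xo_add[OF 1 2] show ?thesis by (simp add: algebra_simps)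
qed

section \<open>Removing the unit and reading off the lowest terms\<close>

lemma H1_lead: "xo (0 + 1) (H 1 - 1)" and xo_H1: "xo 0 (H 1)"
proof -
  show H0: "xo 0 (H 1)" using bp_Zh[of 1] unfolding H_def bp_series2_def by (blast intro: xo_bp)
  have z: "xo 1 (2 * (la + 3 * lc + 7 * le - 1))"
    by (rule xo_mult'[OF xo_two, of 0]) (intro X0.add X0.diff X0.mult X0.numeral X0.one xo_0_L, simp)
  have "xo 26 (Lf - (-1 + 14 * le + 6 * lc + 2 * la))" using near_base(2) unfolding near_def by blast
  from xo_add[OF xo_mono[OF this, of 1] z] have "xo 1 (Lf - 1)" by (simp add: algebra_simps)
  from xo_neg[OF xo_mult0[OF H0 this]] have "xo 1 (- (H 1 * (Lf - 1)))" .
  then show "xo (0 + 1) (H 1 - 1)" using H_rec(1) by (simp add: algebra_simps)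
qed

text \<open>\<open>H 1\<close> is the inverse of log' and is 1 up to order 1, so powers of log'
  leave leading parts unchanged.\<close>

lemma unit_cancel:
  assumes "xo (N + 1) (Lf ^ n * f - g)" "xo N g"
  shows "xo (N + 1) (f - g)"
proof -
  have "xo (0 + N + 1) (H 1 ^ n * (Lf ^ n * f) - 1 * g)"
    by (rule lead_mult) (use lead_power[OF H1_lead, of n] assms in \<open>auto intro: X0.one\<close>)
  moreover have "H 1 ^ n * (Lf ^ n * f) = f"
    by (simp only: mult.assoc[symmetric] power_mult_distrib[symmetric] H_rec(1) power_one mult_1)
  ultimately show ?thesis by (simp only: add_0 mult_1)
qed

lemma lookup_mon_scale: "Poly_Mapping.lookup (mon_scale n m) i = n * Poly_Mapping.lookup m i"
  by (induction n) (simp_all add: mon_scale_def lookup_add del: sum_constant)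

lemma lowest_term_MC2: "lowest_term p (MC p 2) 6 (v 1 ^ 6 + v 2 ^ 2)"
proof (rule lowest_termI)
  show "bp_series p (MC p 2)" by (rule bp_MC)
  show "bp_poly p (v 1 ^ 6 + v 2 ^ 2)" by (intro bp_poly.add bp_poly.power bp_poly_v)
  \<comment> \<open>Were the two monomials equal, the coefficient would be 2, which is not a binary
    digit.\<close>
  have "mon_scale 6 (Poly_Mapping.single 1 1) \<noteq> mon_scale 2 (Poly_Mapping.single 2 1)"
  proof
    assume "mon_scale 6 (Poly_Mapping.single 1 1) = mon_scale 2 (Poly_Mapping.single 2 1)"
    then have "Poly_Mapping.lookup (mon_scale 6 (Poly_Mapping.single 1 1)) 1
      = Poly_Mapping.lookup (mon_scale 2 (Poly_Mapping.single 2 1)) 1"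
      by simp
    then show False by (simp add: lookup_mon_scale lookup_single)
  qed
  then show "digit_poly p (v 1 ^ 6 + v 2 ^ 2)"
    using two unfolding v_def single_power digit_poly_def
    by (auto simp: lookup_add lookup_single when_def intro: exI[of _ 0] exI[of _ 1])
  have k: "xo 6 (tt ^ 6 + uu ^ 2)"
    using xo_add[OF xo_power'[OF xo_tt, of 6 6] xo_power'[OF xo_uu, of 6 2]] by simp
  have "xo (6 + 1) (Lf ^ 3 * MC p 2 - (tt ^ 6 + uu ^ 2))"
    using xo_trans[OF MC2_approx cubic_lead] by simp
  from unit_cancel[OF this k] have "xo 7 (MC p 2 - (tt ^ 6 + uu ^ 2))" by simp
  also have "tt ^ 6 + uu ^ 2 = fps_const (v 1 ^ 6 + v 2 ^ 2) * fps_X ^ 6"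
    by (simp add: power_mult_distrib distrib_right fps_const_power flip: power_mult fps_const_add)
  finally show "xo (int (Suc 6)) (MC p 2 - fps_const (v 1 ^ 6 + v 2 ^ 2) * fps_X ^ 6)" by simp
qed

lemma lowest_term_MC4: "lowest_term p (MC p 4) 10 (v 1 ^ 4 * v 2 ^ 2)"
proof (rule lowest_termI)
  show "bp_series p (MC p 4)" by (rule bp_MC)
  show "bp_poly p (v 1 ^ 4 * v 2 ^ 2)" by (intro bp_poly.mult bp_poly.power bp_poly_v)
  show "digit_poly p (v 1 ^ 4 * v 2 ^ 2)"
    using two unfolding v_def single_power digit_poly_def mult_single
    by (auto simp: lookup_single when_def intro: exI[of _ 0] exI[of _ 1])
  have k: "xo 10 (tt ^ 4 * uu ^ 2)"
    by (rule xo_mult'[OF xo_power[OF xo_tt] xo_power[OF xo_uu]]) simp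
  have "xo (10 + 1) (Lf ^ 7 * MC p 4 - tt ^ 4 * uu ^ 2)"
    using xo_trans[OF MC4_approx quintic_lead] by simp
  from unit_cancel[OF this k] have "xo 11 (MC p 4 - tt ^ 4 * uu ^ 2)" by simp
  also have "tt ^ 4 * uu ^ 2 = fps_const (v 1 ^ 4 * v 2 ^ 2) * fps_X ^ 10"
  proof -
    have "(fps_X :: qpoly fps) ^ 10 = fps_X ^ 4 * (fps_X ^ 3) ^ 2" by (simp flip: power_mult power_add)
    then show ?thesis
      by (simp add: power_mult_distrib fps_const_power mult_ac flip: fps_const_mult)
  qed
  finally show "xo (int (Suc 10)) (MC p 4 - fps_const (v 1 ^ 4 * v 2 ^ 2) * fps_X ^ 10)" by simp
qed

end

theorem theorem2p4:
  shows "lowest_term 2 (MC 2 2) 6 (v 1 ^ 6 + v 2 ^ 2)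
       \<and> lowest_term 2 (MC 2 4) 10 (v 1 ^ 4 * v 2 ^ 2)
       \<and> lowest_term 3 (MC 3 4) 22 (2 * v 1 ^ 9)
       \<and> lowest_term 5 (MC 5 8) 88 (3 * v 1 ^ 16)
       \<and> lowest_term 7 (MC 7 12) 192 (4 * v 1 ^ 22)
       \<and> lowest_term 11 (MC 11 20) 520 (9 * v 1 ^ 34)
       \<and> lowest_term 13 (MC 13 24) 744 (11 * v 1 ^ 40)"
proof -
  have two: "bp_two 2" by (simp add: bp_two_def bp_prime_def bp_two_axioms_def)
  show ?thesis
    using bp_two.lowest_term_MC2[OF two] bp_two.lowest_term_MC4[OF two]
      lowest_term_3 lowest_term_5 lowest_term_7 lowest_term_11 lowest_term_13 by blast
qed

end
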